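(* Let $p\ge1$, $\theta\in\mathbb{R}^p$, $|\rho|<1$, and consider the adaptively controlled ARX$(p,0)$ process with first-order autoregressive noise described in the context, with least squares estimator $\widehat\vartheta_n$ of $\vartheta$. Assume that $\rho\ne0$ and that $(V_n)$ has a finite conditional moment of order $>2$. Then $\widehat\vartheta_n$ converges almost surely to $\vartheta$, and $$\|\widehat\vartheta_n-\vartheta\|^2=\mathcal{O}\left(\frac{\log n}{n}\right)\quad\text{a.s.}$$
   Context: Model. For all $n\ge 0$, $$X_{n+1}=\sum_{k=1}^p\theta_kX_{n-k+1}+U_n+\varepsilon_{n+1},\qquad \varepsilon_{n+1}=\rho\varepsilon_n+V_{n+1},$$ with $\theta=(\theta_1,\dots,\theta_p)^t\in\mathbb{R}^p$, $|\rho|<1$. Initial values ($X_k$ for $k\le 0$, $\varepsilon_0$, $U_0$, $U_{-1}$) are arbitrary ($\mathcal F_0$-measurable). $(V_n)$ is a martingale difference sequence adapted to a filtration $(\mathcal F_n)$ with $\mathbb{E}[V_{n+1}^2\mid\mathcal F_n]=\sigma^2$ a.s. for all $n\ge0$, where $\sigma^2>0$ is a constant. "Finite conditional moment of order $>2$" means: there is $a>2$ with $\sup_{n\ge0}\mathbb{E}[|V_{n+1}|^a\mid\mathcal F_n]<\infty$ a.s. Regression vector and parameter. $\Phi_n=(X_n,X_{n-1},\dots,X_{n-p+1},X_{n-p},U_{n-1})^t\in\mathbb{R}^{p+2}$, and $\vartheta\in\mathbb{R}^{p+2}$ is $$\vartheta=\begin{pmatrix}\theta\\0\\0\end{pmatrix}-\rho\begin{pmatrix}-1\\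 \theta\\ 1\end{pmatrix},$$ so that for $n\ge 1$, $X_{n+1}=\vartheta^t\Phi_n+U_n+V_{n+1}$. Estimator and control. $S_n=\sum_{k=0}^n\Phi_k\Phi_k^t+I_{p+2}$; the least squares estimator satisfies, for $n\ge0$, $$\widehat\vartheta_{n+1}=\widehat\vartheta_n+S_n^{-1}\Phi_n\bigl(X_{n+1}-U_n-\widehat\vartheta_n^{\,t}\Phi_n\bigr),$$ with $\widehat\vartheta_0$ arbitrary. The adaptive tracking control is $U_n=x_{n+1}-\widehat\vartheta_n^{\,t}\Phi_n$ (for $n\ge 1$; $U_0$ may be arbitrary), where $(x_n)$ is a predictable real reference trajectory ($x_{n+1}$ is $\mathcal F_n$-measurable) satisfying $\sum_{k=1}^n x_k^2=o(n)$ a.s. *)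

theory Defs
  imports
    "HOL-Probability.Probability"
    "HOL-Library.Landau_Symbols"
    "Jordan_Normal_Form.Gauss_Jordan_Elimination"
begin

text \<open>
  Since the lags range up to \<open>p\<close> and the regression vector lives in dimension \<open>p + 2\<close>, vectors
  and matrices are those of \<open>Jordan_Normal_Form\<close>, with explicit dimensions. The parameter
  \<open>\<theta>\<^sub>k\<close>, for \<open>1 \<le> k \<le> p\<close>, is \<open>\<theta> $ (k - 1)\<close>. The processes \<open>X\<close> and \<open>U\<close> are indexed by \<open>int\<close>,
  because negative times enter through the initial values.
\<close>

hide_type (open) Finite_Cartesian_Product.vec
hide_const (open) Finite_Cartesian_Product.vec
no_notation inner (infix "\<bullet>" 70)
no_notation Finite_Cartesian_Product.vec_nth (infixl "$" 90)

definition vec_norm2 :: "real vec \<Rightarrow> real"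
  where "vec_norm2 v = sqrt (v \<bullet> v)"

text \<open>
  Only \<open>V\<^sub>1, V\<^sub>2, \<dots>\<close> drive the process, so \<open>V 0\<close> is left unconstrained here and in the two moment
  conditions below.
\<close>

definition martingale_difference ::
    "'a measure \<Rightarrow> (nat \<Rightarrow> 'a measure) \<Rightarrow> (nat \<Rightarrow> 'a \<Rightarrow> real) \<Rightarrow> bool"
  where "martingale_difference M F V \<longleftrightarrow>
    (\<forall>n. V (Suc n) \<in> borel_measurable (F (Suc n)) \<and> integrable M (V (Suc n)) \<and>
         (AE \<omega> in M. real_cond_exp M (F n) (V (Suc n)) \<omega> = 0))"

text \<open>
  Conditional moments use the \<open>ennreal\<close>-valued conditional expectation: its real-valued
  counterpart sends the value \<open>\<infinity>\<close> to \<open>0\<close>.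
\<close>

definition constant_conditional_variance ::
    "'a measure \<Rightarrow> (nat \<Rightarrow> 'a measure) \<Rightarrow> (nat \<Rightarrow> 'a \<Rightarrow> real) \<Rightarrow> real \<Rightarrow> bool"
  where "constant_conditional_variance M F V sigma_sq \<longleftrightarrow>
    (\<forall>n. AE \<omega> in M. nn_cond_exp M (F n) (\<lambda>\<eta>. ennreal ((V (Suc n) \<eta>)\<^sup>2)) \<omega> = ennreal sigma_sq)"

definition finite_conditional_moment_gt2 ::
    "'a measure \<Rightarrow> (nat \<Rightarrow> 'a measure) \<Rightarrow> (nat \<Rightarrow> 'a \<Rightarrow> real) \<Rightarrow> bool"
  where "finite_conditional_moment_gt2 M F V \<longleftrightarrow>
    (\<exists>a>2. AE \<omega> in M.
       (SUP n. nn_cond_exp M (F n) (\<lambda>\<eta>. ennreal (\<bar>V (Suc n) \<eta>\<bar> powr a)) \<omega>) < \<infinity>)"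

definition regression_vector ::
    "nat \<Rightarrow> (int \<Rightarrow> 'a \<Rightarrow> real) \<Rightarrow> (int \<Rightarrow> 'a \<Rightarrow> real) \<Rightarrow> nat \<Rightarrow> 'a \<Rightarrow> real vec"
  where "regression_vector p X U n \<omega> =
    vec (p + 1) (\<lambda>i. X (int n - int i) \<omega>) @\<^sub>v vec_of_list [U (int n - 1) \<omega>]"

definition extended_parameter :: "real vec \<Rightarrow> real \<Rightarrow> real vec"
  where "extended_parameter \<theta> \<rho> =
    (\<theta> @\<^sub>v 0\<^sub>v 2) - \<rho> \<cdot>\<^sub>v (vec_of_list [-1] @\<^sub>v \<theta> @\<^sub>v vec_of_list [1])"

definition design_matrix :: "nat \<Rightarrow> (nat \<Rightarrow> real vec) \<Rightarrow> nat \<Rightarrow> real mat"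
  where "design_matrix d \<Phi> n =
    mat d d (\<lambda>(i, j). \<Sum>k\<le>n. \<Phi> k $ i * \<Phi> k $ j) + 1\<^sub>m d"

text \<open>
  The design matrix is positive definite, so \<open>mat_inverse\<close> returns its inverse (not \<open>None\<close>)
  wherever the estimator below uses it.
\<close>

definition least_squares_estimator ::
    "nat \<Rightarrow> (nat \<Rightarrow> real vec) \<Rightarrow> (int \<Rightarrow> real) \<Rightarrow> (int \<Rightarrow> real) \<Rightarrow> (nat \<Rightarrow> real vec) \<Rightarrow> bool"
  where "least_squares_estimator d \<Phi> X U \<theta>h \<longleftrightarrow>
    \<theta>h 0 \<in> carrier_vec d \<and>
    (\<forall>n. \<theta>h (Suc n) = \<theta>h n +
       (X (int n + 1) - U (int n) - \<theta>h n \<bullet> \<Phi> n) \<cdot>\<^sub>v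
         (the (mat_inverse (design_matrix d \<Phi> n)) *\<^sub>v \<Phi> n))"

end

theory Submission
  imports
    Defs
    "Jordan_Normal_Form.Determinant"
    "HOL-Real_Asymp.Real_Asymp"
begin

text \<open>
  Let \<open>e\<^sub>n\<close> be the estimation error, \<open>R\<^sub>n\<close> the identity plus the Gram matrix of the regressors before
  time \<open>n\<close>, and \<open>\<pi>\<^sub>n = e\<^sub>n \<bullet> \<Phi>\<^sub>n\<close> the prediction error. The control is chosen so that
  \<open>X\<^sub>n\<^sub>+\<^sub>1 = x\<^sub>n\<^sub>+\<^sub>1 + V\<^sub>n\<^sub>+\<^sub>1 - \<pi>\<^sub>n\<close>: the closed loop reproduces the noise up to the reference and the
  prediction error. The rate is the quotient of two estimates: the energy \<open>e\<^sub>n \<bullet> R\<^sub>n e\<^sub>n\<close> is of order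
  \<open>ln n\<close>, and the quadratic form of \<open>R\<^sub>n\<close> is at least a positive multiple of \<open>n\<close>.

  Upper bound. The least squares recursion satisfies an exact energy balance (\<open>energy_step\<close>). Its
  noise terms are of two kinds: a weighted sum of the noise, controlled by convergence of
  square-integrable martingales (\<open>AE_weighted_noise_sum\<close>), and a weighted sum of squares of the
  noise, which needs the moment of order above 2 (\<open>AE_weighted_square_sum\<close>). The weights sum up to
  at most \<open>ln (det R\<^sub>n)\<close>, so that the energy is of the order of the logarithm of
  \<open>r\<^sub>n = 1 + (\<Sum>k<n. \<parallel>\<Phi>\<^sub>k\<parallel>\<^sup>2)\<close>, and so is the sum of \<open>\<alpha>\<^sub>k = \<pi>\<^sub>k\<^sup>2 / (1 + g\<^sub>k)\<close>, where \<open>g\<^sub>k\<close> is the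
  leverage of \<open>\<Phi>\<^sub>k\<close> (\<open>energy_le\<close>). It remains to see that \<open>r\<^sub>n\<close> grows polynomially (\<open>ln_r_le\<close>). The
  square of the prediction error is at most \<open>2 \<alpha>\<^sub>n + \<alpha>\<^sub>n \<delta>\<^sub>n \<parallel>\<Phi>\<^sub>n\<parallel>\<^sup>2\<close>, where \<open>\<delta>\<^sub>n\<close>, the decrease of the trace
  of the inverse Gram matrix, is summable. The product of the factors \<open>1 + B \<alpha>\<^sub>k \<delta>\<^sub>k\<close> by which the state
  may grow is therefore at most an arbitrarily small power of \<open>r\<^sub>n\<close>, up to a constant.

  Lower bound. The model expresses \<open>U\<^sub>n\<^sub>-\<^sub>1\<close> by \<open>X\<^sub>n, \<dots>, X\<^sub>n\<^sub>-\<^sub>p\<close> and \<open>\<epsilon>\<^sub>n\<close>. Hence \<open>\<Phi>\<^sub>n\<close> is, up to the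
  reference and the prediction errors, a linear image of \<open>V\<^sub>n, \<dots>, V\<^sub>n\<^sub>-\<^sub>p, \<epsilon>\<^sub>n\<^sub>-\<^sub>p\<^sub>-\<^sub>1\<close>
  (\<open>regressor_decomposition\<close>). These noise variables are asymptotically orthogonal with sums of
  squares of order \<open>n\<close>. The linear map is injective because \<open>\<epsilon>\<^sub>n\<^sub>-\<^sub>p\<^sub>-\<^sub>1\<close> is multiplied by \<open>\<rho>\<close> to the
  power \<open>p + 1\<close> (\<open>noise_coeff_ge\<close>): here \<open>\<rho> \<noteq> 0\<close> is decisive. The prediction errors may be large
  only when the leverage exceeds 1. This happens \<open>O(ln n)\<close> times before \<open>n\<close>, and since the squares of
  the noise are \<open>O(n\<^sup>\<delta>)\<close> with some \<open>\<delta> < 1\<close>, these times can be left out (\<open>excitation\<close>).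

  Probability enters only through the almost sure behaviour of weighted sums of the noise. All other
  arguments concern one trajectory at a time, in the locales \<open>closed_loop\<close> and \<open>regular_path\<close>.
\<close>

hide_const (open) Determinants.det

section \<open>Rank-one updates and determinants\<close>

definition rank_one :: "real vec \<Rightarrow> real vec \<Rightarrow> real mat"
  where "rank_one a b = mat (dim_vec a) (dim_vec b) (\<lambda>(i, j). a $ i * b $ j)"

lemma rank_one_carrier [simp]:
  "a \<in> carrier_vec m \<Longrightarrow> b \<in> carrier_vec n \<Longrightarrow> rank_one a b \<in> carrier_mat m n"
  by (simp add: rank_one_def)

lemma dim_rank_one [simp]: "dim_row (rank_one a b) = dim_vec a" "dim_col (rank_one a b) = dim_vec b"
  by (simp_all add: rank_one_def)

lemma rank_one_mult_vec:
  assumes "a \<in> carrier_vec m" "b \<in> carrier_vec n" "x \<in> carrier_vec n"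
  shows "rank_one a b *\<^sub>v x = (b \<bullet> x) \<cdot>\<^sub>v a"
  using assms by (intro eq_vecI) (auto simp: rank_one_def scalar_prod_def sum_distrib_right sum_distrib_left ac_simps)

lemma smult_mat_mult_vec:
  fixes A :: "real mat"
  assumes "A \<in> carrier_mat m n" "x \<in> carrier_vec n"
  shows "(c \<cdot>\<^sub>m A) *\<^sub>v x = c \<cdot>\<^sub>v (A *\<^sub>v x)"
  using assms by (intro eq_vecI) (auto simp: scalar_prod_def sum_distrib_left ac_simps)

lemma mult_rank_one:
  assumes "A \<in> carrier_mat n m" "a \<in> carrier_vec m"
  shows "A * rank_one a b = rank_one (A *\<^sub>v a) b"
  using assms by (intro eq_matI) (auto simp: rank_one_def scalar_prod_def sum_distrib_right sum_distrib_left ac_simps)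

lemma rank_one_mult_symmetric:
  assumes "A \<in> carrier_mat m m" "b \<in> carrier_vec m"
    and "\<And>i j. i < m \<Longrightarrow> j < m \<Longrightarrow> A $$ (i, j) = A $$ (j, i)"
  shows "rank_one a b * A = rank_one a (A *\<^sub>v b)"
  using assms by (intro eq_matI) (auto simp: rank_one_def scalar_prod_def sum_distrib_right sum_distrib_left ac_simps intro!: sum.cong)

lemma rank_one_mult_rank_one:
  assumes "b \<in> carrier_vec m" "c \<in> carrier_vec m"
  shows "rank_one a b * rank_one c e = (b \<bullet> c) \<cdot>\<^sub>m rank_one a e"
  using assms by (intro eq_matI) (auto simp: rank_one_def scalar_prod_def sum_distrib_right sum_distrib_left ac_simps)

lemma scalar_prod_self_nonneg: "x \<bullet> x \<ge> (0::real)"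
  by (simp add: scalar_prod_def sum_nonneg)

lemma scalar_prod_Cauchy_Schwarz:
  fixes x y :: "real vec"
  assumes "x \<in> carrier_vec m" "y \<in> carrier_vec m"
  shows "(x \<bullet> y)\<^sup>2 \<le> (x \<bullet> x) * (y \<bullet> y)"
  using Cauchy_Schwarz_ineq_sum[of "\<lambda>i. x $ i" "\<lambda>i. y $ i" "{0..<m}"] assms
  by (simp add: scalar_prod_def power2_eq_square)

text \<open>
  Of the three block matrices multiplied below, the outer two have determinant 1 and the middle one has that of
  the left-hand side; the product is block triangular with the scalar \<open>1 + a \<bullet> b\<close> in the corner.
\<close>

lemma det_one_add_rank_one:
  assumes a: "a \<in> carrier_vec n" and b: "b \<in> carrier_vec n"
  shows "det (1\<^sub>m n + rank_one a b) = 1 + a \<bullet> b"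
proof -
  define u :: "real vec" where "u = vec 1 (\<lambda>_. 1)"
  have u: "u \<in> carrier_vec 1" by (simp add: u_def)
  let ?C = "rank_one a u" and ?B = "rank_one u b"
  have cC: "?C \<in> carrier_mat n 1" and cB: "?B \<in> carrier_mat 1 n" and cAB: "rank_one a b \<in> carrier_mat n n"
    using a b u by auto
  have uu: "u \<bullet> u = 1" by (simp add: u_def scalar_prod_def)
  let ?X = "four_block_mat (1\<^sub>m n) (0\<^sub>m n 1) ?B (1\<^sub>m 1)"
  let ?Y = "four_block_mat (1\<^sub>m n + rank_one a b) ?C (0\<^sub>m 1 n) (1\<^sub>m 1)"
  let ?Z = "four_block_mat (1\<^sub>m n) (0\<^sub>m n 1) (- ?B) (1\<^sub>m 1)"
  have CB: "?C * ?B = rank_one a b" using a b u uu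
    by (subst rank_one_mult_rank_one[OF u u]) (auto simp: )
  have BC: "?B * ?C = (a \<bullet> b) \<cdot>\<^sub>m 1\<^sub>m 1" using a b u
    by (subst rank_one_mult_rank_one[OF b a])
      (auto simp: rank_one_def u_def comm_scalar_prod[OF a b] intro!: eq_matI)
  have YZ: "?Y * ?Z = four_block_mat (1\<^sub>m n) ?C (- ?B) (1\<^sub>m 1)"
    using cC cB cAB a b u
    by (subst mult_four_block_mat[of _ n n _ 1 _ 1 _ _ n _ 1])
      (auto simp: CB rank_one_def intro!: cong_four_block_mat eq_matI, auto simp: scalar_prod_def u_def)
  have XYZ: "?X * (?Y * ?Z) = four_block_mat (1\<^sub>m n) ?C (0\<^sub>m 1 n) ((1 + a \<bullet> b) \<cdot>\<^sub>m 1\<^sub>m 1)"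
    unfolding YZ using cC cB cAB a b u
    apply (subst mult_four_block_mat[of _ n n _ 1 _ 1 _ _ n _ 1])
            apply (auto simp: BC intro!: cong_four_block_mat eq_matI)
    done
  have dF: "det (four_block_mat (1\<^sub>m n) ?C (0\<^sub>m 1 n) ((1 + a \<bullet> b) \<cdot>\<^sub>m 1\<^sub>m 1)) = 1 + a \<bullet> b"
    unfolding det_four_block_mat_lower_left_zero[OF one_carrier_mat cC refl smult_carrier_mat[OF one_carrier_mat]]
      det_one det_smult by simp
  have dM: "det (?X * (?Y * ?Z)) = det ?X * (det ?Y * det ?Z)"
  proof -
    have X: "?X \<in> carrier_mat (n + 1) (n + 1)" and Z: "?Z \<in> carrier_mat (n + 1) (n + 1)"
      by (rule four_block_carrier_mat[OF one_carrier_mat one_carrier_mat])+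
    have Y: "?Y \<in> carrier_mat (n + 1) (n + 1)"
      by (rule four_block_carrier_mat[OF add_carrier_mat[OF cAB] one_carrier_mat])
    show ?thesis
      unfolding det_mult[OF X mult_carrier_mat[OF Y Z]] det_mult[OF Y Z] ..
  qed
  have dX: "det ?X = 1"
    unfolding det_four_block_mat_upper_right_zero[OF one_carrier_mat refl cB one_carrier_mat] by (simp only: det_one mult_1)
  have dZ: "det ?Z = 1"
    unfolding det_four_block_mat_upper_right_zero[OF one_carrier_mat refl uminus_carrier_mat[OF cB] one_carrier_mat]
    by (simp only: det_one mult_1)
  have dY: "det ?Y = det (1\<^sub>m n + rank_one a b)"
    unfolding det_four_block_mat_lower_left_zero[OF add_carrier_mat[OF cAB] cC refl one_carrier_mat]
    by (simp only: det_one mult_1_right)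
  have "1 + a \<bullet> b = det (?X * (?Y * ?Z))" unfolding XYZ dF ..
  also note dM
  also have "det ?X * (det ?Y * det ?Z) = det (1\<^sub>m n + rank_one a b)"
    unfolding dX dY dZ by (simp only: mult_1 mult_1_right)
  finally show ?thesis ..
qed

text \<open>
  A crude bound from the Leibniz formula; it is used only through its logarithm.
\<close>

lemma abs_det_le:
  fixes A :: "real mat"
  assumes A: "A \<in> carrier_mat n n" and le: "\<And>i j. i < n \<Longrightarrow> j < n \<Longrightarrow> \<bar>A $$ (i, j)\<bar> \<le> c"
  shows "\<bar>det A\<bar> \<le> fact n * c ^ n"
proof -
  have "\<bar>det A\<bar> \<le> (\<Sum>p\<in>{p. p permutes {0..<n}}. \<bar>signof p * (\<Prod>i = 0..<n. A $$ (i, p i))\<bar>)"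
    unfolding det_def'[OF A] by (rule sum_abs)
  also have "\<dots> \<le> (\<Sum>p\<in>{p. p permutes {0..<n}}. c ^ n)"
  proof (rule sum_mono)
    fix p assume "p \<in> {p. p permutes {0..<n}}"
    then have p: "p permutes {0..<n}" by simp
    have "\<bar>signof p * (\<Prod>i = 0..<n. A $$ (i, p i))\<bar> = (\<Prod>i = 0..<n. \<bar>A $$ (i, p i)\<bar>)"
      by (simp add: abs_mult abs_prod sign_def)
    also have "\<dots> \<le> (\<Prod>i = 0..<n. c)"
      using p by (intro prod_mono) (auto intro!: le simp: permutes_in_image)
    finally show "\<bar>signof p * (\<Prod>i = 0..<n. A $$ (i, p i))\<bar> \<le> c ^ n" by simp
  qed
  also have "\<dots> = fact n * c ^ n" by (simp add: card_permutations)
  finally show ?thesis .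
qed

section \<open>The regularised Gram matrix of the regressors and its inverse\<close>

primrec gram :: "nat \<Rightarrow> (nat \<Rightarrow> real vec) \<Rightarrow> nat \<Rightarrow> real mat"
  where
    "gram d \<Phi> 0 = 1\<^sub>m d"
  | "gram d \<Phi> (Suc n) = gram d \<Phi> n + rank_one (\<Phi> n) (\<Phi> n)"

text \<open>
  The Sherman--Morrison recursion for the inverse of \<open>gram\<close>. It makes every entry an explicit rational
  function of the regressors, which gives both the algebra of one step and measurability.
\<close>

primrec gram_inv :: "nat \<Rightarrow> (nat \<Rightarrow> real vec) \<Rightarrow> nat \<Rightarrow> real mat"
  where
    "gram_inv d \<Phi> 0 = 1\<^sub>m d"
  | "gram_inv d \<Phi> (Suc n) = gram_inv d \<Phi> n -
       (1 / (1 + \<Phi> n \<bullet> (gram_inv d \<Phi> n *\<^sub>v \<Phi> n))) \<cdot>\<^sub>m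
         rank_one (gram_inv d \<Phi> n *\<^sub>v \<Phi> n) (gram_inv d \<Phi> n *\<^sub>v \<Phi> n)"

text \<open>
  One plus this number is the factor by which the \<open>n\<close>-th regressor multiplies the determinant of the
  Gram matrix. It compares the regressor with the excitation accumulated before time \<open>n\<close>.
\<close>

definition leverage :: "nat \<Rightarrow> (nat \<Rightarrow> real vec) \<Rightarrow> nat \<Rightarrow> real"
  where "leverage d \<Phi> n = \<Phi> n \<bullet> (gram_inv d \<Phi> n *\<^sub>v \<Phi> n)"

text \<open>
  The shift by one lets \<open>gram d \<Phi> n\<close> depend on the regressors strictly before time \<open>n\<close> only.
\<close>

lemma design_matrix_eq_gram:
  assumes "\<And>n. \<Phi> n \<in> carrier_vec d"
  shows "design_matrix d \<Phi> n = gram d \<Phi> (Suc n)"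
proof -
  have "gram d \<Phi> n = mat d d (\<lambda>(i, j). \<Sum>k<n. \<Phi> k $ i * \<Phi> k $ j) + 1\<^sub>m d" for n
  proof (induction n)
    case (Suc n)
    show ?case using assms[of n] by (auto simp: Suc rank_one_def intro!: eq_matI)
  qed (auto intro!: eq_matI)
  from this[of "Suc n"] show ?thesis
    by (simp add: design_matrix_def lessThan_Suc_atMost)
qed

locale regressors =
  fixes d :: nat and \<Phi> :: "nat \<Rightarrow> real vec"
  assumes regressor_carrier [simp, intro]: "\<Phi> n \<in> carrier_vec d"
begin

abbreviation "R \<equiv> gram d \<Phi>"
abbreviation "Q \<equiv> gram_inv d \<Phi>"
abbreviation "g \<equiv> leverage d \<Phi>"

lemma dim_regressor [simp]: "dim_vec (\<Phi> n) = d"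
  using regressor_carrier[of n] by simp

lemma gram_carrier [simp, intro]: "R n \<in> carrier_mat d d"
  by (induction n) (simp_all add: rank_one_def)

lemma gram_inv_carrier [simp, intro]: "Q n \<in> carrier_mat d d"
proof (induction n)
  case (Suc n)
  show ?case unfolding gram_inv.simps
    by (intro minus_carrier_mat smult_carrier_mat rank_one_carrier mult_mat_vec_carrier[OF Suc] regressor_carrier)
qed simp

lemma dim_gram [simp]: "dim_row (R n) = d" "dim_col (R n) = d" "dim_row (Q n) = d" "dim_col (Q n) = d"
  by (rule carrier_matD[OF gram_carrier] carrier_matD[OF gram_inv_carrier])+

lemma gram_mult_vec_carrier [simp, intro]:
  "x \<in> carrier_vec d \<Longrightarrow> R n *\<^sub>v x \<in> carrier_vec d"
  "x \<in> carrier_vec d \<Longrightarrow> Q n *\<^sub>v x \<in> carrier_vec d"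
  by (rule mult_mat_vec_carrier[OF gram_carrier] mult_mat_vec_carrier[OF gram_inv_carrier]; assumption)+

lemma gram_inv_symmetric: "i < d \<Longrightarrow> j < d \<Longrightarrow> Q n $$ (i, j) = Q n $$ (j, i)"
  by (induction n) (auto simp: rank_one_def)

text \<open>
  In particular the form is symmetric and dominates the scalar product.
\<close>

lemma gram_form:
  assumes "x \<in> carrier_vec d" "y \<in> carrier_vec d"
  shows "x \<bullet> (R n *\<^sub>v y) = x \<bullet> y + (\<Sum>k<n. (\<Phi> k \<bullet> x) * (\<Phi> k \<bullet> y))"
proof (induction n)
  case (Suc n)
  have "R (Suc n) *\<^sub>v y = R n *\<^sub>v y + (\<Phi> n \<bullet> y) \<cdot>\<^sub>v \<Phi> n"
    using assms by (simp add: add_mult_distrib_mat_vec[of _ d d] rank_one_mult_vec[of _ d _ d])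
  then have "x \<bullet> (R (Suc n) *\<^sub>v y) = x \<bullet> (R n *\<^sub>v y) + (\<Phi> n \<bullet> y) * (x \<bullet> \<Phi> n)"
    using assms by (simp add: scalar_prod_add_distrib[of x d])
  then show ?case
    using Suc comm_scalar_prod[OF assms(1) regressor_carrier, of n] by simp
qed (use assms in simp)

text \<open>
  The induction needs the leverage to be nonnegative, so that the Sherman--Morrison denominator does not
  vanish, and nonnegativity in turn follows from the inverse at the same stage: \<open>x \<bullet> Q x = y \<bullet> R y\<close> for
  \<open>y = Q x\<close>.
\<close>

lemma gram_mult_gram_inv: "R n * Q n = 1\<^sub>m d" and gram_inv_nonneg: "x \<in> carrier_vec d \<Longrightarrow> x \<bullet> (Q n *\<^sub>v x) \<ge> 0"
proof -
  have pos: "x \<bullet> (Q n *\<^sub>v x) \<ge> 0" if inv: "R n * Q n = 1\<^sub>m d" and x: "x \<in> carrier_vec d" for n x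
  proof -
    define y where "y = Q n *\<^sub>v x"
    have y: "y \<in> carrier_vec d" using x by (simp add: y_def)
    have "R n *\<^sub>v y = (R n * Q n) *\<^sub>v x"
      unfolding y_def by (rule assoc_mult_mat_vec[symmetric, OF gram_carrier gram_inv_carrier x])
    then have "R n *\<^sub>v y = x" using x by (simp add: inv)
    then have "x \<bullet> (Q n *\<^sub>v x) = y \<bullet> (R n *\<^sub>v y)"
      using comm_scalar_prod[OF x y] by (simp add: y_def)
    also have "\<dots> \<ge> 0"
      unfolding gram_form[OF y y]
      using y by (intro add_nonneg_nonneg sum_nonneg) (simp_all add: scalar_prod_def sum_nonneg)
    finally show ?thesis .
  qed
  have g: "g n \<ge> 0" if "R n * Q n = 1\<^sub>m d" for n
    using pos[OF that regressor_carrier] by (simp add: leverage_def)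
  have inv: "R n * Q n = 1\<^sub>m d" for n
  proof (induction n)
    case (Suc n)
    define u where "u = Q n *\<^sub>v \<Phi> n"
    define c where "c = 1 / (1 + g n)"
    have u: "u \<in> carrier_vec d" by (simp add: u_def)
    have gn: "g n \<ge> 0" by (rule g[OF Suc])
    have gu: "\<Phi> n \<bullet> u = g n" by (simp add: leverage_def u_def)
    have Ru: "R n *\<^sub>v u = \<Phi> n"
      unfolding u_def by (subst assoc_mult_mat_vec[symmetric, of _ d d _ d]) (auto simp: Suc)
    have "R (Suc n) * Q (Suc n) = (R n + rank_one (\<Phi> n) (\<Phi> n)) * (Q n - c \<cdot>\<^sub>m rank_one u u)"
      by (simp add: u_def c_def leverage_def)
    also have "\<dots> = (R n + rank_one (\<Phi> n) (\<Phi> n)) * Q n - (R n + rank_one (\<Phi> n) (\<Phi> n)) * (c \<cdot>\<^sub>m rank_one u u)"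
      using u by (intro mult_minus_distrib_mat[of _ d d _ d]) auto
    also have "(R n + rank_one (\<Phi> n) (\<Phi> n)) * Q n = 1\<^sub>m d + rank_one (\<Phi> n) u"
      by (subst add_mult_distrib_mat[of _ d d _ _ d])
        (auto simp: Suc u_def rank_one_mult_symmetric[of _ d] gram_inv_symmetric)
    also have "(R n + rank_one (\<Phi> n) (\<Phi> n)) * (c \<cdot>\<^sub>m rank_one u u)
        = c \<cdot>\<^sub>m (rank_one (\<Phi> n) u + g n \<cdot>\<^sub>m rank_one (\<Phi> n) u)"
      using u by (subst mult_smult_distrib[of _ d d _ d], auto, subst add_mult_distrib_mat[of _ d d _ _ d])
        (auto simp: mult_rank_one[of "R n" d d] Ru rank_one_mult_rank_one[of _ d] gu)
    also have "1\<^sub>m d + rank_one (\<Phi> n) u - c \<cdot>\<^sub>m (rank_one (\<Phi> n) u + g n \<cdot>\<^sub>m rank_one (\<Phi> n) u) = 1\<^sub>m d"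
      using u gn by (intro eq_matI) (auto simp: rank_one_def c_def field_simps)
    finally show ?case .
  qed simp
  show "R n * Q n = 1\<^sub>m d" by (rule inv)
  show "x \<bullet> (Q n *\<^sub>v x) \<ge> 0" if "x \<in> carrier_vec d" by (rule pos[OF inv that])
qed

lemma leverage_nonneg: "g n \<ge> 0"
  using gram_inv_nonneg[OF regressor_carrier] by (simp add: leverage_def)

lemma gram_inv_mult_gram: "Q n * R n = 1\<^sub>m d"
  by (rule mat_mult_left_right_inverse[OF gram_carrier gram_inv_carrier gram_mult_gram_inv])

lemma mat_inverse_gram: "mat_inverse (R n) = Some (Q n)"
proof (cases "mat_inverse (R n)")
  case None
  moreover have "R n \<in> Units (ring_mat TYPE(real) d ())"
    unfolding Units_def ring_mat_def
    using gram_mult_gram_inv[of n] gram_inv_mult_gram[of n] gram_carrier[of n] gram_inv_carrier[of n]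
    by simp (rule bexI[of _ "Q n"], simp_all)
  ultimately show ?thesis using mat_inverse(1)[OF gram_carrier, of n "()"] by simp
next
  case (Some B)
  from mat_inverse(2)[OF gram_carrier Some]
  have B: "B * R n = 1\<^sub>m d" "B \<in> carrier_mat d d" by auto
  have "B = B * (R n * Q n)" using B(2) by (simp add: gram_mult_gram_inv)
  also have "\<dots> = (B * R n) * Q n"
    by (rule assoc_mult_mat[OF B(2) gram_carrier gram_inv_carrier, symmetric])
  also have "\<dots> = Q n" by (simp add: B(1))
  finally show ?thesis using Some by simp
qed

lemma gram_inv_Suc_regressor: "Q (Suc n) *\<^sub>v \<Phi> n = (1 / (1 + g n)) \<cdot>\<^sub>v (Q n *\<^sub>v \<Phi> n)"
proof -
  define u where "u = Q n *\<^sub>v \<Phi> n"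
  have u: "u \<in> carrier_vec d" by (simp add: u_def)
  have gu: "\<Phi> n \<bullet> u = g n" "u \<bullet> \<Phi> n = g n"
    using u by (simp_all add: leverage_def u_def comm_scalar_prod[of _ d])
  have "Q (Suc n) *\<^sub>v \<Phi> n = (Q n - (1 / (1 + g n)) \<cdot>\<^sub>m rank_one u u) *\<^sub>v \<Phi> n"
    by (simp add: u_def leverage_def)
  also have "\<dots> = u - (g n / (1 + g n)) \<cdot>\<^sub>v u"
    using u by (subst minus_mult_distrib_mat_vec[of _ d d])
      (auto simp: smult_mat_mult_vec[of _ d d] rank_one_mult_vec[of _ d _ d] gu u_def[symmetric] smult_smult_assoc)
  also have "\<dots> = (1 / (1 + g n)) \<cdot>\<^sub>v u"
    using u leverage_nonneg[of n] by (intro eq_vecI) (auto simp: field_simps)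
  finally show ?thesis by (simp add: u_def)
qed

text \<open>
  Matrix determinant lemma: factor \<open>R n\<close> out of \<open>R n + \<Phi> \<Phi>\<^sup>t\<close>.
\<close>

lemma det_gram_Suc: "det (R (Suc n)) = det (R n) * (1 + g n)"
proof -
  have u: "Q n *\<^sub>v \<Phi> n \<in> carrier_vec d" by simp
  have "R n *\<^sub>v (Q n *\<^sub>v \<Phi> n) = \<Phi> n"
    by (subst assoc_mult_mat_vec[symmetric, of _ d d _ d]) (auto simp: gram_mult_gram_inv)
  then have "R n * rank_one (Q n *\<^sub>v \<Phi> n) (\<Phi> n) = rank_one (\<Phi> n) (\<Phi> n)"
    using u by (simp add: mult_rank_one[of _ d d])
  then have "R (Suc n) = R n * (1\<^sub>m d + rank_one (Q n *\<^sub>v \<Phi> n) (\<Phi> n))"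
    using u by (subst mult_add_distrib_mat[of _ d d _ d]) auto
  then show ?thesis
    using u by (simp add: det_mult[of _ d] det_one_add_rank_one[of _ d] leverage_def comm_scalar_prod[of _ d "\<Phi> n"])
qed

lemma gram_mult_gram_inv_regressor: "R n *\<^sub>v (Q n *\<^sub>v \<Phi> n) = \<Phi> n"
  by (subst assoc_mult_mat_vec[symmetric, OF gram_carrier gram_inv_carrier regressor_carrier])
    (simp add: gram_mult_gram_inv)

text \<open>
  The energy balance of the recursive least squares algorithm driven by an innovation \<open>\<nu>\<close>. The error moves
  by a multiple of \<open>u = Q n \<Phi> n\<close>, and \<open>R n u = \<Phi> n\<close>, so that all quadratic terms are polynomials in the
  prediction error, the innovation and the leverage.
\<close>

lemma energy_step:
  assumes e: "e \<in> carrier_vec d"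
    and e': "e' = e + (\<nu> - e \<bullet> \<Phi> n) \<cdot>\<^sub>v (Q (Suc n) *\<^sub>v \<Phi> n)"
  shows "e' \<bullet> (R (Suc n) *\<^sub>v e') + (e \<bullet> \<Phi> n)\<^sup>2 / (1 + g n)
    = e \<bullet> (R n *\<^sub>v e) + 2 * ((e \<bullet> \<Phi> n) / (1 + g n) * \<nu>) + g n / (1 + g n) * \<nu>\<^sup>2"
proof -
  define u where "u = Q n *\<^sub>v \<Phi> n"
  define c where "c = (\<nu> - e \<bullet> \<Phi> n) / (1 + g n)"
  define \<pi> where "\<pi> = e \<bullet> \<Phi> n"
  have gn: "1 + g n > 0" using leverage_nonneg[of n] by linarith
  have u: "u \<in> carrier_vec d" by (simp add: u_def)
  have e'_eq: "e' = e + c \<cdot>\<^sub>v u"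
    by (simp add: e' gram_inv_Suc_regressor u_def c_def smult_smult_assoc del: gram_inv.simps)
  have e'_car: "e' \<in> carrier_vec d" using e u by (simp add: e'_eq)
  have uphi: "u \<bullet> \<Phi> n = g n" "\<Phi> n \<bullet> u = g n"
    using comm_scalar_prod[OF u regressor_carrier[of n]] by (simp_all add: leverage_def u_def)
  have Ru: "R n *\<^sub>v u = \<Phi> n" by (simp add: u_def gram_mult_gram_inv_regressor)
  have phi_e: "\<Phi> n \<bullet> e = \<pi>" using comm_scalar_prod[OF e regressor_carrier[of n]] by (simp add: \<pi>_def)
  have uRe: "u \<bullet> (R n *\<^sub>v e) = \<pi>"
  proof -
    have "u \<bullet> (R n *\<^sub>v e) = e \<bullet> (R n *\<^sub>v u)"
      by (simp only: gram_form[OF u e] gram_form[OF e u] comm_scalar_prod[OF u e] mult.commute)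
    then show ?thesis by (simp add: Ru \<pi>_def)
  qed
  have phi_e': "\<Phi> n \<bullet> e' = \<pi> + c * g n" and e'_phi: "e' \<bullet> \<Phi> n = \<pi> + c * g n"
    using e u comm_scalar_prod[OF e'_car regressor_carrier[of n]]
    by (simp_all add: e'_eq scalar_prod_add_distrib[of _ d] phi_e uphi)
  have "R n *\<^sub>v e' = R n *\<^sub>v e + c \<cdot>\<^sub>v \<Phi> n"
    using e u by (simp add: e'_eq mult_add_distrib_mat_vec[OF gram_carrier] mult_mat_vec[OF gram_carrier] Ru)
  then have "e' \<bullet> (R n *\<^sub>v e') = e' \<bullet> (R n *\<^sub>v e) + c * (\<pi> + c * g n)"
    using e e'_car by (simp add: scalar_prod_add_distrib[of _ d] e'_phi)
  also have "e' \<bullet> (R n *\<^sub>v e) = e \<bullet> (R n *\<^sub>v e) + c * \<pi>"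
    using e u by (simp add: e'_eq add_scalar_prod_distrib[of _ d] uRe)
  finally have "e' \<bullet> (R (Suc n) *\<^sub>v e') = e \<bullet> (R n *\<^sub>v e) + c * \<pi> + c * (\<pi> + c * g n) + (\<pi> + c * g n)\<^sup>2"
    using gram_form[OF e'_car e'_car, of n] gram_form[OF e'_car e'_car, of "Suc n"]
    by (simp add: phi_e' power2_eq_square)
  moreover have "c * (1 + g n) = \<nu> - \<pi>" using gn by (simp add: c_def \<pi>_def)
  then have \<nu>: "\<nu> = \<pi> + c * (1 + g n)" by simp
  ultimately show ?thesis
    using gn unfolding \<pi>_def[symmetric] \<nu> by (simp add: divide_simps) (simp add: algebra_simps power2_eq_square)
qed

text \<open>
  The decrease of the trace of the inverse Gram matrix at time \<open>n\<close>.
\<close>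

definition trace_drop :: "nat \<Rightarrow> real"
  where "trace_drop n = ((Q n *\<^sub>v \<Phi> n) \<bullet> (Q n *\<^sub>v \<Phi> n)) / (1 + g n)"

lemma trace_drop_nonneg: "trace_drop n \<ge> 0"
  using leverage_nonneg[of n] scalar_prod_self_nonneg by (simp add: trace_drop_def)

text \<open>
  The factor of \<open>\<Phi> n \<bullet> \<Phi> n\<close> is small for large \<open>n\<close>, because the decreases of the trace are summable.
  This refines the obvious bound, in which the factor is the norm of the inverse Gram matrix.
\<close>

lemma leverage_le: "g n \<le> 1 + trace_drop n * (\<Phi> n \<bullet> \<Phi> n)"
proof -
  have gn: "g n \<ge> 0" by (rule leverage_nonneg)
  have "(g n)\<^sup>2 \<le> (\<Phi> n \<bullet> \<Phi> n) * ((Q n *\<^sub>v \<Phi> n) \<bullet> (Q n *\<^sub>v \<Phi> n))"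
    unfolding leverage_def by (rule scalar_prod_Cauchy_Schwarz[of _ d]) simp_all
  then have "(g n)\<^sup>2 / (1 + g n) \<le> trace_drop n * (\<Phi> n \<bullet> \<Phi> n)"
    using gn by (simp add: trace_drop_def divide_right_mono mult.commute)
  moreover have "g n \<le> 1 + (g n)\<^sup>2 / (1 + g n)"
    using gn by (simp add: field_simps power2_eq_square)
  ultimately show ?thesis by linarith
qed

text \<open>
  Telescoping, as the trace starts at \<open>d\<close> and stays nonnegative.
\<close>

lemma sum_trace_drop_le: "(\<Sum>k<n. trace_drop k) \<le> real d"
proof -
  define tr where "tr n = (\<Sum>i<d. Q n $$ (i, i))" for n
  have "tr n = real d - (\<Sum>k<n. trace_drop k)"
  proof (induction n)
    case (Suc n)
    have "tr (Suc n) = tr n - (1 / (1 + g n)) * (\<Sum>i<d. (Q n *\<^sub>v \<Phi> n) $ i * (Q n *\<^sub>v \<Phi> n) $ i)"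
      by (simp add: tr_def rank_one_def leverage_def sum_subtractf sum_divide_distrib)
    also have "\<dots> = tr n - trace_drop n"
      by (simp add: trace_drop_def scalar_prod_def[of "Q n *\<^sub>v \<Phi> n" "Q n *\<^sub>v \<Phi> n"] lessThan_atLeast0)
    finally show ?case using Suc by simp
  qed (simp add: tr_def)
  moreover have "tr n \<ge> 0"
  proof -
    have "Q n $$ (i, i) \<ge> 0" if "i < d" for i
      using gram_inv_nonneg[OF unit_vec_carrier, of i n] that
      by (simp add: scalar_prod_left_unit[of _ d] scalar_prod_right_unit[of _ d])
    then show ?thesis by (auto simp: tr_def intro!: sum_nonneg)
  qed
  ultimately show ?thesis by linarith
qed

lemma det_gram: "det (R n) = (\<Prod>k<n. 1 + g k)"
proof (induction n)
  case (Suc n)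
  show ?case by (simp only: det_gram_Suc Suc prod.lessThan_Suc)
qed simp

lemma gram_entry_le:
  assumes "i < d" "j < d"
  shows "\<bar>R n $$ (i, j)\<bar> \<le> 1 + (\<Sum>k<n. \<Phi> k \<bullet> \<Phi> k)"
proof (induction n)
  case (Suc n)
  have i: "(\<Phi> n $ i)\<^sup>2 \<le> \<Phi> n \<bullet> \<Phi> n" if "i < d" for i
    unfolding scalar_prod_def power2_eq_square using that
    by (intro member_le_sum[where f = "\<lambda>i. \<Phi> n $ i * \<Phi> n $ i"]) simp_all
  have "\<bar>\<Phi> n $ i * \<Phi> n $ j\<bar> \<le> \<Phi> n \<bullet> \<Phi> n"
    using i[OF assms(1)] i[OF assms(2)] sum_squares_bound[of "\<bar>\<Phi> n $ i\<bar>" "\<bar>\<Phi> n $ j\<bar>"]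
    by (simp add: abs_mult)
  moreover have "R (Suc n) $$ (i, j) = R n $$ (i, j) + \<Phi> n $ i * \<Phi> n $ j"
    using assms by (simp add: rank_one_def)
  ultimately show ?case using Suc by simp
qed (use assms in simp)

text \<open>
  The logarithm of a determinant of bounded size is at most logarithmic in the size of the entries.
\<close>

lemma sum_ln_leverage_le:
  "(\<Sum>k<n. ln (1 + g k)) \<le> ln (fact d) + real d * ln (1 + (\<Sum>k<n. \<Phi> k \<bullet> \<Phi> k))"
proof -
  define r where "r = 1 + (\<Sum>k<n. \<Phi> k \<bullet> \<Phi> k)"
  have r: "r \<ge> 1" by (auto simp: r_def intro!: sum_nonneg scalar_prod_self_nonneg)
  have pos: "1 + g k > 0" for k using leverage_nonneg[of k] by linarith
  have "(\<Sum>k<n. ln (1 + g k)) = ln (det (R n))"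
    unfolding det_gram by (subst ln_prod) (simp_all add: pos less_imp_neq[OF pos, symmetric])
  also have "\<dots> \<le> ln (fact d * r ^ d)"
  proof (rule ln_mono)
    show "det (R n) > 0" unfolding det_gram using pos by (intro prod_pos) simp
    show "det (R n) \<le> fact d * r ^ d"
      using abs_det_le[OF gram_carrier, of n r] gram_entry_le[of _ _ n] by (simp add: r_def)
  qed
  also have "\<dots> = ln (fact d) + real d * ln r"
    using r by (simp add: ln_mult ln_realpow)
  finally show ?thesis by (simp add: r_def)
qed

end

section \<open>Series of conditionally controlled random variables\<close>

locale filtered_prob_space = prob_space M for M :: "'a measure" +
  fixes F :: "nat \<Rightarrow> 'a measure"
  assumes filtration_F: "filtration (space M) F"
    and subalgebra_F: "subalgebra M (F n)"
begin

lemma space_F [simp]: "space (F n) = space M"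
  using subalgebra_F[of n] by (simp add: subalgebra_def)

lemma sigma_finite_subalgebra_F: "sigma_finite_subalgebra M (F n)"
  by (rule finite_measure_subalgebra_is_sigma_finite)
    (simp add: finite_measure_subalgebra_def finite_measure_subalgebra_axioms_def subalgebra_F finite_measure_axioms)

lemma borel_measurable_F_mono:
  "f \<in> borel_measurable (F m) \<Longrightarrow> m \<le> n \<Longrightarrow> f \<in> borel_measurable (F n)"
  using filtration.sets_F_mono[OF filtration_F]
  by (intro measurable_from_subalg[of "F n" "F m"]) (auto simp: subalgebra_def)

lemma borel_measurable_F_M: "f \<in> borel_measurable (F m) \<Longrightarrow> f \<in> borel_measurable M"
  by (rule measurable_from_subalg[OF subalgebra_F])

text \<open>
  The conditional expectation of the positive part of \<open>Y\<close> given \<open>F n\<close> is at most that of \<open>h\<close>. Testing against nonnegative weights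
  avoids integrability assumptions on \<open>Y\<close> and on the weights.
\<close>

definition conditionally_le :: "nat \<Rightarrow> ('a \<Rightarrow> real) \<Rightarrow> ('a \<Rightarrow> real) \<Rightarrow> bool"
  where "conditionally_le n Y h \<longleftrightarrow>
    (\<forall>w \<in> borel_measurable (F n). (\<integral>\<^sup>+\<omega>. w \<omega> * ennreal (Y \<omega>) \<partial>M) \<le> (\<integral>\<^sup>+\<omega>. w \<omega> * ennreal (h \<omega>) \<partial>M))"

lemma conditionally_leD:
  "conditionally_le n Y h \<Longrightarrow> w \<in> borel_measurable (F n) \<Longrightarrow>
    (\<integral>\<^sup>+\<omega>. w \<omega> * ennreal (Y \<omega>) \<partial>M) \<le> (\<integral>\<^sup>+\<omega>. w \<omega> * ennreal (h \<omega>) \<partial>M)"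
  by (simp add: conditionally_le_def)

lemma conditionally_le_trans:
  "conditionally_le n X Y \<Longrightarrow> conditionally_le n Y Z \<Longrightarrow> conditionally_le n X Z"
  unfolding conditionally_le_def by (meson order_trans)

lemma conditionally_le_AE:
  assumes "AE \<omega> in M. X \<omega> \<le> Y \<omega>"
  shows "conditionally_le n X Y"
  unfolding conditionally_le_def
  by (intro ballI nn_integral_mono_AE, use assms in eventually_elim) (auto intro: mult_left_mono ennreal_leI)

lemma conditionally_le_mult:
  assumes "conditionally_le n Y h" "u \<in> borel_measurable (F n)" "\<And>\<omega>. u \<omega> \<ge> 0"
  shows "conditionally_le n (\<lambda>\<omega>. u \<omega> * Y \<omega>) (\<lambda>\<omega>. u \<omega> * h \<omega>)"
  unfolding conditionally_le_def
proof
  fix w :: "'a \<Rightarrow> ennreal" assume w: "w \<in> borel_measurable (F n)"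
  have "(\<lambda>\<omega>. w \<omega> * ennreal (u \<omega>)) \<in> borel_measurable (F n)" using w assms(2) by measurable
  from conditionally_leD[OF assms(1) this]
  show "(\<integral>\<^sup>+\<omega>. w \<omega> * ennreal (u \<omega> * Y \<omega>) \<partial>M) \<le> (\<integral>\<^sup>+\<omega>. w \<omega> * ennreal (u \<omega> * h \<omega>) \<partial>M)"
    by (simp add: ennreal_mult' assms(3) mult.assoc)
qed

lemma conditionally_le_add:
  assumes Y: "conditionally_le n Y h" "Y \<in> borel_measurable M" "\<And>\<omega>. Y \<omega> \<ge> 0"
    and h: "h \<in> borel_measurable M" "\<And>\<omega>. h \<omega> \<ge> 0" and c: "c \<ge> 0"
  shows "conditionally_le n (\<lambda>\<omega>. Y \<omega> + c) (\<lambda>\<omega>. h \<omega> + c)"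
  unfolding conditionally_le_def
proof
  note [measurable] = Y(2) h(1)
  fix w :: "'a \<Rightarrow> ennreal" assume w: "w \<in> borel_measurable (F n)"
  have [measurable]: "w \<in> borel_measurable M" by (rule measurable_from_subalg[OF subalgebra_F w])
  have split: "(\<integral>\<^sup>+\<omega>. w \<omega> * ennreal (X \<omega> + c) \<partial>M) = (\<integral>\<^sup>+\<omega>. w \<omega> * ennreal (X \<omega>) \<partial>M) + (\<integral>\<^sup>+\<omega>. w \<omega> * ennreal c \<partial>M)"
    if [measurable]: "X \<in> borel_measurable M" and "\<And>\<omega>. X \<omega> \<ge> 0" for X
    using that(2) c by (subst nn_integral_add[symmetric]) (auto simp: ennreal_plus distrib_left)
  show "(\<integral>\<^sup>+\<omega>. w \<omega> * ennreal (Y \<omega> + c) \<partial>M) \<le> (\<integral>\<^sup>+\<omega>. w \<omega> * ennreal (h \<omega> + c) \<partial>M)"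
    unfolding split[OF Y(2,3)] split[OF h] by (intro add_right_mono conditionally_leD[OF Y(1) w])
qed

lemma conditionally_le_nn_cond_exp:
  assumes [measurable]: "Y \<in> borel_measurable M"
    and h: "AE \<omega> in M. nn_cond_exp M (F n) (\<lambda>\<eta>. ennreal (Y \<eta>)) \<omega> = ennreal (h \<omega>)"
  shows "conditionally_le n Y h"
  unfolding conditionally_le_def
proof
  interpret S: sigma_finite_subalgebra M "F n" by (rule sigma_finite_subalgebra_F)
  fix w :: "'a \<Rightarrow> ennreal" assume w: "w \<in> borel_measurable (F n)"
  have "(\<integral>\<^sup>+\<omega>. w \<omega> * ennreal (Y \<omega>) \<partial>M) = (\<integral>\<^sup>+\<omega>. w \<omega> * nn_cond_exp M (F n) (\<lambda>\<eta>. ennreal (Y \<eta>)) \<omega> \<partial>M)"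
    by (rule S.nn_cond_exp_intg[symmetric, OF w]) measurable
  also have "\<dots> = (\<integral>\<^sup>+\<omega>. w \<omega> * ennreal (h \<omega>) \<partial>M)"
    by (rule nn_integral_cong_AE, use h in eventually_elim) simp
  finally show "(\<integral>\<^sup>+\<omega>. w \<omega> * ennreal (Y \<omega>) \<partial>M) \<le> (\<integral>\<^sup>+\<omega>. w \<omega> * ennreal (h \<omega>) \<partial>M)" by simp
qed

text \<open>
  On \<open>Y \<ge> 0\<close> this is the tower property; in general the negative part only helps.
\<close>

lemma real_cond_exp_conditionally_le:
  assumes [measurable]: "Y \<in> borel_measurable M"
  shows "conditionally_le n (real_cond_exp M (F n) Y) Y"
  unfolding conditionally_le_def
proof
  interpret S: sigma_finite_subalgebra M "F n" by (rule sigma_finite_subalgebra_F)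
  fix w :: "'a \<Rightarrow> ennreal" assume w: "w \<in> borel_measurable (F n)"
  let ?E = "nn_cond_exp M (F n) (\<lambda>\<eta>. ennreal (Y \<eta>))"
  have "ennreal (real_cond_exp M (F n) Y \<omega>) \<le> ?E \<omega>" for \<omega>
  proof -
    have "ennreal (real_cond_exp M (F n) Y \<omega>) \<le> ennreal (enn2real (?E \<omega>))"
      by (intro ennreal_leI) (simp add: real_cond_exp_def)
    also have "\<dots> \<le> ?E \<omega>" by (cases "?E \<omega>") auto
    finally show ?thesis .
  qed
  then have "(\<integral>\<^sup>+\<omega>. w \<omega> * ennreal (real_cond_exp M (F n) Y \<omega>) \<partial>M) \<le> (\<integral>\<^sup>+\<omega>. w \<omega> * ?E \<omega> \<partial>M)"
    by (intro nn_integral_mono mult_left_mono) simp_all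
  also have "\<dots> = (\<integral>\<^sup>+\<omega>. w \<omega> * ennreal (Y \<omega>) \<partial>M)"
    by (rule S.nn_cond_exp_intg[OF w]) measurable
  finally show "(\<integral>\<^sup>+\<omega>. w \<omega> * ennreal (real_cond_exp M (F n) Y \<omega>) \<partial>M) \<le> (\<integral>\<^sup>+\<omega>. w \<omega> * ennreal (Y \<omega>) \<partial>M)" .
qed

text \<open>
  A predictable cut-off: the weights are switched off as soon as the accumulated \<open>h\<close> exceeds \<open>K\<close>. It turns
  almost surely finite sums into sums of finite expectation, and it changes nothing on the event
  that the whole sum is at most \<open>K\<close>.
\<close>

definition budget :: "(nat \<Rightarrow> 'a \<Rightarrow> real) \<Rightarrow> nat \<Rightarrow> nat \<Rightarrow> 'a \<Rightarrow> real"
  where "budget h K k \<omega> = (if (\<Sum>i\<le>k. h i \<omega>) \<le> real K then 1 else 0)"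

lemma budget_measurable:
  assumes "\<And>k. h k \<in> borel_measurable (F k)"
  shows "budget h K k \<in> borel_measurable (F k)"
proof -
  have [measurable]: "(\<lambda>\<omega>. \<Sum>i\<le>k. h i \<omega>) \<in> borel_measurable (F k)"
    by (intro borel_measurable_sum borel_measurable_F_mono[OF assms]) simp
  show ?thesis unfolding budget_def by measurable
qed

lemma sum_budget_le:
  assumes "\<And>k \<omega>. h k \<omega> \<ge> 0"
  shows "(\<Sum>k<n. budget h K k \<omega> * h k \<omega>) \<le> real K"
proof -
  have "(\<Sum>k<n. budget h K k \<omega> * h k \<omega>) \<le> real K \<and>
      (\<Sum>k<n. budget h K k \<omega> * h k \<omega>) \<le> (\<Sum>k<n. h k \<omega>)"
  proof (induction n)
    case (Suc n)
    show ?case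
    proof (cases "budget h K n \<omega> = 1")
      case True
      then have "(\<Sum>k<Suc n. h k \<omega>) \<le> real K"
        by (auto simp: budget_def lessThan_Suc_atMost split: if_splits)
      then show ?thesis using Suc True by simp
    next
      case False
      then have "budget h K n \<omega> = 0" by (auto simp: budget_def)
      then show ?thesis using Suc assms[of n \<omega>] by simp
    qed
  qed simp
  then show ?thesis by simp
qed

lemma suminf_nn_integral_budget_le:
  assumes h: "\<And>k. h k \<in> borel_measurable (F k)" "\<And>k \<omega>. h k \<omega> \<ge> 0"
  shows "(\<Sum>k. \<integral>\<^sup>+\<omega>. ennreal (budget h K k \<omega>) * ennreal (h k \<omega>) \<partial>M) \<le> ennreal (real K)"
proof -
  have [measurable]: "budget h K k \<in> borel_measurable M" "h k \<in> borel_measurable M" for k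
    by (rule borel_measurable_F_M[OF budget_measurable[OF h(1)]] borel_measurable_F_M[OF h(1)])+
  have "(\<Sum>k. \<integral>\<^sup>+\<omega>. ennreal (budget h K k \<omega>) * ennreal (h k \<omega>) \<partial>M)
      = (\<integral>\<^sup>+\<omega>. (\<Sum>k. ennreal (budget h K k \<omega> * h k \<omega>)) \<partial>M)"
    by (subst nn_integral_suminf[symmetric]) (auto simp: ennreal_mult h budget_def)
  also have "\<dots> \<le> (\<integral>\<^sup>+\<omega>. ennreal (real K) \<partial>M)"
  proof (intro nn_integral_mono suminf_le_const summableI)
    fix n \<omega>
    have "(\<Sum>k<n. budget h K k \<omega> * h k \<omega>) \<le> real K" by (rule sum_budget_le[OF h(2)])
    then show "(\<Sum>k<n. ennreal (budget h K k \<omega> * h k \<omega>)) \<le> ennreal (real K)"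
      using h(2) by (subst sum_ennreal) (auto simp: budget_def intro!: ennreal_leI)
  qed
  also have "\<dots> = ennreal (real K)" by (simp add: emeasure_space_1)
  finally show ?thesis .
qed

lemma budget_eventually_one:
  assumes "\<And>k. h k \<omega> \<ge> 0" "summable (\<lambda>k. h k \<omega>)"
  obtains K where "\<And>k. budget h K k \<omega> = 1"
proof -
  obtain K where K: "(\<Sum>k. h k \<omega>) \<le> real K" using real_arch_simple by blast
  have "budget h K k \<omega> = 1" for k
    using sum_le_suminf[OF assms(2), of "{..k}"] assms(1) K by (auto simp: budget_def)
  then show ?thesis by (rule that)
qed

text \<open>
  After the cut-off at level \<open>K\<close>, the expected sum is at most \<open>K\<close>; the levels exhaust almost every
  trajectory.
\<close>

lemma AE_summable_of_conditionally_le: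
  fixes Y h :: "nat \<Rightarrow> 'a \<Rightarrow> real"
  assumes Y: "\<And>k. Y k \<in> borel_measurable M" "\<And>k \<omega>. Y k \<omega> \<ge> 0"
    and h: "\<And>k. h k \<in> borel_measurable (F k)" "\<And>k \<omega>. h k \<omega> \<ge> 0"
    and bound: "\<And>k. conditionally_le k (Y k) (h k)"
    and summable: "AE \<omega> in M. summable (\<lambda>k. h k \<omega>)"
  shows "AE \<omega> in M. summable (\<lambda>k. Y k \<omega>)"
proof -
  let ?I = "budget h"
  have I_F: "?I K k \<in> borel_measurable (F k)" for K k by (rule budget_measurable[OF h(1)])
  have [measurable]: "?I K k \<in> borel_measurable M" for K k by (rule borel_measurable_F_M[OF I_F])
  note [measurable] = Y(1)
  have I_nonneg: "?I K k \<omega> \<ge> 0" for K k \<omega> by (simp add: budget_def)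
  have fin: "AE \<omega> in M. (\<Sum>k. ennreal (?I K k \<omega> * Y k \<omega>)) \<noteq> \<infinity>" for K
  proof (rule nn_integral_noteq_infinite)
    have "(\<integral>\<^sup>+\<omega>. (\<Sum>k. ennreal (?I K k \<omega> * Y k \<omega>)) \<partial>M) = (\<Sum>k. \<integral>\<^sup>+\<omega>. ennreal (?I K k \<omega>) * ennreal (Y k \<omega>) \<partial>M)"
      by (subst nn_integral_suminf[symmetric]) (auto simp: ennreal_mult Y I_nonneg)
    also have "\<dots> \<le> (\<Sum>k. \<integral>\<^sup>+\<omega>. ennreal (?I K k \<omega>) * ennreal (h k \<omega>) \<partial>M)"
      by (intro suminf_le conditionally_leD[OF bound] summableI measurable_compose[OF I_F measurable_ennreal])
    also have "\<dots> \<le> ennreal (real K)" by (rule suminf_nn_integral_budget_le[OF h])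
    also have "\<dots> < \<infinity>" by simp
    finally show "(\<integral>\<^sup>+\<omega>. (\<Sum>k. ennreal (?I K k \<omega> * Y k \<omega>)) \<partial>M) \<noteq> \<infinity>" by simp
  qed measurable
  then have "AE \<omega> in M. \<forall>K. (\<Sum>k. ennreal (?I K k \<omega> * Y k \<omega>)) \<noteq> \<infinity>"
    by (simp add: AE_all_countable)
  then show ?thesis using summable
  proof eventually_elim
    case (elim \<omega>)
    obtain K where "\<And>k. ?I K k \<omega> = 1" using budget_eventually_one[of h \<omega>] h(2) elim(2) by blast
    then have "(\<Sum>k. ennreal (Y k \<omega>)) \<noteq> \<infinity>" using elim(1)[rule_format, of K] by simp
    then show ?case using Y(2) by (intro summable_suminf_not_top) (auto simp: infinity_ennreal_def)
  qed
qed

end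

lemma convergent_if_tails_small:
  fixes x :: "nat \<Rightarrow> real"
  assumes "\<And>i. \<exists>l. \<forall>j\<ge>l. \<bar>\<Sum>k\<in>{l..<j}. x k\<bar> \<le> inverse (real (Suc i))"
  shows "convergent (\<lambda>n. \<Sum>k<n. x k)"
proof -
  have "Cauchy (\<lambda>n. \<Sum>k<n. x k)"
  proof (rule CauchyI)
    fix e :: real assume e: "e > 0"
    then obtain i where i: "inverse (real (Suc i)) < e / 2" using reals_Archimedean[of "e/2"] by auto
    obtain l where l: "\<And>j. j \<ge> l \<Longrightarrow> \<bar>\<Sum>k\<in>{l..<j}. x k\<bar> \<le> inverse (real (Suc i))" using assms by blast
    have split: "(\<Sum>k<j. x k) = (\<Sum>k<l. x k) + (\<Sum>k\<in>{l..<j}. x k)" if "j \<ge> l" for j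
      using sum.atLeastLessThan_concat[of 0 l j x] that by (simp add: lessThan_atLeast0)
    show "\<exists>N. \<forall>j\<ge>N. \<forall>n\<ge>N. norm ((\<Sum>k<j. x k) - (\<Sum>k<n. x k)) < e"
    proof (intro exI[of _ l] allI impI)
      fix j n assume "l \<le> j" "l \<le> n"
      then show "norm ((\<Sum>k<j. x k) - (\<Sum>k<n. x k)) < e"
        using l[of j] l[of n] i split[of j] split[of n] unfolding real_norm_def by linarith
    qed
  qed
  then show ?thesis by (simp add: Cauchy_convergent_iff)
qed

text \<open>
  Square-integrability is required only conditionally: \<open>m k\<close> bounds the conditional variance of \<open>Z k\<close>.
\<close>

locale martingale_increments = filtered_prob_space +
  fixes Z m :: "nat \<Rightarrow> 'a \<Rightarrow> real"
  assumes Z_measurable: "Z k \<in> borel_measurable (F (Suc k))"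
    and Z_integrable: "integrable M (Z k)"
    and Z_centred: "AE \<omega> in M. real_cond_exp M (F k) (Z k) \<omega> = 0"
    and m_measurable: "m k \<in> borel_measurable (F k)"
    and m_nonneg: "m k \<omega> \<ge> 0"
    and Z_variance: "conditionally_le k (\<lambda>\<omega>. (Z k \<omega>)\<^sup>2) (m k)"
begin

lemma Z_M [measurable]: "Z k \<in> borel_measurable M"
  by (rule borel_measurable_F_M[OF Z_measurable])

lemma partial_sum_measurable:
  assumes "\<And>k. w k \<in> borel_measurable (F k)"
  shows "(\<lambda>\<omega>. \<Sum>k<n. w k \<omega> * Z k \<omega>) \<in> borel_measurable (F n)"
  by (intro borel_measurable_sum borel_measurable_times borel_measurable_F_mono[OF assms]
      borel_measurable_F_mono[OF Z_measurable]) auto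

lemma second_moment_term:
  assumes w: "w \<in> borel_measurable (F k)"
  shows "(\<integral>\<^sup>+\<omega>. ennreal ((w \<omega> * Z k \<omega>)\<^sup>2) \<partial>M) \<le> (\<integral>\<^sup>+\<omega>. ennreal ((w \<omega>)\<^sup>2 * m k \<omega>) \<partial>M)"
proof -
  have [measurable]: "w \<in> borel_measurable (F k)" by (rule w)
  have "(\<integral>\<^sup>+\<omega>. ennreal ((w \<omega>)\<^sup>2) * ennreal ((Z k \<omega>)\<^sup>2) \<partial>M) \<le> (\<integral>\<^sup>+\<omega>. ennreal ((w \<omega>)\<^sup>2) * ennreal (m k \<omega>) \<partial>M)"
    by (rule conditionally_leD[OF Z_variance]) measurable
  then show ?thesis by (simp add: power_mult_distrib ennreal_mult m_nonneg)
qed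

text \<open>
  Orthogonality of the increments: the past sum times the weight is measurable with respect to \<open>F n\<close>, hence
  orthogonal to \<open>Z n\<close>.
\<close>

lemma second_moment_sum:
  assumes w: "\<And>k. w k \<in> borel_measurable (F k)"
    and fin: "\<And>k. (\<integral>\<^sup>+\<omega>. ennreal ((w k \<omega>)\<^sup>2 * m k \<omega>) \<partial>M) < \<infinity>"
  shows "integrable M (\<lambda>\<omega>. (\<Sum>k<n. w k \<omega> * Z k \<omega>)\<^sup>2) \<and>
    (\<integral>\<^sup>+\<omega>. ennreal ((\<Sum>k<n. w k \<omega> * Z k \<omega>)\<^sup>2) \<partial>M) \<le> (\<Sum>k<n. \<integral>\<^sup>+\<omega>. ennreal ((w k \<omega>)\<^sup>2 * m k \<omega>) \<partial>M)"
proof (induction n)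
  case (Suc n)
  interpret S: sigma_finite_subalgebra M "F n" by (rule sigma_finite_subalgebra_F)
  define G where "G \<omega> = (\<Sum>k<n. w k \<omega> * Z k \<omega>)" for \<omega>
  define D where "D \<omega> = w n \<omega> * Z n \<omega>" for \<omega>
  have G_F: "G \<in> borel_measurable (F n)" unfolding G_def by (rule partial_sum_measurable[OF w])
  have [measurable]: "G \<in> borel_measurable M" "w n \<in> borel_measurable M"
    by (rule borel_measurable_F_M[OF G_F] borel_measurable_F_M[OF w])+
  have D_meas [measurable]: "D \<in> borel_measurable M" unfolding D_def by measurable
  have G2: "integrable M (\<lambda>\<omega>. (G \<omega>)\<^sup>2)" using Suc by (simp add: G_def)
  have D2le: "(\<integral>\<^sup>+\<omega>. ennreal ((D \<omega>)\<^sup>2) \<partial>M) \<le> (\<integral>\<^sup>+\<omega>. ennreal ((w n \<omega>)\<^sup>2 * m n \<omega>) \<partial>M)"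
    unfolding D_def by (rule second_moment_term[OF w])
  have D2: "integrable M (\<lambda>\<omega>. (D \<omega>)\<^sup>2)"
    using order.strict_trans1[OF D2le fin] by (intro integrableI_nonneg) auto
  have GD: "integrable M (\<lambda>\<omega>. G \<omega> * D \<omega>)"
  proof (rule Bochner_Integration.integrable_bound[OF Bochner_Integration.integrable_add[OF G2 D2]])
    show "AE \<omega> in M. norm (G \<omega> * D \<omega>) \<le> norm ((G \<omega>)\<^sup>2 + (D \<omega>)\<^sup>2)"
    proof (intro AE_I2)
      fix \<omega>
      have "2 * (\<bar>G \<omega>\<bar> * \<bar>D \<omega>\<bar>) \<le> (G \<omega>)\<^sup>2 + (D \<omega>)\<^sup>2"
        using sum_squares_bound[of "\<bar>G \<omega>\<bar>" "\<bar>D \<omega>\<bar>"] by simp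
      moreover have "\<bar>G \<omega>\<bar> * \<bar>D \<omega>\<bar> \<le> 2 * (\<bar>G \<omega>\<bar> * \<bar>D \<omega>\<bar>)" by simp
      ultimately have "\<bar>G \<omega>\<bar> * \<bar>D \<omega>\<bar> \<le> (G \<omega>)\<^sup>2 + (D \<omega>)\<^sup>2" by linarith
      then show "norm (G \<omega> * D \<omega>) \<le> norm ((G \<omega>)\<^sup>2 + (D \<omega>)\<^sup>2)"
        by (simp add: abs_mult)
    qed
  qed measurable
  have GD0: "(\<integral>\<omega>. G \<omega> * D \<omega> \<partial>M) = 0"
  proof -
    have "(\<integral>\<omega>. G \<omega> * D \<omega> \<partial>M) = (\<integral>\<omega>. (G \<omega> * w n \<omega>) * Z n \<omega> \<partial>M)"
      by (simp add: D_def mult.assoc)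
    also have "\<dots> = (\<integral>\<omega>. (G \<omega> * w n \<omega>) * real_cond_exp M (F n) (Z n) \<omega> \<partial>M)"
      using GD G_F w[of n] by (intro S.real_cond_exp_intg(2)[symmetric]) (auto simp: D_def mult.assoc)
    also have "\<dots> = 0"
      using Z_centred[of n] by (intro integral_eq_zero_AE) auto
    finally show ?thesis .
  qed
  have sq: "(\<Sum>k<Suc n. w k \<omega> * Z k \<omega>)\<^sup>2 = (G \<omega>)\<^sup>2 + (D \<omega>)\<^sup>2 + 2 * (G \<omega> * D \<omega>)" for \<omega>
    by (simp add: G_def D_def power2_sum)
  have int: "integrable M (\<lambda>\<omega>. (G \<omega>)\<^sup>2 + (D \<omega>)\<^sup>2 + 2 * (G \<omega> * D \<omega>))"
    using G2 D2 GD by simp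
  have "(\<integral>\<omega>. (G \<omega>)\<^sup>2 + (D \<omega>)\<^sup>2 + 2 * (G \<omega> * D \<omega>) \<partial>M) = (\<integral>\<omega>. (G \<omega>)\<^sup>2 \<partial>M) + (\<integral>\<omega>. (D \<omega>)\<^sup>2 \<partial>M)"
    using G2 D2 GD GD0 by simp
  then have "(\<integral>\<^sup>+\<omega>. ennreal ((\<Sum>k<Suc n. w k \<omega> * Z k \<omega>)\<^sup>2) \<partial>M)
      = (\<integral>\<^sup>+\<omega>. ennreal ((G \<omega>)\<^sup>2) \<partial>M) + (\<integral>\<^sup>+\<omega>. ennreal ((D \<omega>)\<^sup>2) \<partial>M)"
    using int G2 D2 unfolding sq
    by (subst nn_integral_eq_integral) (auto simp: nn_integral_eq_integral sq[symmetric])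
  also have "\<dots> \<le> (\<Sum>k<Suc n. \<integral>\<^sup>+\<omega>. ennreal ((w k \<omega>)\<^sup>2 * m k \<omega>) \<partial>M)"
    using Suc D2le by (simp add: G_def[symmetric] add_mono)
  finally show ?case using int unfolding sq by blast
qed simp

text \<open>
  Kolmogorov's inequality. Instead of splitting according to the first time at which the partial sums exceed
  \<open>\<epsilon>\<close>, the weights are set to 0 from that time on. They stay predictable, the stopped sum still exceeds
  \<open>\<epsilon>\<close> at the end, and Chebyshev's inequality applies to it.
\<close>

lemma maximal_inequality:
  assumes w: "\<And>k. w k \<in> borel_measurable (F k)"
    and fin: "\<And>k. (\<integral>\<^sup>+\<omega>. ennreal ((w k \<omega>)\<^sup>2 * m k \<omega>) \<partial>M) < \<infinity>"
    and \<epsilon>: "\<epsilon> > 0"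
  shows "emeasure M {\<omega> \<in> space M. \<exists>j\<le>n. \<bar>\<Sum>k<j. w k \<omega> * Z k \<omega>\<bar> > \<epsilon>}
    \<le> ennreal (1 / \<epsilon>\<^sup>2) * (\<Sum>k<n. \<integral>\<^sup>+\<omega>. ennreal ((w k \<omega>)\<^sup>2 * m k \<omega>) \<partial>M)"
proof -
  define S where "S n \<omega> = (\<Sum>k<n. w k \<omega> * Z k \<omega>)" for n \<omega>
  define below where "below k \<omega> \<longleftrightarrow> (\<forall>j\<le>k. \<bar>S j \<omega>\<bar> \<le> \<epsilon>)" for k \<omega>
  have below_0: "below 0 \<omega>" for \<omega> using \<epsilon> by (simp add: below_def S_def)
  have below_Suc: "below (Suc k) \<omega> \<longleftrightarrow> below k \<omega> \<and> \<bar>S (Suc k) \<omega>\<bar> \<le> \<epsilon>" for k \<omega>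
    by (auto simp: below_def le_Suc_eq)
  define w' where "w' k \<omega> = (if below k \<omega> then w k \<omega> else 0)" for k \<omega>
  have S_F: "S j \<in> borel_measurable (F k)" if "j \<le> k" for j k
    unfolding S_def by (rule borel_measurable_F_mono[OF partial_sum_measurable[OF w] that])
  have w'_F: "w' k \<in> borel_measurable (F k)" for k
  proof -
    define b :: "real \<Rightarrow> real" where "b x = (if \<bar>x\<bar> \<le> \<epsilon> then 1 else 0)" for x
    have b [measurable]: "b \<in> borel_measurable borel" unfolding b_def by measurable
    have "(\<Prod>j\<le>k. b (S j \<omega>)) = (if below k \<omega> then 1 else 0)" for \<omega>
    proof (induction k)
      case 0
      show ?case using \<epsilon> by (simp add: b_def S_def below_0)
    next
      case (Suc k)
      show ?case using Suc by (simp add: below_Suc b_def)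
    qed
    then have "w' k = (\<lambda>\<omega>. w k \<omega> * (\<Prod>j\<in>{..k}. b (S j \<omega>)))"
      by (simp add: w'_def fun_eq_iff)
    moreover have "(\<lambda>\<omega>. w k \<omega> * (\<Prod>j\<in>{..k}. b (S j \<omega>))) \<in> borel_measurable (F k)"
      by (intro borel_measurable_times borel_measurable_prod w measurable_compose[OF S_F b]) simp
    ultimately show ?thesis by simp
  qed
  have w'_le: "(\<integral>\<^sup>+\<omega>. ennreal ((w' k \<omega>)\<^sup>2 * m k \<omega>) \<partial>M) \<le> (\<integral>\<^sup>+\<omega>. ennreal ((w k \<omega>)\<^sup>2 * m k \<omega>) \<partial>M)" for k
    by (intro nn_integral_mono) (auto simp: w'_def m_nonneg)
  define S' where "S' \<omega> = (\<Sum>k<n. w' k \<omega> * Z k \<omega>)" for \<omega>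
  have S'_M [measurable]: "S' \<in> borel_measurable M"
    unfolding S'_def by (rule borel_measurable_F_M[OF partial_sum_measurable[OF w'_F]])
  have S_M [measurable]: "S j \<in> borel_measurable M" for j
    by (rule borel_measurable_F_M[OF S_F[OF order_refl]])
  have stop: "(below n \<omega> \<longrightarrow> (\<Sum>k<n. w' k \<omega> * Z k \<omega>) = S n \<omega>) \<and>
      (\<not> below n \<omega> \<longrightarrow> \<bar>\<Sum>k<n. w' k \<omega> * Z k \<omega>\<bar> > \<epsilon>)" for \<omega> n
  proof (induction n)
    case (Suc n)
    show ?case
    proof (cases "below n \<omega>")
      case True
      then have "(\<Sum>k<Suc n. w' k \<omega> * Z k \<omega>) = S (Suc n) \<omega>"
        using Suc by (simp add: w'_def S_def)
      then show ?thesis using True unfolding below_Suc by (simp add: not_le)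
    next
      case False
      then have "w' n \<omega> = 0" by (simp add: w'_def)
      then show ?thesis using Suc False unfolding below_Suc by simp
    qed
  qed (simp add: below_0 S_def)
  have "{\<omega> \<in> space M. \<exists>j\<le>n. \<bar>S j \<omega>\<bar> > \<epsilon>} \<subseteq> {\<omega> \<in> space M. 1 \<le> ennreal (1 / \<epsilon>\<^sup>2) * ennreal ((S' \<omega>)\<^sup>2)}"
  proof safe
    fix \<omega> j assume "j \<le> n" "\<bar>S j \<omega>\<bar> > \<epsilon>"
    then have "\<not> below n \<omega>" by (auto simp: below_def not_le)
    with stop[of n \<omega>] have "\<bar>S' \<omega>\<bar> > \<epsilon>" by (simp add: S'_def)
    then have "\<epsilon>\<^sup>2 \<le> (S' \<omega>)\<^sup>2" using \<epsilon> by (simp add: abs_le_square_iff[symmetric])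
    then have "1 \<le> 1 / \<epsilon>\<^sup>2 * (S' \<omega>)\<^sup>2" using \<epsilon> by (simp add: field_simps)
    then have "ennreal 1 \<le> ennreal (1 / \<epsilon>\<^sup>2 * (S' \<omega>)\<^sup>2)" by (rule ennreal_leI)
    moreover have "ennreal (1 / \<epsilon>\<^sup>2 * (S' \<omega>)\<^sup>2) = ennreal (1 / \<epsilon>\<^sup>2) * ennreal ((S' \<omega>)\<^sup>2)"
      by (rule ennreal_mult) simp_all
    ultimately show "1 \<le> ennreal (1 / \<epsilon>\<^sup>2) * ennreal ((S' \<omega>)\<^sup>2)" by (metis ennreal_1)
  qed
  then have "emeasure M {\<omega> \<in> space M. \<exists>j\<le>n. \<bar>S j \<omega>\<bar> > \<epsilon>}
      \<le> emeasure M {\<omega> \<in> space M. 1 \<le> ennreal (1 / \<epsilon>\<^sup>2) * ennreal ((S' \<omega>)\<^sup>2)}"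
    by (rule emeasure_mono) measurable
  also have "\<dots> \<le> ennreal (1 / \<epsilon>\<^sup>2) * (\<integral>\<^sup>+\<omega>. ennreal ((S' \<omega>)\<^sup>2) * indicator (space M) \<omega> \<partial>M)"
    by (rule nn_integral_Markov_inequality) measurable
  also have "\<dots> \<le> ennreal (1 / \<epsilon>\<^sup>2) * (\<Sum>k<n. \<integral>\<^sup>+\<omega>. ennreal ((w k \<omega>)\<^sup>2 * m k \<omega>) \<partial>M)"
  proof (rule mult_left_mono)
    have "(\<integral>\<^sup>+\<omega>. ennreal ((S' \<omega>)\<^sup>2) * indicator (space M) \<omega> \<partial>M) = (\<integral>\<^sup>+\<omega>. ennreal ((S' \<omega>)\<^sup>2) \<partial>M)"
      by (intro nn_integral_cong) simp
    also have "\<dots> \<le> (\<Sum>k<n. \<integral>\<^sup>+\<omega>. ennreal ((w' k \<omega>)\<^sup>2 * m k \<omega>) \<partial>M)"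
      unfolding S'_def using second_moment_sum[OF w'_F order.strict_trans1[OF w'_le fin]] by (rule conjunct2)
    also have "\<dots> \<le> (\<Sum>k<n. \<integral>\<^sup>+\<omega>. ennreal ((w k \<omega>)\<^sup>2 * m k \<omega>) \<partial>M)"
      by (rule sum_mono[OF w'_le])
    finally show "(\<integral>\<^sup>+\<omega>. ennreal ((S' \<omega>)\<^sup>2) * indicator (space M) \<omega> \<partial>M)
      \<le> (\<Sum>k<n. \<integral>\<^sup>+\<omega>. ennreal ((w k \<omega>)\<^sup>2 * m k \<omega>) \<partial>M)" .
  qed simp
  finally show ?thesis unfolding S_def .
qed

lemma AE_tail_small:
  assumes w: "\<And>k. w k \<in> borel_measurable (F k)"
    and fin: "(\<Sum>k. \<integral>\<^sup>+\<omega>. ennreal ((w k \<omega>)\<^sup>2 * m k \<omega>) \<partial>M) < \<infinity>"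
    and \<epsilon>: "\<epsilon> > 0"
  shows "AE \<omega> in M. \<exists>l. \<forall>j\<ge>l. \<bar>\<Sum>k\<in>{l..<j}. w k \<omega> * Z k \<omega>\<bar> \<le> \<epsilon>"
proof -
  define a where "a k = (\<integral>\<^sup>+\<omega>. ennreal ((w k \<omega>)\<^sup>2 * m k \<omega>) \<partial>M)" for k
  \<comment> \<open>Weights that start at \<open>l\<close>, so that the partial sums are tails of the series.\<close>
  define W where "W l k \<omega> = (if k < l then 0 else w k \<omega>)" for l k \<omega>
  have W_F: "W l k \<in> borel_measurable (F k)" for l k
    using w[of k] unfolding W_def by (cases "k < l") simp_all
  have a_W: "(\<integral>\<^sup>+\<omega>. ennreal ((W l k \<omega>)\<^sup>2 * m k \<omega>) \<partial>M) = (if k < l then 0 else a k)" for l k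
    by (simp add: W_def a_def)
  have a_fin: "a k < \<infinity>" for k
  proof -
    have "a k \<le> (\<Sum>k. a k)" using sum_le_suminf[of a "{k}"] by (simp add: summableI)
    then show ?thesis using fin[folded a_def] by (rule le_less_trans)
  qed
  define b where "b k = enn2real (a k)" for k
  have ab: "a k = ennreal (b k)" for k using a_fin[of k] by (simp add: b_def)
  have b0: "b k \<ge> 0" for k by (simp add: b_def)
  have b_sum: "summable b"
    using fin b0 by (intro summable_suminf_not_top) (auto simp: ab a_def[symmetric])
  define T where "T l \<omega> j = (\<Sum>k<j. W l k \<omega> * Z k \<omega>)" for l \<omega> j
  have T_M [measurable]: "(\<lambda>\<omega>. T l \<omega> j) \<in> borel_measurable M" for l j
    unfolding T_def by (rule borel_measurable_F_M[OF partial_sum_measurable[OF W_F]])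
  have T_eq: "T l \<omega> j = (\<Sum>k\<in>{l..<j}. w k \<omega> * Z k \<omega>)" for l \<omega> j
    unfolding T_def by (rule sum.mono_neutral_cong_right) (auto simp: W_def)
  define E where "E l = {\<omega> \<in> space M. \<exists>j. \<bar>T l \<omega> j\<bar> > \<epsilon>}" for l
  have E_meas [measurable]: "E l \<in> sets M" for l unfolding E_def by measurable
  have E_le: "emeasure M (E l) \<le> ennreal (1 / \<epsilon>\<^sup>2 * (\<Sum>k. b (k + l)))" for l
  proof -
    have "emeasure M (E l) = emeasure M (\<Union>n. {\<omega> \<in> space M. \<exists>j\<le>n. \<bar>T l \<omega> j\<bar> > \<epsilon>})"
      unfolding E_def by (rule arg_cong[where f = "emeasure M"]) blast
    also have "\<dots> = (SUP n. emeasure M {\<omega> \<in> space M. \<exists>j\<le>n. \<bar>T l \<omega> j\<bar> > \<epsilon>})"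
    proof (rule SUP_emeasure_incseq[symmetric])
      show "range (\<lambda>n. {\<omega> \<in> space M. \<exists>j\<le>n. \<bar>T l \<omega> j\<bar> > \<epsilon>}) \<subseteq> sets M"
        by (intro image_subsetI) measurable
      show "incseq (\<lambda>n. {\<omega> \<in> space M. \<exists>j\<le>n. \<bar>T l \<omega> j\<bar> > \<epsilon>})"
        unfolding incseq_def using order_trans by blast
    qed
    also have "\<dots> \<le> ennreal (1 / \<epsilon>\<^sup>2 * (\<Sum>k. b (k + l)))"
    proof (rule SUP_least)
      fix n
      have "emeasure M {\<omega> \<in> space M. \<exists>j\<le>n. \<bar>T l \<omega> j\<bar> > \<epsilon>} \<le> ennreal (1 / \<epsilon>\<^sup>2) * (\<Sum>k<n. if k < l then 0 else a k)"
        using maximal_inequality[of "W l", OF W_F _ \<epsilon>, of n] a_fin by (simp add: a_W T_def)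
      also have "(\<Sum>k<n. if k < l then 0 else a k) = ennreal (\<Sum>k<n. if k < l then 0 else b k)"
      proof -
        have "(\<Sum>k<n. if k < l then 0 else a k) = (\<Sum>k<n. ennreal (if k < l then 0 else b k))"
          by (intro sum.cong) (auto simp: ab)
        also have "\<dots> = ennreal (\<Sum>k<n. if k < l then 0 else b k)"
          by (rule sum_ennreal) (simp add: b0)
        finally show ?thesis .
      qed
      also have "(\<Sum>k<n. if k < l then 0 else b k) \<le> (\<Sum>k. b (k + l))"
      proof -
        have "(\<Sum>k<n. if k < l then 0 else b k) = (\<Sum>k\<in>{l..<n}. b k)"
          by (rule sum.mono_neutral_cong_right) auto
        also have "\<dots> = (\<Sum>k<n-l. b (k + l))"
          by (rule sum.reindex_bij_witness[of _ "\<lambda>k. k + l" "\<lambda>k. k - l"]) auto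
        also have "\<dots> \<le> (\<Sum>k. b (k + l))"
          using b0 b_sum by (intro sum_le_suminf) (auto intro: summable_ignore_initial_segment)
        finally show ?thesis .
      qed
      finally show "emeasure M {\<omega> \<in> space M. \<exists>j\<le>n. \<bar>T l \<omega> j\<bar> > \<epsilon>} \<le> ennreal (1 / \<epsilon>\<^sup>2 * (\<Sum>k. b (k + l)))"
        using ennreal_mult[of "1 / \<epsilon>\<^sup>2" "\<Sum>k. b (k + l)"] b_sum b0
        by (simp add: ennreal_leI mult_left_mono suminf_nonneg summable_ignore_initial_segment)
    qed
    finally show ?thesis .
  qed
  have "emeasure M (\<Inter>l. E l) \<le> 0"
  proof (rule ennreal_le_epsilon)
    fix r :: real assume r: "r > 0"
    obtain l where l: "norm (\<Sum>k. b (k + l)) < r * \<epsilon>\<^sup>2"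
      using suminf_exist_split[OF _ b_sum, of "r * \<epsilon>\<^sup>2"] r \<epsilon> by auto
    have "emeasure M (\<Inter>l. E l) \<le> emeasure M (E l)" by (rule emeasure_mono) auto
    also note E_le
    also have "1 / \<epsilon>\<^sup>2 * (\<Sum>k. b (k + l)) \<le> r" using l \<epsilon> by (simp add: field_simps abs_less_iff)
    finally show "emeasure M (\<Inter>l. E l) \<le> 0 + ennreal r" by (simp add: ennreal_leI)
  qed
  then have "AE \<omega> in M. \<omega> \<notin> (\<Inter>l. E l)"
    by (intro AE_not_in) (auto simp: null_sets_def)
  then show ?thesis
    using AE_space
  proof eventually_elim
    case (elim \<omega>)
    then obtain l where "\<omega> \<notin> E l" by blast
    then have "\<bar>T l \<omega> j\<bar> \<le> \<epsilon>" for j using elim(2) by (auto simp: E_def not_less)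
    then show ?case unfolding T_eq by blast
  qed
qed

text \<open>
  The cut-off reduces the claim to weights of finite total variance, for which the maximal inequality makes
  the tails small.
\<close>

lemma AE_convergent:
  assumes w: "\<And>k. w k \<in> borel_measurable (F k)"
    and summable: "AE \<omega> in M. summable (\<lambda>k. (w k \<omega>)\<^sup>2 * m k \<omega>)"
  shows "AE \<omega> in M. convergent (\<lambda>n. \<Sum>k<n. w k \<omega> * Z k \<omega>)"
proof -
  define h where "h k \<omega> = (w k \<omega>)\<^sup>2 * m k \<omega>" for k \<omega>
  have h: "h k \<in> borel_measurable (F k)" "h k \<omega> \<ge> 0" for k \<omega>
    unfolding h_def by (intro borel_measurable_times borel_measurable_power w m_measurable) (simp add: m_nonneg)
  let ?I = "budget h"
  have I_F: "?I K k \<in> borel_measurable (F k)" for K k by (rule budget_measurable[OF h(1)])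
  have "AE \<omega> in M. \<exists>l. \<forall>j\<ge>l. \<bar>\<Sum>k\<in>{l..<j}. (?I K k \<omega> * w k \<omega>) * Z k \<omega>\<bar> \<le> inverse (real (Suc i))" for K i
  proof (rule AE_tail_small)
    show "(\<lambda>\<omega>. ?I K k \<omega> * w k \<omega>) \<in> borel_measurable (F k)" for k
      by (intro borel_measurable_times w I_F)
    have "ennreal ((?I K k \<omega> * w k \<omega>)\<^sup>2 * m k \<omega>) = ennreal (?I K k \<omega>) * ennreal (h k \<omega>)" for k \<omega>
      by (auto simp: budget_def h_def)
    then show "(\<Sum>k. \<integral>\<^sup>+\<omega>. ennreal ((?I K k \<omega> * w k \<omega>)\<^sup>2 * m k \<omega>) \<partial>M) < \<infinity>"
      using suminf_nn_integral_budget_le[OF h, of K] by (simp add: le_less_trans)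
  qed simp
  then have "AE \<omega> in M. \<forall>K i. \<exists>l. \<forall>j\<ge>l. \<bar>\<Sum>k\<in>{l..<j}. (?I K k \<omega> * w k \<omega>) * Z k \<omega>\<bar> \<le> inverse (real (Suc i))"
    by (intro AE_all_countable[THEN iffD2] allI)
  then show ?thesis using summable
  proof eventually_elim
    case (elim \<omega>)
    obtain K where K: "\<And>k. ?I K k \<omega> = 1"
      using budget_eventually_one[of h \<omega>] h(2) elim(2) by (auto simp: h_def)
    show ?case
      using elim(1)[rule_format, of K] by (intro convergent_if_tails_small) (simp add: K)
  qed
qed

end

section \<open>Weighted sums of the driving noise\<close>

text \<open>
  Kronecker's lemma in a form that does not distinguish whether the normalising sums \<open>1 + (\<Sum>i\<le>k. b i)\<close> are
  bounded. The proof is summation by parts against the remainders of the convergent series.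
\<close>

lemma kronecker_bound:
  fixes a b :: "nat \<Rightarrow> real"
  assumes b: "\<And>k. b k \<ge> 0"
    and conv: "convergent (\<lambda>n. \<Sum>k<n. a k / (1 + (\<Sum>i\<le>k. b i)))"
    and \<eta>: "\<eta> > 0"
  shows "\<exists>C. \<forall>n. \<bar>\<Sum>k<n. a k\<bar> \<le> C + \<eta> * (\<Sum>k<n. b k)"
proof -
  define B where "B n = 1 + (\<Sum>i<n. b i)" for n
  define T where "T n = (\<Sum>k<n. a k / B (Suc k))" for n
  have B_pos: "B n \<ge> 1" for n unfolding B_def using b by (simp add: sum_nonneg)
  have B_Suc: "B (Suc n) = B n + b n" for n by (simp add: B_def)
  have "convergent T" using conv by (simp add: T_def[abs_def] B_def lessThan_Suc_atMost)
  then obtain L where "T \<longlonglongrightarrow> L" by (auto simp: convergent_def)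
  then have "\<exists>N. \<forall>n\<ge>N. norm (T n - L) < \<eta> / 2" using \<eta> by (intro LIMSEQ_D) simp_all
  then obtain N where N: "\<bar>T n - L\<bar> \<le> \<eta> / 2" if "n \<ge> N" for n by fastforce
  have a: "a n = B (Suc n) * (T (Suc n) - T n)" for n
    using B_pos[of "Suc n"] by (simp add: T_def)
  have key: "\<bar>(\<Sum>k<n. a k) - (\<Sum>k<N. a k) - B n * (T n - L) + B N * (T N - L)\<bar> \<le> \<eta> / 2 * (B n - B N)" if "n \<ge> N" for n
    using that
  proof (induction n rule: dec_induct)
    case (step n)
    have "(\<Sum>k<Suc n. a k) - (\<Sum>k<N. a k) - B (Suc n) * (T (Suc n) - L) + B N * (T N - L)
      = ((\<Sum>k<n. a k) - (\<Sum>k<N. a k) - B n * (T n - L) + B N * (T N - L)) - b n * (T n - L)"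
      unfolding sum.lessThan_Suc a[of n] B_Suc by (simp add: algebra_simps)
    moreover have "\<bar>b n * (T n - L)\<bar> \<le> \<eta> / 2 * b n"
      using mult_left_mono[OF N[OF step(1)] b[of n]] b[of n] by (simp add: abs_mult mult.commute)
    moreover have "\<eta> / 2 * (B (Suc n) - B N) = \<eta> / 2 * (B n - B N) + \<eta> / 2 * b n"
      by (simp add: B_Suc algebra_simps add_divide_distrib diff_divide_distrib)
    ultimately show ?case using step(3) by linarith
  qed simp
  define C where "C = (\<Sum>k<N. \<bar>a k\<bar>) + \<eta> * B N + \<eta>"
  show ?thesis
  proof (intro exI[of _ C] allI)
    fix n
    have Bn: "\<eta> * B n = \<eta> + \<eta> * (\<Sum>k<n. b k)" by (simp add: B_def algebra_simps)
    have pos: "\<eta> * B N \<ge> 0" "\<eta> * (\<Sum>k<n. b k) \<ge> 0" using \<eta> B_pos[of N] b by (simp_all add: sum_nonneg)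
    have aN: "\<bar>\<Sum>k<N. a k\<bar> \<le> (\<Sum>k<N. \<bar>a k\<bar>)" by (rule sum_abs)
    show "\<bar>\<Sum>k<n. a k\<bar> \<le> C + \<eta> * (\<Sum>k<n. b k)"
    proof (cases "n \<ge> N")
      case True
      have "\<bar>B n * (T n - L)\<bar> \<le> \<eta> / 2 * B n" "\<bar>B N * (T N - L)\<bar> \<le> \<eta> / 2 * B N"
        using N[OF True] N[of N] B_pos[of n] B_pos[of N] by (simp_all add: abs_mult mult.commute mult_left_mono)
      then show ?thesis using key[OF True] aN Bn pos unfolding C_def right_diff_distrib by linarith
    next
      case False
      have "\<bar>\<Sum>k<n. a k\<bar> \<le> (\<Sum>k<n. \<bar>a k\<bar>)" by (rule sum_abs)
      also have "\<dots> \<le> (\<Sum>k<N. \<bar>a k\<bar>)" using False by (intro sum_mono2) auto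
      finally show ?thesis using pos \<eta> by (simp add: C_def)
    qed
  qed
qed

text \<open>
  Comparison with the integral of \<open>x powr (-q)\<close> over the interval between consecutive partial sums.
\<close>

lemma summable_div_partial_sums_powr:
  fixes b :: "nat \<Rightarrow> real"
  assumes b: "\<And>k. b k \<ge> 0" and q: "q > 1"
  shows "summable (\<lambda>k. b k * (1 + (\<Sum>i\<le>k. b i)) powr (-q))"
proof -
  define B where "B n = 1 + (\<Sum>i<n. b i)" for n
  have B_pos: "B n \<ge> 1" for n unfolding B_def using b by (simp add: sum_nonneg)
  have B_Suc: "B (Suc n) = B n + b n" for n by (simp add: B_def)
  have le: "b k * B (Suc k) powr (-q) \<le> (B k powr (1 - q) - B (Suc k) powr (1 - q)) / (q - 1)" for k
  proof (cases "b k = 0")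
    case False
    then have lt: "B k < B (Suc k)" using b[of k] by (simp add: B_Suc)
    have "\<exists>z>B k. z < B (Suc k) \<and> B (Suc k) powr (1 - q) - B k powr (1 - q) = (B (Suc k) - B k) * ((1 - q) * z powr (-q))"
    proof (rule MVT2[OF lt])
      fix x assume "B k \<le> x" "x \<le> B (Suc k)"
      then have "x > 0" using B_pos[of k] by linarith
      then show "((\<lambda>x. x powr (1 - q)) has_real_derivative (1 - q) * x powr (-q)) (at x)"
        by (auto intro!: derivative_eq_intros)
    qed
    then obtain z where z: "B k < z" "z < B (Suc k)"
      "B (Suc k) powr (1 - q) - B k powr (1 - q) = b k * ((1 - q) * z powr (-q))"
      by (auto simp: B_Suc)
    have "B (Suc k) powr (-q) \<le> z powr (-q)" using z B_pos[of k] q by (intro powr_mono2') auto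
    then have "b k * B (Suc k) powr (-q) \<le> b k * z powr (-q)" using b by (intro mult_left_mono)
    also have "\<dots> = (B k powr (1 - q) - B (Suc k) powr (1 - q)) / (q - 1)"
      using z(3) q by (simp add: field_simps)
    finally show ?thesis .
  qed (simp add: B_Suc)
  have "summable (\<lambda>k. b k * B (Suc k) powr (-q))"
  proof (rule summableI_nonneg_bounded[where x = "1 / (q - 1)"])
    fix n
    have "(\<Sum>k<n. b k * B (Suc k) powr (-q)) \<le> (\<Sum>k<n. (B k powr (1 - q) - B (Suc k) powr (1 - q)) / (q - 1))"
      by (rule sum_mono[OF le])
    also have "\<dots> = (B 0 powr (1 - q) - B n powr (1 - q)) / (q - 1)"
      by (simp add: sum_divide_distrib[symmetric] sum_lessThan_telescope'[of "\<lambda>k. B k powr (1 - q)" n])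
    also have "\<dots> \<le> 1 / (q - 1)" using q by (intro divide_right_mono) (simp_all add: B_def)
    finally show "(\<Sum>k<n. b k * B (Suc k) powr (-q)) \<le> 1 / (q - 1)" .
  qed (use b in simp)
  then show ?thesis by (simp add: B_def lessThan_Suc_atMost)
qed

text \<open>
  The exponent \<open>2 * q\<close> is a moment of order above 2, capped at 4 since truncation gains nothing beyond that.
  The sequence \<open>\<kappa>\<close> bounds the conditional moments and is itself random.
\<close>

locale driving_noise = filtered_prob_space +
  fixes V :: "nat \<Rightarrow> 'a \<Rightarrow> real" and sigma_sq q :: real and \<kappa> :: "nat \<Rightarrow> 'a \<Rightarrow> real"
  assumes V_measurable: "V (Suc k) \<in> borel_measurable (F (Suc k))"
    and V_integrable: "integrable M (V (Suc k))"
    and V_centred: "AE \<omega> in M. real_cond_exp M (F k) (V (Suc k)) \<omega> = 0"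
    and sigma_pos: "sigma_sq > 0"
    and V_variance: "AE \<omega> in M. nn_cond_exp M (F k) (\<lambda>\<eta>. ennreal ((V (Suc k) \<eta>)\<^sup>2)) \<omega> = ennreal sigma_sq"
    and q_gt: "q > 1" and q_le: "q \<le> 2"
    and \<kappa>_measurable: "\<kappa> k \<in> borel_measurable (F k)"
    and \<kappa>_nonneg: "\<kappa> k \<omega> \<ge> 0"
    and V_moment: "conditionally_le k (\<lambda>\<omega>. \<bar>V (Suc k) \<omega>\<bar> powr (2 * q)) (\<kappa> k)"
    and \<kappa>_bounded: "AE \<omega> in M. \<exists>C. \<forall>k. \<kappa> k \<omega> \<le> C"
begin

lemma V_M [measurable]: "V (Suc k) \<in> borel_measurable M"
  by (rule borel_measurable_F_M[OF V_measurable])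

lemma V_conditionally_le: "conditionally_le k (\<lambda>\<omega>. (V (Suc k) \<omega>)\<^sup>2) (\<lambda>_. sigma_sq)"
  by (rule conditionally_le_nn_cond_exp[OF _ V_variance]) measurable

text \<open>
  The series of \<open>w k * V (Suc k) / (1 + (\<Sum>i\<le>k. (w i)\<^sup>2))\<close> has summable conditional variances and
  therefore converges; Kronecker's lemma gives the claim.
\<close>

lemma AE_weighted_noise_sum:
  assumes w: "\<And>k. w k \<in> borel_measurable (F k)"
  shows "AE \<omega> in M. \<forall>\<eta>>0. \<exists>C. \<forall>n. \<bar>\<Sum>k<n. w k \<omega> * V (Suc k) \<omega>\<bar> \<le> C + \<eta> * (\<Sum>k<n. (w k \<omega>)\<^sup>2)"
proof -
  interpret MI: martingale_increments M F "\<lambda>k. V (Suc k)" "\<lambda>_ _. sigma_sq"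
    by unfold_locales (use V_measurable V_integrable V_centred sigma_pos V_conditionally_le in simp_all)
  define A where "A k \<omega> = 1 + (\<Sum>i\<le>k. (w i \<omega>)\<^sup>2)" for k \<omega>
  have A_pos: "A k \<omega> > 0" for k \<omega> unfolding A_def by (simp add: add_pos_nonneg sum_nonneg)
  have A_F: "A k \<in> borel_measurable (F k)" for k
    unfolding A_def
    by (intro borel_measurable_add borel_measurable_sum borel_measurable_power borel_measurable_F_mono[OF w]) simp_all
  have "AE \<omega> in M. convergent (\<lambda>n. \<Sum>k<n. (w k \<omega> / A k \<omega>) * V (Suc k) \<omega>)"
  proof (rule MI.AE_convergent)
    show "(\<lambda>\<omega>. w k \<omega> / A k \<omega>) \<in> borel_measurable (F k)" for k
      by (intro borel_measurable_divide w A_F)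
    have "(w k \<omega>)\<^sup>2 * (1 + (\<Sum>i\<le>k. (w i \<omega>)\<^sup>2)) powr (-2) = (w k \<omega> / A k \<omega>)\<^sup>2" for k \<omega>
      using A_pos[of k \<omega>] unfolding A_def[symmetric] by (simp add: powr_minus power_mult_distrib power_inverse divide_inverse)
    then have "summable (\<lambda>k. (w k \<omega> / A k \<omega>)\<^sup>2)" for \<omega>
      using summable_div_partial_sums_powr[of "\<lambda>k. (w k \<omega>)\<^sup>2" 2] by simp
    then show "AE \<omega> in M. summable (\<lambda>k. (w k \<omega> / A k \<omega>)\<^sup>2 * sigma_sq)"
      by (intro AE_I2 summable_mult2)
  qed
  then show ?thesis
  proof eventually_elim
    case (elim \<omega>)
    then show ?case
      using kronecker_bound[of "\<lambda>k. (w k \<omega>)\<^sup>2" "\<lambda>k. w k \<omega> * V (Suc k) \<omega>"] by (simp add: A_def)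
  qed
qed

text \<open>
  The terms of an almost surely convergent series are bounded. The exponent \<open>r\<close> in the proof lies strictly
  between 1 and \<open>q\<close>: the series of \<open>c k\<close> converges, and the growth exponent \<open>r / q\<close> is below 1.
\<close>

lemma AE_noise_growth:
  "AE \<omega> in M. \<exists>C. \<forall>k. (V (Suc k) \<omega>)\<^sup>2 \<le> C * real (Suc k) powr ((1 + q) / (2 * q))"
proof -
  define r where "r = (1 + q) / 2"
  have r: "r > 1" using q_gt by (simp add: r_def)
  define c where "c k = real (Suc k) powr (-r)" for k
  have c_nonneg: "c k \<ge> 0" for k by (simp add: c_def)
  have c_sum: "summable c"
    using r summable_real_powr_iff[of "-r"] unfolding c_def by (subst summable_Suc_iff) simp
  have "AE \<omega> in M. summable (\<lambda>k. c k * \<bar>V (Suc k) \<omega>\<bar> powr (2 * q))"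
  proof (rule AE_summable_of_conditionally_le[where h = "\<lambda>k \<omega>. c k * \<kappa> k \<omega>"])
    show "conditionally_le k (\<lambda>\<omega>. c k * \<bar>V (Suc k) \<omega>\<bar> powr (2 * q)) (\<lambda>\<omega>. c k * \<kappa> k \<omega>)" for k
      by (rule conditionally_le_mult[OF V_moment]) (simp_all add: c_nonneg)
    show "AE \<omega> in M. summable (\<lambda>k. c k * \<kappa> k \<omega>)"
      using \<kappa>_bounded
    proof eventually_elim
      case (elim \<omega>)
      then obtain C where C: "\<kappa> k \<omega> \<le> C" for k by blast
      show ?case
        by (rule summable_comparison_test'[where g = "\<lambda>k. c k * C" and N = 0])
          (use C c_nonneg \<kappa>_nonneg c_sum in \<open>auto intro: summable_mult2 mult_left_mono simp: abs_mult\<close>)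
    qed
  qed (use c_nonneg \<kappa>_nonneg \<kappa>_measurable in \<open>auto intro!: borel_measurable_times\<close>)
  then show ?thesis
  proof eventually_elim
    case (elim \<omega>)
    then have "(\<lambda>k. c k * \<bar>V (Suc k) \<omega>\<bar> powr (2 * q)) \<longlonglongrightarrow> 0" by (rule summable_LIMSEQ_zero)
    then have "Bseq (\<lambda>k. c k * \<bar>V (Suc k) \<omega>\<bar> powr (2 * q))" by (intro convergent_imp_Bseq convergentI)
    then obtain C where C: "C > 0" "\<And>k. norm (c k * \<bar>V (Suc k) \<omega>\<bar> powr (2 * q)) \<le> C"
      unfolding Bseq_def by blast
    have "(V (Suc k) \<omega>)\<^sup>2 \<le> C powr (1 / q) * real (Suc k) powr ((1 + q) / (2 * q))" for k
    proof -
      have "c k * \<bar>V (Suc k) \<omega>\<bar> powr (2 * q) \<le> C" using C(2)[of k] c_nonneg[of k] by simp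
      then have "\<bar>V (Suc k) \<omega>\<bar> powr (2 * q) \<le> C * real (Suc k) powr r"
        by (simp add: c_def powr_minus field_simps)
      then have "(\<bar>V (Suc k) \<omega>\<bar> powr (2 * q)) powr (1 / q) \<le> (C * real (Suc k) powr r) powr (1 / q)"
        using q_gt by (intro powr_mono2) auto
      also have "(\<bar>V (Suc k) \<omega>\<bar> powr (2 * q)) powr (1 / q) = (V (Suc k) \<omega>)\<^sup>2"
        using q_gt by (simp add: powr_powr)
      also have "(C * real (Suc k) powr r) powr (1 / q) = C powr (1 / q) * real (Suc k) powr ((1 + q) / (2 * q))"
        using C(1) by (simp add: powr_mult powr_powr r_def)
      finally show ?thesis .
    qed
    then show ?case by blast
  qed
qed

text \<open>
  A truncated square has a second moment that is controlled by the moment of order \<open>2 * q\<close>.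
\<close>

lemma truncated_square_le:
  fixes s v :: real
  assumes "s \<ge> 1"
  shows "(if v\<^sup>2 \<le> s then v\<^sup>2 else 0)\<^sup>2 \<le> s powr (2 - q) * \<bar>v\<bar> powr (2 * q)"
proof (cases "v = 0 \<or> \<not> v\<^sup>2 \<le> s")
  case False
  then have v: "v\<^sup>2 > 0" "v\<^sup>2 \<le> s" by auto
  have "(v\<^sup>2)\<^sup>2 = (v\<^sup>2) powr (2 - q) * (v\<^sup>2) powr q"
    using v(1) by (simp add: powr_add[symmetric])
  also have "(v\<^sup>2) powr q = \<bar>v\<bar> powr (2 * q)"
    using v(1) by (simp add: powr_powr[symmetric])
  also have "(v\<^sup>2) powr (2 - q) * \<bar>v\<bar> powr (2 * q) \<le> s powr (2 - q) * \<bar>v\<bar> powr (2 * q)"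
    using v q_le by (intro mult_right_mono powr_mono2) auto
  finally show ?thesis using v by simp
qed auto

lemma overflow_square_le:
  fixes s v :: real
  assumes "s \<ge> 1"
  shows "(if v\<^sup>2 \<le> s then 0 else v\<^sup>2) \<le> s powr (1 - q) * \<bar>v\<bar> powr (2 * q)"
proof (cases "v\<^sup>2 \<le> s")
  case False
  then have v: "v\<^sup>2 > 0" "v\<^sup>2 > s" using assms by auto
  have "v\<^sup>2 = (v\<^sup>2) powr (1 - q) * (v\<^sup>2) powr q"
    using v(1) by (simp add: powr_add[symmetric])
  also have "(v\<^sup>2) powr q = \<bar>v\<bar> powr (2 * q)"
    using v(1) by (simp add: powr_powr[symmetric])
  also have "(v\<^sup>2) powr (1 - q) * \<bar>v\<bar> powr (2 * q) \<le> s powr (1 - q) * \<bar>v\<bar> powr (2 * q)"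
    using v q_gt assms by (intro mult_right_mono powr_mono2') auto
  finally show ?thesis using False by simp
qed simp

lemma V_square_integrable: "integrable M (\<lambda>\<omega>. (V (Suc k) \<omega>)\<^sup>2)"
proof (rule integrableI_nonneg)
  have "(\<integral>\<^sup>+\<omega>. 1 * ennreal ((V (Suc k) \<omega>)\<^sup>2) \<partial>M) \<le> (\<integral>\<^sup>+\<omega>. 1 * ennreal sigma_sq \<partial>M)"
    by (rule conditionally_leD[OF V_conditionally_le]) simp
  also have "\<dots> < \<infinity>" by (simp add: emeasure_space_1)
  finally show "(\<integral>\<^sup>+\<omega>. ennreal ((V (Suc k) \<omega>)\<^sup>2) \<partial>M) < \<infinity>" by simp
qed simp_all

lemma V_square_cond_exp: "AE \<omega> in M. real_cond_exp M (F k) (\<lambda>\<omega>. (V (Suc k) \<omega>)\<^sup>2) \<omega> = sigma_sq"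
proof -
  interpret S: sigma_finite_subalgebra M "F k" by (rule sigma_finite_subalgebra_F)
  have "(\<lambda>\<omega>. ennreal (- (V (Suc k) \<omega>)\<^sup>2)) = (\<lambda>_. 0)" by (simp add: fun_eq_iff ennreal_neg)
  moreover have "AE \<omega> in M. 0 = nn_cond_exp M (F k) (\<lambda>_. 0) \<omega>"
    using S.nn_cond_exp_F_meas[of "\<lambda>_. 0"] by simp
  ultimately have "AE \<omega> in M. nn_cond_exp M (F k) (\<lambda>\<omega>. ennreal (- (V (Suc k) \<omega>)\<^sup>2)) \<omega> = 0" by auto
  then show ?thesis using V_variance[of k]
    by eventually_elim (use sigma_pos in \<open>simp add: real_cond_exp_def\<close>)
qed

text \<open>
  The squares of the noise need not be square-integrable. They are truncated at the level \<open>s k\<close> reached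
  by the normalising sums. The truncated and centred part is a martingale with summable conditional
  variances, the overflow and its conditional expectation are summable series of nonnegative terms, and
  Kronecker's lemma applies to the sum of the three.
\<close>

lemma AE_weighted_square_sum:
  assumes f: "\<And>k. f k \<in> borel_measurable (F k)" and f0: "\<And>k \<omega>. f k \<omega> \<ge> 0" and f1: "\<And>k \<omega>. f k \<omega> \<le> 1"
  shows "AE \<omega> in M. \<forall>\<eta>>0. \<exists>C. \<forall>n.
    \<bar>\<Sum>k<n. f k \<omega> * ((V (Suc k) \<omega>)\<^sup>2 - sigma_sq)\<bar> \<le> C + \<eta> * (\<Sum>k<n. f k \<omega>)"
proof -
  define s where "s k \<omega> = 1 + (\<Sum>i\<le>k. f i \<omega>)" for k \<omega>
  have s1: "s k \<omega> \<ge> 1" for k \<omega> unfolding s_def using f0 by (simp add: sum_nonneg)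
  have s_pos: "s k \<omega> > 0" for k \<omega> using s1[of k \<omega>] by linarith
  have s_F: "s k \<in> borel_measurable (F k)" for k
    unfolding s_def by (intro borel_measurable_add borel_measurable_sum borel_measurable_F_mono[OF f]) simp_all
  have s_M [measurable]: "s k \<in> borel_measurable M" for k by (rule borel_measurable_F_M[OF s_F])
  define u where "u k \<omega> = f k \<omega> / s k \<omega>" for k \<omega>
  have u0: "u k \<omega> \<ge> 0" for k \<omega> using f0 s_pos[of k \<omega>] by (simp add: u_def)
  have u_F: "u k \<in> borel_measurable (F k)" for k unfolding u_def by (intro borel_measurable_divide f s_F)
  have u_M [measurable]: "u k \<in> borel_measurable M" for k by (rule borel_measurable_F_M[OF u_F])
  \<comment> \<open>Split of the square into the truncated part \<open>Y\<close> and the overflow \<open>Z\<close>.\<close>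
  define Y where "Y k \<omega> = (if (V (Suc k) \<omega>)\<^sup>2 \<le> s k \<omega> then (V (Suc k) \<omega>)\<^sup>2 else 0)" for k \<omega>
  define Z where "Z k \<omega> = (if (V (Suc k) \<omega>)\<^sup>2 \<le> s k \<omega> then 0 else (V (Suc k) \<omega>)\<^sup>2)" for k \<omega>
  have YZ: "Y k \<omega> + Z k \<omega> = (V (Suc k) \<omega>)\<^sup>2" for k \<omega> by (simp add: Y_def Z_def)
  have Y0: "Y k \<omega> \<ge> 0" and Z0: "Z k \<omega> \<ge> 0" for k \<omega> by (simp_all add: Y_def Z_def)
  have V_F: "V (Suc k) \<in> borel_measurable (F (Suc k))" for k by (rule V_measurable)
  have sS: "s k \<in> borel_measurable (F (Suc k))" for k by (rule borel_measurable_F_mono[OF s_F]) simp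
  have Y_F: "Y k \<in> borel_measurable (F (Suc k))" for k
    using V_F[of k] sS[of k] unfolding Y_def by measurable
  have Y_M [measurable]: "Y k \<in> borel_measurable M" for k by (rule borel_measurable_F_M[OF Y_F])
  have Z_M [measurable]: "Z k \<in> borel_measurable M" for k unfolding Z_def by measurable
  have Y_int: "integrable M (Y k)" for k
    by (rule Bochner_Integration.integrable_bound[OF V_square_integrable[of k]]) (auto simp: Y_def)
  have Z_int: "integrable M (Z k)" for k
    by (rule Bochner_Integration.integrable_bound[OF V_square_integrable[of k]]) (auto simp: Z_def)
  define EY where "EY k = real_cond_exp M (F k) (Y k)" for k
  define EZ where "EZ k = real_cond_exp M (F k) (Z k)" for k
  have EY_F: "EY k \<in> borel_measurable (F k)" and EZ_F: "EZ k \<in> borel_measurable (F k)" for k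
    by (simp_all add: EY_def EZ_def)
  have EY_M [measurable]: "EY k \<in> borel_measurable M" and EZ_M [measurable]: "EZ k \<in> borel_measurable M" for k
    by (simp_all add: EY_def EZ_def)
  have split: "AE \<omega> in M. EY k \<omega> + EZ k \<omega> = sigma_sq \<and> 0 \<le> EY k \<omega> \<and> 0 \<le> EZ k \<omega>" for k
  proof -
    interpret S: sigma_finite_subalgebra M "F k" by (rule sigma_finite_subalgebra_F)
    have "AE \<omega> in M. real_cond_exp M (F k) (\<lambda>\<omega>. Y k \<omega> + Z k \<omega>) \<omega> = EY k \<omega> + EZ k \<omega>"
      unfolding EY_def EZ_def by (rule S.real_cond_exp_add[OF Y_int Z_int])
    moreover have "AE \<omega> in M. 0 \<le> EY k \<omega>" "AE \<omega> in M. 0 \<le> EZ k \<omega>"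
      unfolding EY_def EZ_def by (intro S.real_cond_exp_pos; simp add: Y0 Z0)+
    ultimately show ?thesis using V_square_cond_exp[of k]
      unfolding YZ by eventually_elim auto
  qed
  define D where "D k \<omega> = Y k \<omega> - EY k \<omega>" for k \<omega>
  define m where "m k \<omega> = 2 * s k \<omega> powr (2 - q) * \<kappa> k \<omega> + 2 * sigma_sq\<^sup>2" for k \<omega>
  have \<kappa>_M [measurable]: "\<kappa> k \<in> borel_measurable M" for k by (rule borel_measurable_F_M[OF \<kappa>_measurable])
  have D_variance: "conditionally_le k (\<lambda>\<omega>. (D k \<omega>)\<^sup>2) (m k)" for k
  proof (rule conditionally_le_trans)
    let ?c = "\<lambda>\<omega>. 2 * s k \<omega> powr (2 - q)"
    show "conditionally_le k (\<lambda>\<omega>. (D k \<omega>)\<^sup>2) (\<lambda>\<omega>. ?c \<omega> * \<bar>V (Suc k) \<omega>\<bar> powr (2 * q) + 2 * sigma_sq\<^sup>2)"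
    proof (rule conditionally_le_AE, use split[of k] in eventually_elim)
      case (elim \<omega>)
      have "(D k \<omega>)\<^sup>2 \<le> 2 * (Y k \<omega>)\<^sup>2 + 2 * (EY k \<omega>)\<^sup>2"
        using zero_le_power2[of "Y k \<omega> + EY k \<omega>"] by (simp add: D_def power2_diff power2_sum)
      also have "(EY k \<omega>)\<^sup>2 \<le> sigma_sq\<^sup>2" using elim by (intro power_mono) auto
      also have "(Y k \<omega>)\<^sup>2 \<le> s k \<omega> powr (2 - q) * \<bar>V (Suc k) \<omega>\<bar> powr (2 * q)"
        unfolding Y_def by (rule truncated_square_le[OF s1])
      finally show ?case by simp
    qed
    have "?c \<in> borel_measurable (F k)" using s_F[of k] by measurable
    then have "conditionally_le k (\<lambda>\<omega>. ?c \<omega> * \<bar>V (Suc k) \<omega>\<bar> powr (2 * q)) (\<lambda>\<omega>. ?c \<omega> * \<kappa> k \<omega>)"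
      by (rule conditionally_le_mult[OF V_moment]) simp
    then show "conditionally_le k (\<lambda>\<omega>. ?c \<omega> * \<bar>V (Suc k) \<omega>\<bar> powr (2 * q) + 2 * sigma_sq\<^sup>2) (m k)"
      unfolding m_def by (rule conditionally_le_add) (simp_all add: \<kappa>_nonneg)
  qed
  interpret MI: martingale_increments M F D m
  proof unfold_locales
    fix k
    interpret S: sigma_finite_subalgebra M "F k" by (rule sigma_finite_subalgebra_F)
    have EY_int: "integrable M (EY k)" unfolding EY_def by (rule S.real_cond_exp_int(1)[OF Y_int])
    show "D k \<in> borel_measurable (F (Suc k))"
      unfolding D_def by (intro borel_measurable_diff Y_F borel_measurable_F_mono[OF EY_F]) simp
    show "integrable M (D k)" unfolding D_def by (intro Bochner_Integration.integrable_diff Y_int EY_int)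
    have "AE \<omega> in M. real_cond_exp M (F k) (D k) \<omega> = EY k \<omega> - real_cond_exp M (F k) (EY k) \<omega>"
      unfolding D_def using S.real_cond_exp_diff[OF Y_int EY_int] by (simp add: EY_def)
    moreover have "AE \<omega> in M. real_cond_exp M (F k) (EY k) \<omega> = EY k \<omega>"
      by (rule S.real_cond_exp_F_meas[OF EY_int EY_F])
    ultimately show "AE \<omega> in M. real_cond_exp M (F k) (D k) \<omega> = 0" by eventually_elim simp
    show "m k \<in> borel_measurable (F k)"
      using s_F[of k] \<kappa>_measurable[of k] unfolding m_def by measurable
    show "m k \<omega> \<ge> 0" for \<omega> by (simp add: m_def \<kappa>_nonneg)
  qed (rule D_variance)
  have s_sum: "summable (\<lambda>k. f k \<omega> * s k \<omega> powr (-q))" for \<omega>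
    unfolding s_def by (rule summable_div_partial_sums_powr[OF f0 q_gt])
  have h_sum: "AE \<omega> in M. summable (\<lambda>k. f k \<omega> * s k \<omega> powr (-q) * \<kappa> k \<omega>)"
    using \<kappa>_bounded
  proof eventually_elim
    case (elim \<omega>)
    then obtain C where C: "\<kappa> k \<omega> \<le> C" for k by blast
    show ?case
      by (rule summable_comparison_test'[where g = "\<lambda>k. f k \<omega> * s k \<omega> powr (-q) * C" and N = 0])
        (use C f0 \<kappa>_nonneg s_sum in \<open>auto intro: summable_mult2 mult_left_mono simp: abs_mult\<close>)
  qed
  have h_F: "(\<lambda>\<omega>. f k \<omega> * s k \<omega> powr (-q) * \<kappa> k \<omega>) \<in> borel_measurable (F k)" for k
    using f[of k] s_F[of k] \<kappa>_measurable[of k] by measurable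
  have h0: "f k \<omega> * s k \<omega> powr (-q) * \<kappa> k \<omega> \<ge> 0" for k \<omega> by (simp add: f0 \<kappa>_nonneg)
  have us: "u k \<omega> * s k \<omega> powr (1 - q) = f k \<omega> * s k \<omega> powr (-q)" for k \<omega>
    using s_pos[of k \<omega>] by (simp add: u_def powr_diff powr_minus field_simps)
  have uZ: "conditionally_le k (\<lambda>\<omega>. u k \<omega> * Z k \<omega>) (\<lambda>\<omega>. f k \<omega> * s k \<omega> powr (-q) * \<kappa> k \<omega>)" for k
  proof (rule conditionally_le_trans)
    have "u k \<omega> * Z k \<omega> \<le> u k \<omega> * (s k \<omega> powr (1 - q) * \<bar>V (Suc k) \<omega>\<bar> powr (2 * q))" for \<omega>
      unfolding Z_def by (intro mult_left_mono overflow_square_le[OF s1] u0)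
    then show "conditionally_le k (\<lambda>\<omega>. u k \<omega> * Z k \<omega>) (\<lambda>\<omega>. f k \<omega> * s k \<omega> powr (-q) * \<bar>V (Suc k) \<omega>\<bar> powr (2 * q))"
      by (intro conditionally_le_AE AE_I2) (simp only: mult.assoc[symmetric] us)
    have "(\<lambda>\<omega>. f k \<omega> * s k \<omega> powr (-q)) \<in> borel_measurable (F k)" using s_F[of k] f[of k] by measurable
    then show "conditionally_le k (\<lambda>\<omega>. f k \<omega> * s k \<omega> powr (-q) * \<bar>V (Suc k) \<omega>\<bar> powr (2 * q))
        (\<lambda>\<omega>. f k \<omega> * s k \<omega> powr (-q) * \<kappa> k \<omega>)"
      by (rule conditionally_le_mult[OF V_moment]) (simp add: f0)
  qed
  have uEZ: "conditionally_le k (\<lambda>\<omega>. u k \<omega> * max 0 (EZ k \<omega>)) (\<lambda>\<omega>. f k \<omega> * s k \<omega> powr (-q) * \<kappa> k \<omega>)" for k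
  proof (rule conditionally_le_trans[OF _ uZ])
    have "conditionally_le k (\<lambda>\<omega>. max 0 (EZ k \<omega>)) (EZ k)"
      by (rule conditionally_le_AE, use split[of k] in eventually_elim) simp
    then have "conditionally_le k (\<lambda>\<omega>. max 0 (EZ k \<omega>)) (Z k)"
      by (rule conditionally_le_trans) (unfold EZ_def, rule real_cond_exp_conditionally_le[OF Z_M])
    then show "conditionally_le k (\<lambda>\<omega>. u k \<omega> * max 0 (EZ k \<omega>)) (\<lambda>\<omega>. u k \<omega> * Z k \<omega>)"
      by (rule conditionally_le_mult[OF _ u_F u0])
  qed
  have "AE \<omega> in M. summable (\<lambda>k. u k \<omega> * Z k \<omega>)"
    by (rule AE_summable_of_conditionally_le[OF _ _ h_F h0 uZ h_sum]) (measurable, simp add: u0 Z0)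
  moreover have "AE \<omega> in M. summable (\<lambda>k. u k \<omega> * max 0 (EZ k \<omega>))"
    by (rule AE_summable_of_conditionally_le[OF _ _ h_F h0 uEZ h_sum]) (measurable, simp add: u0)
  moreover have "AE \<omega> in M. convergent (\<lambda>n. \<Sum>k<n. u k \<omega> * D k \<omega>)"
  proof (rule MI.AE_convergent[OF u_F])
    show "AE \<omega> in M. summable (\<lambda>k. (u k \<omega>)\<^sup>2 * m k \<omega>)"
      using \<kappa>_bounded
    proof eventually_elim
      case (elim \<omega>)
      then obtain C where C: "\<kappa> k \<omega> \<le> C" for k by blast
      have le: "(u k \<omega>)\<^sup>2 * m k \<omega> \<le> f k \<omega> * s k \<omega> powr (-q) * (2 * C + 2 * sigma_sq\<^sup>2)" for k
      proof -
        have sq: "s k \<omega> powr (2 - q) = (s k \<omega>)\<^sup>2 * s k \<omega> powr (-q)"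
          using s_pos[of k \<omega>] by (simp add: powr_diff powr_minus divide_inverse)
        have ge1: "1 \<le> s k \<omega> powr (2 - q)" using s1[of k \<omega>] q_le by (intro ge_one_powr_ge_zero) auto
        have "m k \<omega> \<le> s k \<omega> powr (2 - q) * (2 * C + 2 * sigma_sq\<^sup>2)"
          using mult_left_mono[OF C[of k], of "s k \<omega> powr (2 - q)"] mult_right_mono[OF ge1, of "sigma_sq\<^sup>2"]
          by (simp add: m_def algebra_simps)
        then have "(u k \<omega>)\<^sup>2 * m k \<omega> \<le> (u k \<omega>)\<^sup>2 * (s k \<omega> powr (2 - q) * (2 * C + 2 * sigma_sq\<^sup>2))"
          by (intro mult_left_mono) simp_all
        also have "\<dots> = (f k \<omega>)\<^sup>2 * (s k \<omega> powr (-q) * (2 * C + 2 * sigma_sq\<^sup>2))"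
          using s_pos[of k \<omega>] by (simp add: u_def sq power_divide)
        also have "\<dots> \<le> f k \<omega> * (s k \<omega> powr (-q) * (2 * C + 2 * sigma_sq\<^sup>2))"
          using f0[of k \<omega>] f1[of k \<omega>] \<kappa>_nonneg[of k \<omega>] C[of k]
          by (intro mult_right_mono) (auto simp: power2_eq_square mult_left_le)
        finally show ?thesis by (simp add: mult.assoc)
      qed
      show ?case
        by (rule summable_comparison_test'[OF summable_mult2[OF s_sum, of \<omega> "2 * C + 2 * sigma_sq\<^sup>2"], of 0])
          (use le MI.m_nonneg in \<open>auto simp: abs_mult\<close>)
    qed
  qed
  moreover have "AE \<omega> in M. \<forall>k. EY k \<omega> + EZ k \<omega> = sigma_sq \<and> 0 \<le> EY k \<omega> \<and> 0 \<le> EZ k \<omega>"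
    by (intro AE_all_countable[THEN iffD2] allI split)
  ultimately show ?thesis
  proof eventually_elim
    case (elim \<omega>)
    have eq: "f k \<omega> * ((V (Suc k) \<omega>)\<^sup>2 - sigma_sq) / s k \<omega> = u k \<omega> * D k \<omega> + u k \<omega> * Z k \<omega> - u k \<omega> * max 0 (EZ k \<omega>)" for k
    proof -
      have v: "(V (Suc k) \<omega>)\<^sup>2 - sigma_sq = D k \<omega> + Z k \<omega> - max 0 (EZ k \<omega>)"
        using elim(4)[rule_format, of k] YZ[of k \<omega>] by (simp add: D_def max_def)
      show ?thesis unfolding v by (simp add: u_def algebra_simps add_divide_distrib diff_divide_distrib)
    qed
    have "convergent (\<lambda>n. (\<Sum>k<n. u k \<omega> * D k \<omega>) + (\<Sum>k<n. u k \<omega> * Z k \<omega>) - (\<Sum>k<n. u k \<omega> * max 0 (EZ k \<omega>)))"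
      using elim(1-3) by (intro convergent_diff convergent_add) (auto simp: summable_iff_convergent)
    then have "convergent (\<lambda>n. \<Sum>k<n. f k \<omega> * ((V (Suc k) \<omega>)\<^sup>2 - sigma_sq) / (1 + (\<Sum>i\<le>k. f i \<omega>)))"
      by (simp add: eq[unfolded s_def] sum.distrib sum_subtractf)
    then show ?case using kronecker_bound[of "\<lambda>k. f k \<omega>" "\<lambda>k. f k \<omega> * ((V (Suc k) \<omega>)\<^sup>2 - sigma_sq)"] f0 by blast
  qed
qed

end

text \<open>
  Allows the order of the moment to be lowered.
\<close>

lemma powr_le_one_add_powr:
  fixes v :: real
  assumes "0 \<le> v" "0 \<le> b" "b \<le> a"
  shows "v powr b \<le> 1 + v powr a"
proof (cases "v \<le> 1")
  case True
  then have "v powr b \<le> 1" using assms by (intro powr_le1) auto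
  then show ?thesis using powr_ge_zero[of v a] by linarith
next
  case False
  then have "v powr b \<le> v powr a" using assms by (intro powr_mono) auto
  then show ?thesis by linarith
qed

lemma driving_noise_of_moment:
  assumes prob: "prob_space M"
    and filt: "filtration (space M) F"
    and subalg: "\<And>n. subalgebra M (F n)"
    and sigma_pos: "sigma_sq > 0"
    and mds: "martingale_difference M F V"
    and var: "constant_conditional_variance M F V sigma_sq"
    and moment: "finite_conditional_moment_gt2 M F V"
  obtains q \<kappa> where "driving_noise M F V sigma_sq q \<kappa>"
proof -
  interpret filtered_prob_space M F
    using prob filt subalg by (simp add: filtered_prob_space_def filtered_prob_space_axioms_def)
  obtain a where a: "a > 2" and fin: "AE \<omega> in M. (SUP n. nn_cond_exp M (F n) (\<lambda>\<eta>. ennreal (\<bar>V (Suc n) \<eta>\<bar> powr a)) \<omega>) < \<infinity>"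
    using moment by (auto simp: finite_conditional_moment_gt2_def)
  \<comment> \<open>Truncation works with exponents \<open>2 * q \<le> 4\<close>.\<close>
  define q where "q = min (a / 2) 2"
  have q: "1 < q" "q \<le> 2" "2 * q \<le> a" using a by (auto simp: q_def)
  define c where "c n \<omega> = nn_cond_exp M (F n) (\<lambda>\<eta>. ennreal (\<bar>V (Suc n) \<eta>\<bar> powr a)) \<omega>" for n \<omega>
  define \<kappa> where "\<kappa> n \<omega> = enn2real (c n \<omega>) + 1" for n \<omega>
  have V_F: "V (Suc n) \<in> borel_measurable (F (Suc n))" and V_int: "integrable M (V (Suc n))"
    and V_cent: "AE \<omega> in M. real_cond_exp M (F n) (V (Suc n)) \<omega> = 0" for n
    using mds by (simp_all add: martingale_difference_def)
  have V_M [measurable]: "V (Suc n) \<in> borel_measurable M" for n by (rule borel_measurable_F_M[OF V_F])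
  have c_F: "c n \<in> borel_measurable (F n)" for n unfolding c_def by simp
  have c_M [measurable]: "c n \<in> borel_measurable M" for n unfolding c_def by simp
  have c_fin: "AE \<omega> in M. c n \<omega> < \<infinity>" for n
    using fin by eventually_elim (metis (no_types, lifting) SUP_upper UNIV_I c_def le_less_trans)
  have moment_le: "conditionally_le n (\<lambda>\<omega>. \<bar>V (Suc n) \<omega>\<bar> powr (2 * q)) (\<kappa> n)" for n
  proof (rule conditionally_le_trans)
    have "\<bar>V (Suc n) \<omega>\<bar> powr (2 * q) \<le> \<bar>V (Suc n) \<omega>\<bar> powr a + 1" for \<omega>
      using powr_le_one_add_powr[of "\<bar>V (Suc n) \<omega>\<bar>" "2 * q" a] q by simp
    then show "conditionally_le n (\<lambda>\<omega>. \<bar>V (Suc n) \<omega>\<bar> powr (2 * q)) (\<lambda>\<omega>. \<bar>V (Suc n) \<omega>\<bar> powr a + 1)"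
      by (intro conditionally_le_AE AE_I2)
    have "conditionally_le n (\<lambda>\<omega>. \<bar>V (Suc n) \<omega>\<bar> powr a) (\<lambda>\<omega>. enn2real (c n \<omega>))"
      by (rule conditionally_le_nn_cond_exp, measurable, use c_fin[of n] in eventually_elim) (simp add: c_def)
    then show "conditionally_le n (\<lambda>\<omega>. \<bar>V (Suc n) \<omega>\<bar> powr a + 1) (\<kappa> n)"
      unfolding \<kappa>_def by (rule conditionally_le_add) simp_all
  qed
  have "driving_noise M F V sigma_sq q \<kappa>"
  proof unfold_locales
    show "AE \<omega> in M. nn_cond_exp M (F k) (\<lambda>\<eta>. ennreal ((V (Suc k) \<eta>)\<^sup>2)) \<omega> = ennreal sigma_sq" for k
      using var by (simp add: constant_conditional_variance_def)
    show "\<kappa> k \<in> borel_measurable (F k)" for k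
      unfolding \<kappa>_def using c_F[of k] by measurable
    show "\<kappa> k \<omega> \<ge> 0" for k \<omega> by (simp add: \<kappa>_def)
    show "AE \<omega> in M. \<exists>C. \<forall>k. \<kappa> k \<omega> \<le> C"
      using fin
    proof eventually_elim
      case (elim \<omega>)
      have "\<kappa> k \<omega> \<le> enn2real (SUP n. c n \<omega>) + 1" for k
        unfolding \<kappa>_def using elim by (intro add_right_mono enn2real_mono SUP_upper) (auto simp: c_def)
      then show ?case by blast
    qed
  qed (use V_F V_int V_cent sigma_pos q moment_le in auto)
  then show ?thesis by (rule that)
qed

section \<open>Sequences of sublinear growth\<close>

text \<open>
  Another form of \<open>T \<in> o(n)\<close> (see \<open>sublinear_iff_smallo\<close>) that is stable under shifts of the index and
  follows directly from the bounds on weighted noise sums.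
\<close>

definition sublinear :: "(nat \<Rightarrow> real) \<Rightarrow> bool"
  where "sublinear T \<longleftrightarrow> (\<forall>\<eta>>0. \<exists>C. \<forall>n. \<bar>T n\<bar> \<le> C + \<eta> * real n)"

lemma sublinearD: "sublinear T \<Longrightarrow> \<eta> > 0 \<Longrightarrow> \<exists>C. \<forall>n. \<bar>T n\<bar> \<le> C + \<eta> * real n"
  by (simp add: sublinear_def)

lemma sublinear_eventually:
  assumes "sublinear T" "\<eta> > 0"
  shows "eventually (\<lambda>n. \<bar>T n\<bar> \<le> \<eta> * real n) sequentially"
proof -
  obtain C where C: "\<bar>T n\<bar> \<le> C + \<eta> / 2 * real n" for n
    using sublinearD[OF assms(1), of "\<eta> / 2"] assms(2) by auto
  obtain N :: nat where N: "real N \<ge> 2 * C / \<eta>" using real_arch_simple by blast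
  show ?thesis
  proof (rule eventually_sequentiallyI[of N])
    fix n assume "N \<le> n"
    then have "2 * C / \<eta> \<le> real n" using N by linarith
    then have "C \<le> \<eta> / 2 * real n" using assms(2) by (simp add: field_simps)
    then show "\<bar>T n\<bar> \<le> \<eta> * real n" using C[of n] by linarith
  qed
qed

lemma sublinear_if_eventually:
  assumes "\<And>\<eta>. \<eta> > 0 \<Longrightarrow> eventually (\<lambda>n. \<bar>T n\<bar> \<le> \<eta> * real n) sequentially"
  shows "sublinear T"
  unfolding sublinear_def
proof (intro allI impI)
  fix \<eta> :: real assume \<eta>: "\<eta> > 0"
  then obtain N where N: "\<And>n. n \<ge> N \<Longrightarrow> \<bar>T n\<bar> \<le> \<eta> * real n"
    using assms by (auto simp: eventually_sequentially)
  show "\<exists>C. \<forall>n. \<bar>T n\<bar> \<le> C + \<eta> * real n"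
  proof (intro exI[of _ "\<Sum>k<N. \<bar>T k\<bar>"] allI)
    fix n
    have pos: "(\<Sum>k<N. \<bar>T k\<bar>) \<ge> 0" "\<eta> * real n \<ge> 0" using \<eta> by (simp_all add: sum_nonneg)
    show "\<bar>T n\<bar> \<le> (\<Sum>k<N. \<bar>T k\<bar>) + \<eta> * real n"
    proof (cases "n < N")
      case True
      then have "\<bar>T n\<bar> \<le> (\<Sum>k<N. \<bar>T k\<bar>)" by (intro member_le_sum) auto
      then show ?thesis using pos by linarith
    next
      case False
      then have "\<bar>T n\<bar> \<le> \<eta> * real n" by (intro N) simp
      then show ?thesis using pos by linarith
    qed
  qed
qed

lemma sublinear_iff_smallo: "sublinear T \<longleftrightarrow> T \<in> o(\<lambda>n. real n)"
proof
  assume "sublinear T"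
  then show "T \<in> o(\<lambda>n. real n)"
    using sublinear_eventually by (intro landau_o.smallI) simp
next
  assume "T \<in> o(\<lambda>n. real n)"
  then show "sublinear T"
    using landau_o.smallD[of T] by (intro sublinear_if_eventually) force
qed

lemma sublinear_le:
  assumes "sublinear S" "\<And>n. \<bar>T n\<bar> \<le> c * S n" 
  shows "sublinear T"
proof -
  have "T \<in> O(S)" using assms(2)
    by (intro bigoI[of _ "\<bar>c\<bar>"] always_eventually allI) (metis abs_ge_self abs_mult order_trans real_norm_def)
  then show ?thesis using assms(1) unfolding sublinear_iff_smallo by (rule landau_o.big_small_trans)
qed

lemma sublinear_shift:
  assumes "sublinear T"
  shows "sublinear (\<lambda>n. T (n + r) - c)"
  unfolding sublinear_def
proof (intro allI impI)
  fix \<eta> :: real assume "\<eta> > 0"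
  then obtain C where C: "\<bar>T n\<bar> \<le> C + \<eta> * real n" for n using sublinearD[OF assms] by blast
  show "\<exists>C. \<forall>n. \<bar>T (n + r) - c\<bar> \<le> C + \<eta> * real n"
  proof (intro exI[of _ "C + \<eta> * real r + \<bar>c\<bar>"] allI)
    fix n
    show "\<bar>T (n + r) - c\<bar> \<le> C + \<eta> * real r + \<bar>c\<bar> + \<eta> * real n"
      using C[of "n + r"] abs_triangle_ineq4[of "T (n + r)" c] by (simp add: distrib_left)
  qed
qed

lemma sublinear_if_weighted_bound:
  assumes bound: "\<forall>\<eta>>0. \<exists>C. \<forall>n. \<bar>T n\<bar> \<le> C + \<eta> * W n"
    and W: "\<And>n. W n \<le> c * real (Suc n)"
  shows "sublinear T"
  unfolding sublinear_def
proof (intro allI impI)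
  fix \<eta> :: real assume \<eta>: "\<eta> > 0"
  define \<eta>' where "\<eta>' = \<eta> / (\<bar>c\<bar> + 1)"
  have \<eta>': "\<eta>' > 0" "\<eta>' * \<bar>c\<bar> \<le> \<eta>" using \<eta> by (simp_all add: \<eta>'_def field_simps)
  obtain C where C: "\<bar>T n\<bar> \<le> C + \<eta>' * W n" for n using bound \<eta>'(1) by blast
  show "\<exists>C. \<forall>n. \<bar>T n\<bar> \<le> C + \<eta> * real n"
  proof (intro exI[of _ "C + \<eta>"] allI)
    fix n
    have "\<eta>' * W n \<le> \<eta>' * (\<bar>c\<bar> * real (Suc n))"
      using W[of n] \<eta>'(1) by (intro mult_left_mono) (auto intro: order_trans mult_right_mono)
    also have "\<dots> = (\<eta>' * \<bar>c\<bar>) * real (Suc n)" by simp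
    also have "\<dots> \<le> \<eta> * real (Suc n)" using \<eta>'(2) by (rule mult_right_mono) simp
    finally show "\<bar>T n\<bar> \<le> C + \<eta> + \<eta> * real n" using C[of n] by (simp add: algebra_simps)
  qed
qed

lemma sum_shift:
  fixes F :: "nat \<Rightarrow> real"
  shows "(\<Sum>m<n. F (m + a)) = (\<Sum>k<n + a. F k) - (\<Sum>k<a. F k)"
  by (induction n) simp_all

lemma sum_shift_le:
  fixes F :: "nat \<Rightarrow> real"
  assumes "\<And>k. F k \<ge> 0" "a \<le> b"
  shows "(\<Sum>m<n. F (m + a)) \<le> (\<Sum>k<n + b. F k)"
proof -
  have "(\<Sum>m<n. F (m + a)) \<le> (\<Sum>k<n + a. F k)" unfolding sum_shift using assms(1) by (simp add: sum_nonneg)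
  also have "\<dots> \<le> (\<Sum>k<n + b. F k)" using assms by (intro sum_mono2) auto
  finally show ?thesis .
qed

lemma sublinear_sum_shift:
  fixes F :: "nat \<Rightarrow> real"
  assumes "sublinear (\<lambda>n. \<Sum>k<n. F k)"
  shows "sublinear (\<lambda>n. \<Sum>m<n. F (m + a))"
  unfolding sum_shift by (rule sublinear_shift[OF assms])

lemma sublinear_add: "sublinear S \<Longrightarrow> sublinear T \<Longrightarrow> sublinear (\<lambda>n. S n + T n)"
  unfolding sublinear_iff_smallo by (rule sum_in_smallo)

lemma square_add_le: "(u + v)\<^sup>2 \<le> 2 * u\<^sup>2 + 2 * v\<^sup>2" for u v :: real
  using zero_le_power2[of "u - v"] by (simp add: power2_eq_square algebra_simps)

lemma square_add_add_le: "(a + b + c)\<^sup>2 \<le> 3 * a\<^sup>2 + 3 * b\<^sup>2 + 3 * c\<^sup>2" for a b c :: real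
  using zero_le_power2[of "a - b"] zero_le_power2[of "a - c"] zero_le_power2[of "b - c"]
  by (simp add: power2_eq_square algebra_simps)

text \<open>
  The Gram matrix of the \<open>d\<close> sequences is eventually diagonally dominant after division by \<open>n\<close>.
\<close>

lemma square_sum_lower_bound:
  fixes Z :: "nat \<Rightarrow> nat \<Rightarrow> real"
  assumes \<tau>: "\<tau> > 0"
    and off: "\<And>i j. i < d \<Longrightarrow> j < d \<Longrightarrow> i \<noteq> j \<Longrightarrow> sublinear (\<lambda>n. \<Sum>m<n. Z m i * Z m j)"
    and diag: "\<And>i. i < d \<Longrightarrow> eventually (\<lambda>n. (\<Sum>m<n. (Z m i)\<^sup>2) \<ge> \<tau> * real n) sequentially"
  shows "eventually (\<lambda>n. \<forall>b. (\<Sum>m<n. (\<Sum>i<d. b i * Z m i)\<^sup>2) \<ge> \<tau> / 2 * real n * (\<Sum>i<d. (b i)\<^sup>2)) sequentially"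
proof (cases "d = 0")
  case False
  then have d: "real d > 0" by simp
  define \<eta> where "\<eta> = \<tau> / (2 * real d)"
  have \<eta>: "\<eta> > 0" using \<tau> d by (simp add: \<eta>_def)
  have "eventually (\<lambda>n. \<forall>i\<in>{..<d}. \<forall>j\<in>{..<d}. i \<noteq> j \<longrightarrow> \<bar>\<Sum>m<n. Z m i * Z m j\<bar> \<le> \<eta> * real n) sequentially"
  proof (intro eventually_ball_finite ballI)
    fix i j assume "i \<in> {..<d}" "j \<in> {..<d}"
    then show "eventually (\<lambda>n. i \<noteq> j \<longrightarrow> \<bar>\<Sum>m<n. Z m i * Z m j\<bar> \<le> \<eta> * real n) sequentially"
      using sublinear_eventually[OF off \<eta>, of i j] by (cases "i = j") auto
  qed simp_all
  moreover have "eventually (\<lambda>n. \<forall>i\<in>{..<d}. (\<Sum>m<n. (Z m i)\<^sup>2) \<ge> \<tau> * real n) sequentially"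
    using diag by (intro eventually_ball_finite ballI) simp_all
  ultimately show ?thesis
  proof eventually_elim
    case (elim n)
    show ?case
    proof
      fix b
      define G where "G i j = (\<Sum>m<n. Z m i * Z m j)" for i j
      have "(\<Sum>m<n. (\<Sum>i<d. b i * Z m i)\<^sup>2) = (\<Sum>m<n. \<Sum>i<d. \<Sum>j<d. b i * b j * (Z m i * Z m j))"
        by (simp add: power2_eq_square sum_product ac_simps)
      also have "\<dots> = (\<Sum>i<d. \<Sum>m<n. \<Sum>j<d. b i * b j * (Z m i * Z m j))" by (rule sum.swap)
      also have "\<dots> = (\<Sum>i<d. \<Sum>j<d. \<Sum>m<n. b i * b j * (Z m i * Z m j))"
        by (intro sum.cong refl sum.swap)
      also have "\<dots> = (\<Sum>i<d. \<Sum>j<d. b i * b j * G i j)"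
        by (simp add: G_def sum_distrib_left)
      also have "\<dots> \<ge> (\<Sum>i<d. \<Sum>j<d. (if i = j then \<tau> * real n * (b i)\<^sup>2 else 0) - \<eta> * real n * (\<bar>b i\<bar> * \<bar>b j\<bar>))"
      proof (intro sum_mono)
        fix i j assume ij: "i \<in> {..<d}" "j \<in> {..<d}"
        show "(if i = j then \<tau> * real n * (b i)\<^sup>2 else 0) - \<eta> * real n * (\<bar>b i\<bar> * \<bar>b j\<bar>) \<le> b i * b j * G i j"
        proof (cases "i = j")
          case True
          have "\<tau> * real n \<le> G i i" using elim(2) ij by (simp add: G_def power2_eq_square)
          then have "\<tau> * real n * (b i)\<^sup>2 \<le> G i i * (b i)\<^sup>2" by (rule mult_right_mono) simp
          moreover have "0 \<le> \<eta> * real n * (\<bar>b i\<bar> * \<bar>b i\<bar>)" using \<eta> by simp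
          ultimately show ?thesis using True by (simp add: power2_eq_square ac_simps)
        next
          case False
          then have "\<bar>G i j\<bar> \<le> \<eta> * real n" using elim(1) ij by (simp add: G_def)
          then have "\<bar>b i * b j * G i j\<bar> \<le> \<bar>b i\<bar> * \<bar>b j\<bar> * (\<eta> * real n)"
            unfolding abs_mult by (intro mult_left_mono) simp_all
          then show ?thesis using False by (simp add: ac_simps)
        qed
      qed
      also have "(\<Sum>i<d. \<Sum>j<d. (if i = j then \<tau> * real n * (b i)\<^sup>2 else 0) - \<eta> * real n * (\<bar>b i\<bar> * \<bar>b j\<bar>))
          = \<tau> * real n * (\<Sum>i<d. (b i)\<^sup>2) - \<eta> * real n * (\<Sum>i<d. \<bar>b i\<bar>)\<^sup>2"
      proof -
        have "\<eta> * real n * (\<Sum>i<d. \<bar>b i\<bar>)\<^sup>2 = (\<Sum>i<d. \<Sum>j<d. \<eta> * real n * (\<bar>b i\<bar> * \<bar>b j\<bar>))"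
          unfolding power2_eq_square sum_product by (simp only: sum_distrib_left)
        then show ?thesis by (simp add: sum_subtractf sum_distrib_left)
      qed
      finally have "(\<Sum>m<n. (\<Sum>i<d. b i * Z m i)\<^sup>2) \<ge> \<tau> * real n * (\<Sum>i<d. (b i)\<^sup>2) - \<eta> * real n * (\<Sum>i<d. \<bar>b i\<bar>)\<^sup>2" .
      moreover have "(\<Sum>i<d. \<bar>b i\<bar>)\<^sup>2 \<le> real d * (\<Sum>i<d. (b i)\<^sup>2)"
        using Cauchy_Schwarz_ineq_sum[of "\<lambda>_. 1" "\<lambda>i. \<bar>b i\<bar>" "{..<d}"] by simp
      then have "\<eta> * real n * (\<Sum>i<d. \<bar>b i\<bar>)\<^sup>2 \<le> \<eta> * real n * (real d * (\<Sum>i<d. (b i)\<^sup>2))"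
        using \<eta> by (intro mult_left_mono) simp_all
      moreover have "\<eta> * real n * (real d * (\<Sum>i<d. (b i)\<^sup>2)) = \<tau> / 2 * real n * (\<Sum>i<d. (b i)\<^sup>2)"
        using d by (simp add: \<eta>_def)
      moreover have "\<tau> * real n * (\<Sum>i<d. (b i)\<^sup>2) = \<tau> / 2 * real n * (\<Sum>i<d. (b i)\<^sup>2) + \<tau> / 2 * real n * (\<Sum>i<d. (b i)\<^sup>2)"
        by simp
      ultimately show "(\<Sum>m<n. (\<Sum>i<d. b i * Z m i)\<^sup>2) \<ge> \<tau> / 2 * real n * (\<Sum>i<d. (b i)\<^sup>2)" by linarith
    qed
  qed
qed simp

lemma sublinear_ln_powr:
  assumes "\<delta> < 1"
  shows "sublinear (\<lambda>n. (1 + ln (real (n + a) + 1)) * (real (n + a) + 1) powr \<delta>)"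
  unfolding sublinear_iff_smallo using assms by real_asymp

lemma sublinear_log: "sublinear (\<lambda>n. 1 + ln (real (Suc (n + a))))"
proof -
  have "sublinear (\<lambda>n. (1 + ln (real (n + a) + 1)) * (real (n + a) + 1) powr 0)"
    by (rule sublinear_ln_powr) simp
  moreover have "(real (n + a) + 1) powr 0 = 1" for n by simp
  ultimately show ?thesis by (simp add: add.commute)
qed

section \<open>The closed loop along one trajectory\<close>

text \<open>
  One trajectory of the controlled process, with the estimator of the parameter in use. The dimension \<open>d\<close>
  is a parameter of its own to keep it from being unfolded.
\<close>

locale closed_loop =
  fixes p d :: nat and \<theta> :: "real vec" and \<rho> :: real and X U :: "int \<Rightarrow> real" and \<epsilon> V x :: "nat \<Rightarrow> real"
    and \<Phi> \<theta>h :: "nat \<Rightarrow> real vec" and \<Theta> :: "real vec"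
  assumes d_eq: "d = p + 2"
    and rho: "\<bar>\<rho>\<bar> < 1" and rho_nz: "\<rho> \<noteq> 0"
    and X_eq: "X (int n + 1) = (\<Sum>k<p. \<theta> $ k * X (int n - int k)) + U (int n) + \<epsilon> (Suc n)"
    and eps_eq: "\<epsilon> (Suc n) = \<rho> * \<epsilon> n + V (Suc n)"
    and \<Phi>_carrier: "\<Phi> n \<in> carrier_vec d"
    and \<Phi>_X: "i \<le> p \<Longrightarrow> \<Phi> n $ i = X (int n - int i)"
    and \<Phi>_U: "\<Phi> n $ (p + 1) = U (int n - 1)"
    and \<Theta>_carrier: "\<Theta> \<in> carrier_vec d"
    and \<Theta>_index: "i < p + 2 \<Longrightarrow> \<Theta> $ i = (if i < p then \<theta> $ i else 0)
      - \<rho> * (if i = 0 then -1 else if i \<le> p then \<theta> $ (i - 1) else 1)"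
    and estimator: "least_squares_estimator d \<Phi> X U \<theta>h"
    and control: "n \<ge> 1 \<Longrightarrow> U (int n) = x (n + 1) - \<theta>h n \<bullet> \<Phi> n"
begin

sublocale regressors d \<Phi>
  by unfold_locales (rule \<Phi>_carrier)

text \<open>
  From time 1 on the past control is a function of the state and of the coloured noise.
\<close>

lemma U_eq: "n \<ge> 1 \<Longrightarrow> U (int n - 1) = X (int n) - (\<Sum>k<p. \<theta> $ k * X (int n - 1 - int k)) - \<epsilon> n"
  using X_eq[of "n - 1"] by (simp add: of_nat_diff)

lemma prediction:
  assumes n: "n \<ge> 1"
  shows "X (int n + 1) = \<Theta> \<bullet> \<Phi> n + U (int n) + V (Suc n)"
proof -
  let ?Y = "\<lambda>i. X (int n - int i)"
  have "\<Theta> \<bullet> \<Phi> n = (\<Sum>i<p+2. \<Theta> $ i * \<Phi> n $ i)"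
    by (simp add: scalar_prod_def lessThan_atLeast0 d_eq)
  also have "\<dots> = (\<Sum>i<p+2. (if i < p then \<theta> $ i else 0) * \<Phi> n $ i)
      - \<rho> * (\<Sum>i<p+2. (if i = 0 then -1 else if i \<le> p then \<theta> $ (i - 1) else 1) * \<Phi> n $ i)"
    unfolding sum_distrib_left sum_subtractf[symmetric]
    by (intro sum.cong refl) (simp add: \<Theta>_index left_diff_distrib)
  also have "(\<Sum>i<p+2. (if i < p then \<theta> $ i else 0) * \<Phi> n $ i) = (\<Sum>i<p. \<theta> $ i * ?Y i)"
    by (rule sum.mono_neutral_cong_right) (auto simp: \<Phi>_X)
  also have "(\<Sum>i<p+2. (if i = 0 then -1 else if i \<le> p then \<theta> $ (i - 1) else 1) * \<Phi> n $ i)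
      = - X (int n) + (\<Sum>i<p. \<theta> $ i * X (int n - 1 - int i)) + U (int n - 1)"
  proof -
    have "(\<Sum>i<Suc (Suc p). (if i = 0 then -1 else if i \<le> p then \<theta> $ (i - 1) else 1) * \<Phi> n $ i)
        = - \<Phi> n $ 0 + (\<Sum>i<p. (if i < p then \<theta> $ i else 1) * \<Phi> n $ Suc i) + \<Phi> n $ Suc p"
      by (subst sum.lessThan_Suc_shift) (simp add: Suc_le_eq)
    also have "(\<Sum>i<p. (if i < p then \<theta> $ i else 1) * \<Phi> n $ Suc i) = (\<Sum>i<p. \<theta> $ i * X (int n - 1 - int i))"
      by (intro sum.cong refl) (simp add: \<Phi>_X algebra_simps)
    finally show ?thesis using \<Phi>_X[of 0 n] \<Phi>_U[of n] by simp
  qed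
  also have "- X (int n) + (\<Sum>i<p. \<theta> $ i * X (int n - 1 - int i)) + U (int n - 1) = - \<epsilon> n"
    using U_eq[OF n] by simp
  finally show ?thesis unfolding X_eq eps_eq by simp
qed

text \<open>
  In the following, \<open>e\<close> is the estimation error, \<open>\<pi>\<close> the error in predicting the next state, \<open>\<alpha>\<close> its
  square as it appears in the energy balance, \<open>f\<close> the weight of the squared innovation, \<open>v\<close> the energy and \<open>\<nu>\<close>
  the innovation.
\<close>

definition e :: "nat \<Rightarrow> real vec" where "e n = \<theta>h n - \<Theta>"
definition \<pi> :: "nat \<Rightarrow> real" where "\<pi> n = e n \<bullet> \<Phi> n"
definition \<alpha> :: "nat \<Rightarrow> real" where "\<alpha> n = (\<pi> n)\<^sup>2 / (1 + g n)"
definition f :: "nat \<Rightarrow> real" where "f n = g n / (1 + g n)"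
definition v :: "nat \<Rightarrow> real" where "v n = e n \<bullet> (R n *\<^sub>v e n)"
definition \<nu> :: "nat \<Rightarrow> real" where "\<nu> n = X (int n + 1) - U (int n) - \<Theta> \<bullet> \<Phi> n"

lemma estimator_carrier: "\<theta>h n \<in> carrier_vec d"
proof (induction n)
  case 0
  show ?case using estimator by (simp add: least_squares_estimator_def)
next
  case (Suc n)
  have "\<theta>h (Suc n) = \<theta>h n + (X (int n + 1) - U (int n) - \<theta>h n \<bullet> \<Phi> n) \<cdot>\<^sub>v
         (the (mat_inverse (design_matrix d \<Phi> n)) *\<^sub>v \<Phi> n)"
    using estimator unfolding least_squares_estimator_def by blast
  also have "the (mat_inverse (design_matrix d \<Phi> n)) = Q (Suc n)"
    unfolding design_matrix_eq_gram[OF \<Phi>_carrier] mat_inverse_gram by simp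
  finally show ?case
    using gram_mult_vec_carrier(2)[OF \<Phi>_carrier, of "Suc n" n] Suc by (simp del: gram_inv.simps)
qed

lemma e_carrier [simp, intro]: "e n \<in> carrier_vec d"
  unfolding e_def by (rule minus_carrier_vec[OF estimator_carrier \<Theta>_carrier])

lemma e_Suc: "e (Suc n) = e n + (\<nu> n - e n \<bullet> \<Phi> n) \<cdot>\<^sub>v (Q (Suc n) *\<^sub>v \<Phi> n)"
proof -
  have "\<theta>h (Suc n) = \<theta>h n + (X (int n + 1) - U (int n) - \<theta>h n \<bullet> \<Phi> n) \<cdot>\<^sub>v
         (the (mat_inverse (design_matrix d \<Phi> n)) *\<^sub>v \<Phi> n)"
    using estimator unfolding least_squares_estimator_def by blast
  also have "the (mat_inverse (design_matrix d \<Phi> n)) = Q (Suc n)"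
    unfolding design_matrix_eq_gram[OF \<Phi>_carrier] mat_inverse_gram by simp
  also have "X (int n + 1) - U (int n) - \<theta>h n \<bullet> \<Phi> n = \<nu> n - e n \<bullet> \<Phi> n"
    using minus_scalar_prod_distrib[OF estimator_carrier[of n] \<Theta>_carrier \<Phi>_carrier[of n]]
    by (simp add: \<nu>_def e_def)
  finally have *: "\<theta>h (Suc n) = \<theta>h n + (\<nu> n - e n \<bullet> \<Phi> n) \<cdot>\<^sub>v (Q (Suc n) *\<^sub>v \<Phi> n)" .
  have "(a + c \<cdot>\<^sub>v u) - b = (a - b) + c \<cdot>\<^sub>v u"
    if "a \<in> carrier_vec d" "b \<in> carrier_vec d" "u \<in> carrier_vec d" for a b u :: "real vec" and c
    using that by (intro eq_vecI) auto
  from this[OF estimator_carrier \<Theta>_carrier gram_mult_vec_carrier(2)[OF \<Phi>_carrier]]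
  show ?thesis unfolding e_def[of "Suc n"] * unfolding e_def .
qed

text \<open>
  At time 0 the innovation is not a noise variable, as \<open>U (-1)\<close> is an arbitrary initial value.
\<close>

lemma \<nu>_eq: "n \<ge> 1 \<Longrightarrow> \<nu> n = V (Suc n)"
  using prediction[of n] by (simp add: \<nu>_def)

lemma tracking: "n \<ge> 1 \<Longrightarrow> X (int n + 1) = x (n + 1) + V (Suc n) - \<pi> n"
  using prediction[of n] control[of n] minus_scalar_prod_distrib[OF estimator_carrier[of n] \<Theta>_carrier \<Phi>_carrier[of n]]
  by (simp add: \<pi>_def e_def)

lemma energy: "v n + (\<Sum>k<n. \<alpha> k) = v 0 + 2 * (\<Sum>k<n. \<pi> k / (1 + g k) * \<nu> k) + (\<Sum>k<n. f k * (\<nu> k)\<^sup>2)"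
proof (induction n)
  case (Suc n)
  have "v (Suc n) + \<alpha> n = v n + 2 * (\<pi> n / (1 + g n) * \<nu> n) + f n * (\<nu> n)\<^sup>2"
    unfolding v_def \<alpha>_def f_def \<pi>_def by (rule energy_step[OF e_carrier e_Suc])
  then show ?case using Suc by simp
qed simp

lemma g_pos: "1 + g n > 0" using leverage_nonneg[of n] by linarith

lemma \<alpha>_nonneg: "\<alpha> n \<ge> 0" using g_pos[of n] by (simp add: \<alpha>_def)
lemma f_nonneg: "f n \<ge> 0" and f_le_ln: "f n \<le> ln (1 + g n)"
proof -
  show "f n \<ge> 0" using leverage_nonneg[of n] by (simp add: f_def)
  show "f n \<le> ln (1 + g n)"
    using ln_le_minus_one[of "1 / (1 + g n)"] g_pos[of n] by (simp add: f_def ln_div field_simps)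
qed

lemma v_ge: "v n \<ge> e n \<bullet> e n"
  unfolding v_def gram_form[OF e_carrier e_carrier] by (simp add: sum_nonneg)

end

text \<open>
  A trajectory on which the noise behaves as it does almost surely.
\<close>

locale regular_path = closed_loop +
  fixes sigma_sq \<delta> :: real
  assumes sigma_pos: "sigma_sq > 0" and \<delta>_pos: "\<delta> > 0" and \<delta>_lt: "\<delta> < 1"
    and prediction_noise: "\<forall>\<eta>>0. \<exists>C. \<forall>n. \<bar>\<Sum>k<n. \<pi> k / (1 + g k) * V (Suc k)\<bar> \<le> C + \<eta> * (\<Sum>k<n. (\<pi> k / (1 + g k))\<^sup>2)"
    and leverage_noise: "\<forall>\<eta>>0. \<exists>C. \<forall>n. \<bar>\<Sum>k<n. f k * ((V (Suc k))\<^sup>2 - sigma_sq)\<bar> \<le> C + \<eta> * (\<Sum>k<n. f k)"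
    and noise_variance: "sublinear (\<lambda>n. \<Sum>k<n. (V (Suc k))\<^sup>2 - sigma_sq)"
    and noise_lag: "\<And>s. \<forall>\<eta>>0. \<exists>C. \<forall>n.
      \<bar>\<Sum>k<n. (if s < k then V (k - s) else 0) * V (Suc k)\<bar> \<le> C + \<eta> * (\<Sum>k<n. (if s < k then V (k - s) else 0)\<^sup>2)"
    and eps_lag: "\<And>s. \<forall>\<eta>>0. \<exists>C. \<forall>n.
      \<bar>\<Sum>k<n. (if s \<le> k then \<epsilon> (k - s) else 0) * V (Suc k)\<bar> \<le> C + \<eta> * (\<Sum>k<n. (if s \<le> k then \<epsilon> (k - s) else 0)\<^sup>2)"
    and noise_growth: "\<exists>C. \<forall>k. (V (Suc k))\<^sup>2 \<le> C * real (Suc k) powr \<delta>"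
    and reference: "sublinear (\<lambda>n. \<Sum>k=1..n. (x k)\<^sup>2)"
begin

definition r :: "nat \<Rightarrow> real" where "r n = 1 + (\<Sum>k<n. \<Phi> k \<bullet> \<Phi> k)"

lemma r_ge_1: "r n \<ge> 1" by (simp add: r_def sum_nonneg scalar_prod_self_nonneg)
lemma r_mono: "m \<le> n \<Longrightarrow> r m \<le> r n"
  unfolding r_def by (intro add_left_mono sum_mono2) (auto simp: scalar_prod_self_nonneg)
lemma ln_r_nonneg: "ln (r n) \<ge> 0" using r_ge_1 by simp

lemma sum_f_le: "\<exists>C>0. \<forall>n. (\<Sum>k<n. f k) \<le> C * (1 + ln (r n))"
proof (intro exI[of _ "ln (fact d) + real d"] conjI allI)
  have "ln (fact d :: real) \<ge> 0" by (rule ln_ge_zero, rule fact_ge_1)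
  then show "0 < ln (fact d) + real d" by (simp add: d_eq add_nonneg_pos del: fact_Suc)
  fix n
  have "(\<Sum>k<n. f k) \<le> (\<Sum>k<n. ln (1 + g k))" by (intro sum_mono f_le_ln)
  also have "\<dots> \<le> ln (fact d) + real d * ln (r n)"
    unfolding r_def by (rule sum_ln_leverage_le)
  also have "\<dots> \<le> (ln (fact d) + real d) * (1 + ln (r n))"
    using ln_r_nonneg[of n] \<open>ln (fact d :: real) \<ge> 0\<close> by (simp only: distrib_left distrib_right) simp
  finally show "(\<Sum>k<n. f k) \<le> (ln (fact d) + real d) * (1 + ln (r n))" .
qed

text \<open>
  In the energy balance the weighted noise sum is absorbed by half of the sum of \<open>\<alpha>\<close>, and the weighted squares
  of the noise are at most a multiple of the sum of the weights \<open>f\<close>.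
\<close>

lemma energy_le: "\<exists>C>0. \<forall>n. v n \<le> C * (1 + ln (r n)) \<and> (\<Sum>k<n. \<alpha> k) \<le> C * (1 + ln (r n))"
proof -
  obtain C1 where C1: "\<bar>\<Sum>k<n. \<pi> k / (1 + g k) * V (Suc k)\<bar> \<le> C1 + 1/4 * (\<Sum>k<n. (\<pi> k / (1 + g k))\<^sup>2)" for n
    using prediction_noise[rule_format, of "1/4"] by auto
  obtain C2 where C2: "\<bar>\<Sum>k<n. f k * ((V (Suc k))\<^sup>2 - sigma_sq)\<bar> \<le> C2 + 1 * (\<Sum>k<n. f k)" for n
    using leverage_noise[rule_format, of 1] by auto
  obtain C3 where C3: "C3 > 0" "\<And>n. (\<Sum>k<n. f k) \<le> C3 * (1 + ln (r n))" using sum_f_le by blast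
  \<comment> \<open>At time 0 the innovation is an arbitrary number instead of the noise.\<close>
  define c where "c = 2 * \<bar>\<pi> 0 / (1 + g 0) * (\<nu> 0 - V 1)\<bar> + \<bar>f 0 * ((\<nu> 0)\<^sup>2 - (V 1)\<^sup>2)\<bar>"
  have head: "(\<Sum>k<n. F k (\<nu> k)) \<le> (\<Sum>k<n. F k (V (Suc k))) + \<bar>F 0 (\<nu> 0) - F 0 (V 1)\<bar>" for F :: "nat \<Rightarrow> real \<Rightarrow> real" and n
  proof (cases n)
    case (Suc m)
    have "(\<Sum>k<m. F (Suc k) (\<nu> (Suc k))) = (\<Sum>k<m. F (Suc k) (V (Suc (Suc k))))"
      by (simp add: \<nu>_eq)
    then show ?thesis unfolding Suc sum.lessThan_Suc_shift by simp
  qed simp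
  have sq_le: "(\<Sum>k<n. (\<pi> k / (1 + g k))\<^sup>2) \<le> (\<Sum>k<n. \<alpha> k)" for n
  proof (rule sum_mono)
    fix k
    have "(\<pi> k)\<^sup>2 / (1 + g k) / (1 + g k) \<le> (\<pi> k)\<^sup>2 / (1 + g k) / 1"
      using leverage_nonneg[of k] by (intro divide_left_mono) auto
    then show "(\<pi> k / (1 + g k))\<^sup>2 \<le> \<alpha> k" by (simp add: \<alpha>_def power_divide power2_eq_square)
  qed
  define K where "K n = v 0 + c + 2 * C1 + C2 + (sigma_sq + 1) * (C3 * (1 + ln (r n)))" for n
  have main: "v n + 1/2 * (\<Sum>k<n. \<alpha> k) \<le> K n" for n
  proof -
    have "2 * (\<Sum>k<n. \<pi> k / (1 + g k) * \<nu> k) \<le> 2 * \<bar>\<pi> 0 / (1 + g 0) * (\<nu> 0 - V 1)\<bar> + 2 * (\<Sum>k<n. \<pi> k / (1 + g k) * V (Suc k))"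
      using head[of "\<lambda>k z. \<pi> k / (1 + g k) * z" n] unfolding right_diff_distrib[of "\<pi> 0 / (1 + g 0)"] by simp
    moreover have "(\<Sum>k<n. f k * (\<nu> k)\<^sup>2) \<le> \<bar>f 0 * ((\<nu> 0)\<^sup>2 - (V 1)\<^sup>2)\<bar> + (\<Sum>k<n. f k * (V (Suc k))\<^sup>2)"
      using head[of "\<lambda>k z. f k * z\<^sup>2" n] unfolding right_diff_distrib[of "f 0"] by simp
    moreover have "(\<Sum>k<n. f k * (V (Suc k))\<^sup>2) = (\<Sum>k<n. f k * ((V (Suc k))\<^sup>2 - sigma_sq)) + sigma_sq * (\<Sum>k<n. f k)"
      by (simp add: right_diff_distrib sum_subtractf sum_distrib_left mult.commute)
    moreover have "(sigma_sq + 1) * (\<Sum>k<n. f k) \<le> (sigma_sq + 1) * (C3 * (1 + ln (r n)))"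
      using C3(2) sigma_pos by (intro mult_left_mono) simp_all
    moreover have "(sigma_sq + 1) * (\<Sum>k<n. f k) = sigma_sq * (\<Sum>k<n. f k) + (\<Sum>k<n. f k)"
      by (simp add: distrib_right)
    ultimately show ?thesis
      using energy[of n] C1[of n] C2[of n] sq_le[of n] unfolding c_def K_def by linarith
  qed
  define C where "C = 2 * (\<bar>v 0\<bar> + c + 2 * \<bar>C1\<bar> + \<bar>C2\<bar> + (sigma_sq + 1) * C3)"
  have c0: "c \<ge> 0" by (simp add: c_def)
  have C3': "(sigma_sq + 1) * C3 > 0" using C3(1) sigma_pos by simp
  have pos: "v n \<ge> 0" "(\<Sum>k<n. \<alpha> k) \<ge> 0" for n
    using v_ge[of n] scalar_prod_self_nonneg[of "e n"] by (simp_all add: sum_nonneg \<alpha>_nonneg)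
  show ?thesis
  proof (intro exI[of _ C] conjI allI)
    have "0 \<le> \<bar>v 0\<bar> + c + 2 * \<bar>C1\<bar> + \<bar>C2\<bar>" using c0 by simp
    then have "0 < \<bar>v 0\<bar> + c + 2 * \<bar>C1\<bar> + \<bar>C2\<bar> + (sigma_sq + 1) * C3" using C3' by (rule add_nonneg_pos)
    then show "C > 0" unfolding C_def by (rule mult_pos_pos[OF zero_less_numeral])
    fix n
    have le: "2 * K n \<le> C * (1 + ln (r n))"
    proof -
      define L where "L = 1 + ln (r n)"
      have L: "L \<ge> 1" using ln_r_nonneg by (simp add: L_def)
      have "v 0 + c + 2 * C1 + C2 \<le> (\<bar>v 0\<bar> + c + 2 * \<bar>C1\<bar> + \<bar>C2\<bar>) * 1" by simp
      also have "\<dots> \<le> (\<bar>v 0\<bar> + c + 2 * \<bar>C1\<bar> + \<bar>C2\<bar>) * L"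
        using L c0 by (intro mult_left_mono) auto
      finally show ?thesis unfolding K_def L_def[symmetric] C_def by (simp add: algebra_simps)
    qed
    show "v n \<le> C * (1 + ln (r n))" using le main[of n] pos[of n] by linarith
    show "(\<Sum>k<n. \<alpha> k) \<le> C * (1 + ln (r n))" using le main[of n] pos[of n] by linarith
  qed
qed

lemma sum_noise_le: "\<exists>C>0. \<forall>n. (\<Sum>k<n. (V (Suc k))\<^sup>2) \<le> C * real (Suc n)"
proof -
  obtain C where C: "\<bar>\<Sum>k<n. (V (Suc k))\<^sup>2 - sigma_sq\<bar> \<le> C + 1 * real n" for n
    using sublinearD[OF noise_variance, of 1] by auto
  show ?thesis
  proof (intro exI[of _ "\<bar>C\<bar> + 1 + sigma_sq"] conjI allI)
    show "\<bar>C\<bar> + 1 + sigma_sq > 0" using sigma_pos by simp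
    fix n
    have "(\<Sum>k<n. (V (Suc k))\<^sup>2) \<le> \<bar>C\<bar> + (1 + sigma_sq) * real n"
      using C[of n] by (simp add: sum_subtractf algebra_simps)
    also have "\<dots> \<le> (\<bar>C\<bar> + 1 + sigma_sq) * real (Suc n)" using sigma_pos by (simp add: algebra_simps)
    finally show "(\<Sum>k<n. (V (Suc k))\<^sup>2) \<le> (\<bar>C\<bar> + 1 + sigma_sq) * real (Suc n)" .
  qed
qed

text \<open>
  Convexity of the square, for the weights \<open>\<bar>\<rho>\<bar>\<close> and \<open>1 - \<bar>\<rho>\<bar>\<close>.
\<close>

lemma eps_square_step: "(\<epsilon> (Suc n))\<^sup>2 \<le> \<bar>\<rho>\<bar> * (\<epsilon> n)\<^sup>2 + (V (Suc n))\<^sup>2 / (1 - \<bar>\<rho>\<bar>)"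
proof -
  define t where "t = 1 - \<bar>\<rho>\<bar>"
  have t: "t > 0" "\<bar>\<rho>\<bar> = 1 - t" using rho by (simp_all add: t_def)
  define a where "a = \<bar>\<epsilon> n\<bar>"
  define b where "b = \<bar>V (Suc n)\<bar>"
  have "\<bar>\<epsilon> (Suc n)\<bar> \<le> (1 - t) * a + b"
    unfolding eps_eq a_def b_def t(2)[symmetric] abs_mult[symmetric] by (rule abs_triangle_ineq)
  then have "\<bar>\<epsilon> (Suc n)\<bar>\<^sup>2 \<le> ((1 - t) * a + b)\<^sup>2" by (rule power_mono) simp
  also have "\<dots> = (1 - t) * a\<^sup>2 + b\<^sup>2 / t - (1 - t) * (a * t - b)\<^sup>2 / t"
    using t(1) by (simp add: field_simps power2_eq_square)
  also have "\<dots> \<le> (1 - t) * a\<^sup>2 + b\<^sup>2 / t"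
    using t(1) abs_ge_zero[of \<rho>] unfolding t(2) by simp
  finally show ?thesis by (simp add: a_def b_def t_def)
qed

lemma sum_eps_le: "\<exists>C>0. \<forall>n. (\<Sum>k\<le>n. (\<epsilon> k)\<^sup>2) \<le> C * real (Suc n)"
proof -
  obtain C where C: "C > 0" "\<And>n. (\<Sum>k<n. (V (Suc k))\<^sup>2) \<le> C * real (Suc n)" using sum_noise_le by blast
  define t where "t = 1 - \<bar>\<rho>\<bar>"
  have t: "t > 0" using rho by (simp add: t_def)
  define D where "D = ((\<epsilon> 0)\<^sup>2 + C / t) / t"
  have "(\<Sum>k\<le>n. (\<epsilon> k)\<^sup>2) \<le> D * real (Suc n)" for n
  proof -
    have "(\<Sum>k\<le>n. (\<epsilon> k)\<^sup>2) = (\<epsilon> 0)\<^sup>2 + (\<Sum>k<n. (\<epsilon> (Suc k))\<^sup>2)"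
      by (simp add: lessThan_Suc_atMost[symmetric] sum.lessThan_Suc_shift del: sum.lessThan_Suc)
    also have "(\<Sum>k<n. (\<epsilon> (Suc k))\<^sup>2) \<le> (\<Sum>k<n. \<bar>\<rho>\<bar> * (\<epsilon> k)\<^sup>2 + (V (Suc k))\<^sup>2 / t)"
      unfolding t_def by (rule sum_mono[OF eps_square_step])
    also have "\<dots> = \<bar>\<rho>\<bar> * (\<Sum>k<n. (\<epsilon> k)\<^sup>2) + (\<Sum>k<n. (V (Suc k))\<^sup>2) / t"
      by (simp add: sum.distrib sum_distrib_left sum_divide_distrib)
    also have "\<bar>\<rho>\<bar> * (\<Sum>k<n. (\<epsilon> k)\<^sup>2) \<le> \<bar>\<rho>\<bar> * (\<Sum>k\<le>n. (\<epsilon> k)\<^sup>2)"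
      by (intro mult_left_mono sum_mono2) auto
    also have "(\<Sum>k<n. (V (Suc k))\<^sup>2) / t \<le> C * real (Suc n) / t"
      using C(2) t by (intro divide_right_mono) simp_all
    finally have "t * (\<Sum>k\<le>n. (\<epsilon> k)\<^sup>2) \<le> (\<epsilon> 0)\<^sup>2 + C / t * real (Suc n)"
      by (simp add: t_def algebra_simps)
    also have "\<dots> \<le> ((\<epsilon> 0)\<^sup>2 + C / t) * real (Suc n)"
    proof -
      have "(\<epsilon> 0)\<^sup>2 * 1 \<le> (\<epsilon> 0)\<^sup>2 * real (Suc n)" by (rule mult_left_mono) simp_all
      then show ?thesis by (simp add: distrib_right)
    qed
    finally show ?thesis using t by (simp add: D_def pos_le_divide_eq mult.commute)
  qed
  moreover have "D > 0" using C(1) t by (simp add: D_def add_nonneg_pos)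
  ultimately show ?thesis by blast
qed

lemma eps_growth: "\<exists>C. \<forall>n. (\<epsilon> n)\<^sup>2 \<le> C * real (Suc n) powr \<delta>"
proof -
  obtain C where C: "\<And>k. (V (Suc k))\<^sup>2 \<le> C * real (Suc k) powr \<delta>" using noise_growth by blast
  define t where "t = 1 - \<bar>\<rho>\<bar>"
  have t: "t > 0" using rho by (simp add: t_def)
  define D where "D = max ((\<epsilon> 0)\<^sup>2) (\<bar>C\<bar> / t / t)"
  have D0: "D \<ge> 0" by (simp add: D_def le_max_iff_disj)
  have DC: "\<bar>C\<bar> / t \<le> D * t"
  proof -
    have "\<bar>C\<bar> / t / t \<le> D" by (simp add: D_def)
    then show ?thesis using t by (simp add: pos_divide_le_eq)
  qed
  have "(\<epsilon> n)\<^sup>2 \<le> D * real (Suc n) powr \<delta>" for n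
  proof (induction n)
    case (Suc n)
    let ?y = "real (Suc n) powr \<delta>"
    have "(\<epsilon> (Suc n))\<^sup>2 \<le> \<bar>\<rho>\<bar> * (\<epsilon> n)\<^sup>2 + (V (Suc n))\<^sup>2 / t" using eps_square_step by (simp add: t_def)
    also have "\<bar>\<rho>\<bar> * (\<epsilon> n)\<^sup>2 \<le> \<bar>\<rho>\<bar> * (D * ?y)" by (intro mult_left_mono Suc) simp
    also have "(V (Suc n))\<^sup>2 / t \<le> \<bar>C\<bar> * ?y / t"
    proof (rule divide_right_mono)
      have "C * ?y \<le> \<bar>C\<bar> * ?y" by (intro mult_right_mono) simp_all
      then show "(V (Suc n))\<^sup>2 \<le> \<bar>C\<bar> * ?y" using C[of n] by linarith
    qed (use t in simp)
    also have "\<bar>C\<bar> * ?y / t = \<bar>C\<bar> / t * ?y" by simp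
    also have "\<bar>C\<bar> / t * ?y \<le> D * t * ?y" by (intro mult_right_mono DC) simp
    also have "\<bar>\<rho>\<bar> * (D * ?y) + D * t * ?y = D * ?y" by (simp add: t_def algebra_simps)
    also have "\<dots> \<le> D * real (Suc (Suc n)) powr \<delta>"
      using D0 \<delta>_pos by (intro mult_left_mono powr_mono2) auto
    finally show ?case by simp
  qed (simp add: D_def)
  then show ?thesis by blast
qed

section \<open>Polynomial growth of the regressors\<close>

text \<open>
  The sum of squares of the states from time \<open>-p\<close> to time \<open>n\<close>. Being nondecreasing, it bounds all lagged
  states at once.
\<close>

definition G :: "nat \<Rightarrow> real" where "G n = (\<Sum>i\<le>n + p. (X (int i - int p))\<^sup>2)"

lemma G_nonneg: "G n \<ge> 0" by (simp add: G_def sum_nonneg)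

lemma G_mono: "m \<le> n \<Longrightarrow> G m \<le> G n" unfolding G_def by (intro sum_mono2) auto

lemma G_Suc: "G (Suc n) = G n + (X (int n + 1))\<^sup>2"
  by (simp add: G_def algebra_simps)

lemma sum_lags_le_G: "(\<Sum>i\<le>p. (X (int n - int i))\<^sup>2) \<le> G n"
proof -
  have "(\<Sum>i\<le>p. (X (int n - int i))\<^sup>2) = (\<Sum>i\<in>{n..n + p}. (X (int i - int p))\<^sup>2)"
    by (rule sum.reindex_bij_witness[of _ "\<lambda>i. n + p - i" "\<lambda>i. n + p - i"]) (auto simp: of_nat_diff)
  also have "\<dots> \<le> G n" unfolding G_def by (intro sum_mono2) auto
  finally show ?thesis .
qed

lemma regressor_le: "\<exists>c>0. \<forall>n\<ge>1. \<Phi> n \<bullet> \<Phi> n \<le> c * (G n + (\<epsilon> n)\<^sup>2)"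
proof -
  define T where "T = (\<Sum>k<p. (\<theta> $ k)\<^sup>2)"
  have T: "T \<ge> 0" by (simp add: T_def sum_nonneg)
  have "\<Phi> n \<bullet> \<Phi> n \<le> (4 + 3 * T) * (G n + (\<epsilon> n)\<^sup>2)" if n: "n \<ge> 1" for n
  proof -
    define L where "L = (\<Sum>i\<le>p. (X (int n - int i))\<^sup>2)"
    define A where "A = (\<Sum>k<p. \<theta> $ k * X (int n - 1 - int k))"
    have LG: "L \<le> G n" unfolding L_def by (rule sum_lags_le_G)
    have "\<Phi> n \<bullet> \<Phi> n = (\<Sum>i<Suc (Suc p). (\<Phi> n $ i)\<^sup>2)"
      by (simp add: scalar_prod_def lessThan_atLeast0 power2_eq_square d_eq)
    also have "\<dots> = (\<Sum>i<Suc p. (\<Phi> n $ i)\<^sup>2) + (U (int n - 1))\<^sup>2"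
      using \<Phi>_U[of n] by simp
    also have "(\<Sum>i<Suc p. (\<Phi> n $ i)\<^sup>2) = L"
      unfolding L_def lessThan_Suc_atMost by (intro sum.cong refl) (simp add: \<Phi>_X)
    finally have Phi: "\<Phi> n \<bullet> \<Phi> n = L + (U (int n - 1))\<^sup>2" .
    have X0: "(X (int n))\<^sup>2 \<le> L"
      unfolding L_def using member_le_sum[of 0 "{..p}" "\<lambda>i. (X (int n - int i))\<^sup>2"] by simp
    have A2: "A\<^sup>2 \<le> T * L"
    proof -
      have "A\<^sup>2 \<le> T * (\<Sum>k<p. (X (int n - 1 - int k))\<^sup>2)"
        unfolding A_def T_def by (rule Cauchy_Schwarz_ineq_sum)
      also have "(\<Sum>k<p. (X (int n - 1 - int k))\<^sup>2) \<le> L"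
      proof -
        have "L = (X (int n))\<^sup>2 + (\<Sum>k<p. (X (int n - 1 - int k))\<^sup>2)"
          unfolding L_def lessThan_Suc_atMost[symmetric] sum.lessThan_Suc_shift by (simp add: algebra_simps)
        then show ?thesis by simp
      qed
      finally show ?thesis using T by (simp add: mult_left_mono)
    qed
    have "(U (int n - 1))\<^sup>2 \<le> 3 * (X (int n))\<^sup>2 + 3 * A\<^sup>2 + 3 * (\<epsilon> n)\<^sup>2"
      using square_add_add_le[of "X (int n)" "- A" "- \<epsilon> n"] by (simp add: U_eq[OF n] A_def)
    then have "\<Phi> n \<bullet> \<Phi> n \<le> (4 + 3 * T) * L + 3 * (\<epsilon> n)\<^sup>2"
      using X0 A2 unfolding Phi by (simp add: algebra_simps)
    also have "\<dots> \<le> (4 + 3 * T) * G n + (4 + 3 * T) * (\<epsilon> n)\<^sup>2"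
      using T LG by (intro add_mono mult_left_mono mult_right_mono) auto
    finally show ?thesis by (simp add: distrib_left)
  qed
  then show ?thesis using T by (intro exI[of _ "4 + 3 * T"]) auto
qed

text \<open>
  The sum of \<open>\<alpha>\<close> is of order \<open>ln (r n)\<close>, and the decreases of the trace tend to 0.
\<close>

lemma trace_drop_alpha_small:
  assumes "\<eta> > 0"
  shows "\<exists>C. \<forall>n. (\<Sum>k<n. \<alpha> k * trace_drop k) \<le> C + \<eta> * ln (r n)"
proof -
  obtain C1 where C1: "C1 > 0" "\<And>n. (\<Sum>k<n. \<alpha> k) \<le> C1 * (1 + ln (r n))" using energy_le by blast
  have "summable trace_drop"
    using sum_trace_drop_le trace_drop_nonneg by (intro summableI_nonneg_bounded[of _ "real d"])
  then have "trace_drop \<longlonglongrightarrow> 0" by (rule summable_LIMSEQ_zero)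
  then obtain N where N: "\<And>n. n \<ge> N \<Longrightarrow> norm (trace_drop n - 0) < \<eta> / C1"
    using LIMSEQ_D[of trace_drop 0 "\<eta> / C1"] assms C1(1) by auto
  define c where "c = \<eta> / C1"
  have c: "c > 0" "c * C1 = \<eta>" using assms C1(1) by (simp_all add: c_def)
  have "\<alpha> k * trace_drop k \<le> (if k < N then \<alpha> k * trace_drop k else 0) + c * \<alpha> k" for k
  proof (cases "k < N")
    case False
    then have "trace_drop k \<le> c" using N[of k] by (simp add: c_def)
    then show ?thesis using False mult_right_mono[OF _ \<alpha>_nonneg[of k], of "trace_drop k" c] by (simp add: mult.commute)
  qed (use c(1) \<alpha>_nonneg[of k] in simp)
  then have "(\<Sum>k<n. \<alpha> k * trace_drop k) \<le> (\<Sum>k<n. (if k < N then \<alpha> k * trace_drop k else 0) + c * \<alpha> k)" for n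
    by (rule sum_mono)
  then have "(\<Sum>k<n. \<alpha> k * trace_drop k) \<le> (\<Sum>k<n. if k < N then \<alpha> k * trace_drop k else 0) + c * (\<Sum>k<n. \<alpha> k)" for n
    unfolding sum.distrib sum_distrib_left[symmetric] .
  moreover have "(\<Sum>k<n. (if k < N then \<alpha> k * trace_drop k else 0)) \<le> (\<Sum>k<N. \<alpha> k * trace_drop k)" for n
  proof -
    have "(\<Sum>k<n. (if k < N then \<alpha> k * trace_drop k else 0)) = (\<Sum>k\<in>{..<n} \<inter> {..<N}. \<alpha> k * trace_drop k)"
      by (rule sum.mono_neutral_cong_right) auto
    also have "\<dots> \<le> (\<Sum>k<N. \<alpha> k * trace_drop k)"
      by (intro sum_mono2) (auto simp: \<alpha>_nonneg trace_drop_nonneg)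
    finally show ?thesis .
  qed
  moreover have "c * (\<Sum>k<n. \<alpha> k) \<le> \<eta> + \<eta> * ln (r n)" for n
    using mult_left_mono[OF C1(2)[of n], of c] c by (simp add: mult.assoc[symmetric] distrib_left)
  ultimately have "(\<Sum>k<n. \<alpha> k * trace_drop k) \<le> (\<Sum>k<N. \<alpha> k * trace_drop k) + \<eta> + \<eta> * ln (r n)" for n
    by (smt (verit))
  then show ?thesis by blast
qed

text \<open>
  The square of the next state is bounded by those of the reference, of the noise and of the prediction error.
  For the last one \<open>leverage_le\<close> separates the part that is proportional to the regressor.
\<close>

lemma state_step:
  "\<exists>B>0. \<forall>n\<ge>1. (X (int n + 1))\<^sup>2 \<le> B * (\<alpha> n * trace_drop n) * G n + B * real (Suc n) * (1 + ln (r (Suc n)))"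
proof -
  obtain C1 where C1: "C1 > 0" "\<And>n. (\<Sum>k<n. \<alpha> k) \<le> C1 * (1 + ln (r n))" using energy_le by blast
  obtain c where c: "c > 0" "\<And>n. n \<ge> 1 \<Longrightarrow> \<Phi> n \<bullet> \<Phi> n \<le> c * (G n + (\<epsilon> n)\<^sup>2)" using regressor_le by blast
  obtain C2 where C2: "C2 > 0" "\<And>n. (\<Sum>k\<le>n. (\<epsilon> k)\<^sup>2) \<le> C2 * real (Suc n)" using sum_eps_le by blast
  obtain C3 where C3: "C3 > 0" "\<And>n. (\<Sum>k<n. (V (Suc k))\<^sup>2) \<le> C3 * real (Suc n)" using sum_noise_le by blast
  obtain C4 where C4: "\<And>n. \<bar>\<Sum>k=1..n. (x k)\<^sup>2\<bar> \<le> C4 + 1 * real n" using sublinearD[OF reference, of 1] by auto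
  define B where "B = 3 * c + 6 * C1 + 3 * C1 * real d * c * C2 + 6 * C3 + 3 * \<bar>C4\<bar> + 3"
  have d: "real d \<ge> 0" by simp
  have Bpos: "B > 0" using c(1) C1(1) C2(1) C3(1) d unfolding B_def
    by (intro add_nonneg_pos add_nonneg_nonneg mult_nonneg_nonneg) auto
  have "(X (int n + 1))\<^sup>2 \<le> B * (\<alpha> n * trace_drop n) * G n + B * real (Suc n) * (1 + ln (r (Suc n)))" if n: "n \<ge> 1" for n
  proof -
    define S where "S = real (Suc n)"
    define L where "L = 1 + ln (r (Suc n))"
    have S: "S \<ge> 1" by (simp add: S_def)
    have L: "L \<ge> 1" using ln_r_nonneg by (simp add: L_def)
    have SL: "S \<le> S * L" "L \<le> S * L" using S L mult_left_mono[OF L, of S] mult_right_mono[OF S, of L] by auto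
    have a: "\<alpha> n \<le> C1 * L"
    proof -
      have "\<alpha> n \<le> (\<Sum>k<Suc n. \<alpha> k)" using sum_nonneg[of "{..<n}" \<alpha>] \<alpha>_nonneg by simp
      then show ?thesis using C1(2)[of "Suc n"] by (simp add: L_def)
    qed
    have a0: "\<alpha> n \<ge> 0" by (rule \<alpha>_nonneg)
    have t0: "trace_drop n \<ge> 0" by (rule trace_drop_nonneg)
    have t: "trace_drop n \<le> real d"
    proof -
      have "trace_drop n \<le> (\<Sum>k<Suc n. trace_drop k)" using sum_nonneg[of "{..<n}" trace_drop] trace_drop_nonneg by simp
      then show ?thesis using sum_trace_drop_le[of "Suc n"] by simp
    qed
    have e: "(\<epsilon> n)\<^sup>2 \<le> C2 * S"
      using member_le_sum[of n "{..n}" "\<lambda>k. (\<epsilon> k)\<^sup>2"] C2(2)[of n] by (simp add: S_def)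
    have V: "(V (Suc n))\<^sup>2 \<le> 2 * C3 * S"
    proof -
      have "(V (Suc n))\<^sup>2 \<le> C3 * real (Suc (Suc n))"
        using member_le_sum[of n "{..<Suc n}" "\<lambda>k. (V (Suc k))\<^sup>2"] C3(2)[of "Suc n"] by simp
      also have "\<dots> \<le> C3 * (2 * S)" using C3(1) by (intro mult_left_mono) (auto simp: S_def)
      finally show ?thesis by simp
    qed
    have x: "(x (Suc n))\<^sup>2 \<le> (\<bar>C4\<bar> + 1) * S"
    proof -
      have "(x (Suc n))\<^sup>2 \<le> (\<Sum>k=1..Suc n. (x k)\<^sup>2)"
        by (rule member_le_sum) auto
      also have "\<dots> \<le> \<bar>C4\<bar> + S" using C4[of "Suc n"] by (simp add: S_def)
      also have "\<dots> \<le> (\<bar>C4\<bar> + 1) * S" using mult_left_mono[OF S, of "\<bar>C4\<bar>"] by (simp add: distrib_right)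
      finally show ?thesis .
    qed
    have pi: "(\<pi> n)\<^sup>2 \<le> 2 * \<alpha> n + \<alpha> n * trace_drop n * (c * (G n + (\<epsilon> n)\<^sup>2))"
    proof -
      have "(\<pi> n)\<^sup>2 = \<alpha> n * (1 + g n)" using g_pos[of n] by (simp add: \<alpha>_def)
      also have "\<dots> \<le> \<alpha> n * (2 + trace_drop n * (c * (G n + (\<epsilon> n)\<^sup>2)))"
      proof (rule mult_left_mono[OF _ a0])
        show "1 + g n \<le> 2 + trace_drop n * (c * (G n + (\<epsilon> n)\<^sup>2))"
          using leverage_le[of n] mult_left_mono[OF c(2)[OF n] t0] by linarith
      qed
      finally show ?thesis by (simp add: algebra_simps)
    qed
    have ae: "\<alpha> n * trace_drop n * (c * (\<epsilon> n)\<^sup>2) \<le> (C1 * L * real d) * (c * (C2 * S))"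
      using a a0 t t0 e c(1) C1(1) L d by (intro mult_mono mult_nonneg_nonneg) auto
    have "(X (int n + 1))\<^sup>2 \<le> 3 * (x (Suc n))\<^sup>2 + 3 * (V (Suc n))\<^sup>2 + 3 * (\<pi> n)\<^sup>2"
      unfolding tracking[OF n] using square_add_add_le[of "x (Suc n)" "V (Suc n)" "- \<pi> n"] by simp
    also have "\<dots> \<le> 3 * ((\<bar>C4\<bar> + 1) * S) + 3 * (2 * C3 * S)
        + 3 * (2 * (C1 * L) + \<alpha> n * trace_drop n * (c * G n) + (C1 * L * real d) * (c * (C2 * S)))"
      using x V pi a ae by (simp add: distrib_left)
    also have "\<dots> = 3 * c * (\<alpha> n * trace_drop n * G n) + (3 * (\<bar>C4\<bar> + 1) + 6 * C3) * S + 6 * C1 * L + 3 * C1 * real d * c * C2 * (S * L)"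
      by (simp add: algebra_simps)
    also have "\<dots> \<le> 3 * c * (\<alpha> n * trace_drop n * G n) + (3 * (\<bar>C4\<bar> + 1) + 6 * C3) * (S * L) + 6 * C1 * (S * L) + 3 * C1 * real d * c * C2 * (S * L)"
      using SL C3(1) C1(1) by (intro add_mono mult_left_mono order_refl) auto
    also have "\<dots> \<le> B * (\<alpha> n * trace_drop n * G n) + B * (S * L)"
    proof -
      have "3 * c \<le> B" using C1(1) C2(1) C3(1) c(1) d unfolding B_def by simp
      then have "3 * c * (\<alpha> n * trace_drop n * G n) \<le> B * (\<alpha> n * trace_drop n * G n)"
        using a0 t0 G_nonneg[of n] by (intro mult_right_mono) auto
      moreover have "0 \<le> 3 * c * (S * L)" using c(1) S L by simp
      ultimately show ?thesis unfolding B_def by (simp add: algebra_simps)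
    qed
    finally show ?thesis by (simp add: S_def L_def mult.assoc)
  qed
  then show ?thesis using Bpos by blast
qed

text \<open>
  A discrete Gronwall argument.
\<close>

lemma G_le:
  assumes B: "B > 0"
    and step: "\<And>n. n \<ge> 1 \<Longrightarrow> (X (int n + 1))\<^sup>2
      \<le> B * (\<alpha> n * trace_drop n) * G n + B * real (Suc n) * (1 + ln (r (Suc n)))"
    and n: "n \<ge> 1"
  shows "G n \<le> exp (B * (\<Sum>k<n. \<alpha> k * trace_drop k)) * (G 1 + B * (real n)\<^sup>2 * (1 + ln (r n)))"
  using n
proof (induction n rule: dec_induct)
  case base
  have "1 \<le> exp (B * (\<Sum>k<1. \<alpha> k * trace_drop k))"
    using B by (simp add: \<alpha>_nonneg trace_drop_nonneg)
  then have "1 * G 1 \<le> exp (B * (\<Sum>k<1. \<alpha> k * trace_drop k)) * (G 1 + B * (real 1)\<^sup>2 * (1 + ln (r 1)))"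
    using B ln_r_nonneg[of 1] G_nonneg[of 1] by (intro mult_mono) auto
  then show ?case by simp
next
  case (step n)
  define E where "E n = exp (B * (\<Sum>k<n. \<alpha> k * trace_drop k))" for n
  define b where "b = \<alpha> n * trace_drop n"
  define L where "L = 1 + ln (r (Suc n))"
  have L: "L \<ge> 1" "1 + ln (r n) \<le> L"
    using ln_r_nonneg r_mono[of n "Suc n"] r_ge_1[of n] by (simp_all add: L_def)
  have b: "b \<ge> 0" by (simp add: b_def \<alpha>_nonneg trace_drop_nonneg)
  have E1: "E (Suc n) \<ge> 1"
    unfolding E_def using B by (simp add: sum_nonneg \<alpha>_nonneg trace_drop_nonneg add_nonneg_nonneg)
  have ES: "E (Suc n) = exp (B * b) * E n"
    by (simp add: E_def b_def distrib_left exp_add mult.commute)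
  have "G (Suc n) \<le> (1 + B * b) * G n + B * real (Suc n) * L"
    using assms(2)[OF step(1)] by (simp add: G_Suc b_def L_def algebra_simps)
  also have "(1 + B * b) * G n \<le> exp (B * b) * (E n * (G 1 + B * (real n)\<^sup>2 * (1 + ln (r n))))"
    using step(3) G_nonneg[of n] B b unfolding E_def by (intro mult_mono exp_ge_add_one_self) auto
  also have "\<dots> = E (Suc n) * (G 1 + B * (real n)\<^sup>2 * (1 + ln (r n)))"
    by (simp add: ES mult.assoc)
  also have "\<dots> \<le> E (Suc n) * (G 1 + B * (real n)\<^sup>2 * L)"
    using E1 L B by (intro mult_left_mono add_left_mono) auto
  also have "B * real (Suc n) * L \<le> E (Suc n) * (B * real (Suc n) * L)"
    using mult_right_mono[OF E1, of "B * real (Suc n) * L"] B L by simp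
  also have "E (Suc n) * (G 1 + B * (real n)\<^sup>2 * L) + E (Suc n) * (B * real (Suc n) * L)
      = E (Suc n) * (G 1 + B * ((real n)\<^sup>2 + real (Suc n)) * L)"
    by (simp add: algebra_simps)
  also have "\<dots> \<le> E (Suc n) * (G 1 + B * (real (Suc n))\<^sup>2 * L)"
    using E1 B L by (intro mult_left_mono add_left_mono mult_right_mono) (auto simp: power2_eq_square algebra_simps)
  finally show ?case by (simp add: E_def L_def)
qed

text \<open>
  The bound on \<open>G\<close> contains the factor \<open>exp (B * (\<Sum>k<n. \<alpha> k * trace_drop k))\<close>, at most a constant times
  the fourth root of \<open>r n\<close>, and a logarithm of \<open>r n\<close>, which is bounded by the same root. So \<open>r (Suc n)\<close> is at
  most a cubic polynomial in \<open>n\<close> times the square root of \<open>r (Suc n)\<close>, which gives polynomial growth.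
\<close>

lemma ln_r_le: "\<exists>C>0. \<forall>n. 1 + ln (r n) \<le> C * (1 + ln (real (Suc n)))"
proof -
  obtain B where B: "B > 0" "\<And>n. n \<ge> 1 \<Longrightarrow> (X (int n + 1))\<^sup>2
      \<le> B * (\<alpha> n * trace_drop n) * G n + B * real (Suc n) * (1 + ln (r (Suc n)))"
    using state_step by blast
  \<comment> \<open>This makes the Gronwall factor at most a constant times the fourth root of \<open>r n\<close>.\<close>
  obtain C1 where C1: "\<And>n. (\<Sum>k<n. \<alpha> k * trace_drop k) \<le> C1 + 1 / (4 * B) * ln (r n)"
    using trace_drop_alpha_small[of "1 / (4 * B)"] B(1) by auto
  obtain c where c: "c > 0" "\<And>n. n \<ge> 1 \<Longrightarrow> \<Phi> n \<bullet> \<Phi> n \<le> c * (G n + (\<epsilon> n)\<^sup>2)" using regressor_le by blast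
  obtain C2 where C2: "C2 > 0" "\<And>n. (\<Sum>k\<le>n. (\<epsilon> k)\<^sup>2) \<le> C2 * real (Suc n)" using sum_eps_le by blast
  define K1 where "K1 = 1 + \<Phi> 0 \<bullet> \<Phi> 0 + c + c * C2"
  define K2 where "K2 = exp (B * C1)"
  define K3 where "K3 = K1 * (K2 * (1 + G 1 + B) * 4)"
  have K1: "K1 > 0" using c(1) C2(1) scalar_prod_self_nonneg[of "\<Phi> 0"]
    unfolding K1_def by (intro add_nonneg_pos add_nonneg_nonneg) auto
  have K3: "K3 > 0" using K1 G_nonneg[of 1] B(1) by (simp add: K3_def K2_def add_nonneg_pos)
  have r_Suc: "r (Suc n) \<le> K1 * real (Suc n) * (1 + G n)" if n: "n \<ge> 1" for n
  proof -
    define S where "S = real (Suc n)"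
    have S: "S \<ge> 1" by (simp add: S_def)
    have "(\<Sum>k<n. \<Phi> (Suc k) \<bullet> \<Phi> (Suc k)) \<le> (\<Sum>k<n. c * G n + c * (\<epsilon> (Suc k))\<^sup>2)"
    proof (rule sum_mono)
      fix k assume "k \<in> {..<n}"
      then have "G (Suc k) \<le> G n" by (intro G_mono) simp
      then have "c * G (Suc k) \<le> c * G n" using c(1) by simp
      then show "\<Phi> (Suc k) \<bullet> \<Phi> (Suc k) \<le> c * G n + c * (\<epsilon> (Suc k))\<^sup>2"
        using c(2)[of "Suc k"] by (simp add: distrib_left)
    qed
    also have "\<dots> = real n * (c * G n) + c * (\<Sum>k<n. (\<epsilon> (Suc k))\<^sup>2)"
      by (simp add: sum.distrib sum_distrib_left)
    also have "(\<Sum>k<n. (\<epsilon> (Suc k))\<^sup>2) \<le> (\<Sum>k\<le>n. (\<epsilon> k)\<^sup>2)"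
      by (simp add: lessThan_Suc_atMost[symmetric] sum.lessThan_Suc_shift del: sum.lessThan_Suc)
    also have "(\<Sum>k\<le>n. (\<epsilon> k)\<^sup>2) \<le> C2 * S" using C2(2) by (simp add: S_def)
    also have "real n * (c * G n) \<le> S * (c * G n)"
      using c(1) G_nonneg[of n] by (intro mult_right_mono) (auto simp: S_def)
    finally have "(\<Sum>k<n. \<Phi> (Suc k) \<bullet> \<Phi> (Suc k)) \<le> S * (c * G n) + c * (C2 * S)"
      using c(1) by (simp add: mult_left_mono)
    then have "r (Suc n) \<le> 1 + \<Phi> 0 \<bullet> \<Phi> 0 + (S * (c * G n) + c * (C2 * S))"
      unfolding r_def sum.lessThan_Suc_shift by simp
    also have "1 + \<Phi> 0 \<bullet> \<Phi> 0 \<le> (1 + \<Phi> 0 \<bullet> \<Phi> 0) * S"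
      using mult_left_mono[OF S, of "1 + \<Phi> 0 \<bullet> \<Phi> 0"] scalar_prod_self_nonneg[of "\<Phi> 0"] by simp
    also have "(1 + \<Phi> 0 \<bullet> \<Phi> 0) * S + (S * (c * G n) + c * (C2 * S)) \<le> K1 * S * (1 + G n)"
    proof -
      have "0 \<le> (1 + \<Phi> 0 \<bullet> \<Phi> 0 + c * C2) * (S * G n) + c * S"
        using scalar_prod_self_nonneg[of "\<Phi> 0"] S G_nonneg[of n] c(1) C2(1)
        by (intro add_nonneg_nonneg mult_nonneg_nonneg) auto
      then show ?thesis unfolding K1_def by (simp add: algebra_simps)
    qed
    finally show ?thesis by (simp add: S_def)
  qed
  have ln_r: "ln (r (Suc n)) \<le> 2 * ln K3 + 6 * ln (real (Suc n))" if n: "n \<ge> 1" for n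
  proof -
    define S where "S = real (Suc n)"
    have S: "S \<ge> 1" by (simp add: S_def)
    define y where "y = r n powr (1/4)"
    have y: "y \<ge> 1" unfolding y_def using r_ge_1 by (intro ge_one_powr_ge_zero) auto
    have r1: "r n > 0" "r (Suc n) > 0" using r_ge_1[of n] r_ge_1[of "Suc n"] by linarith+
    have ln_y: "ln (r n) = 4 * ln y" using r1 by (simp add: y_def ln_powr)
    have L: "1 + ln (r n) \<le> 4 * y" using ln_le_minus_one[of y] y ln_y by simp
    have L0: "1 + ln (r n) \<ge> 1" using ln_r_nonneg by simp
    have E: "exp (B * (\<Sum>k<n. \<alpha> k * trace_drop k)) \<le> K2 * y"
    proof -
      have "B * (\<Sum>k<n. \<alpha> k * trace_drop k) \<le> B * C1 + ln y"
        using mult_left_mono[OF C1[of n], of B] B(1) ln_y by (simp add: distrib_left)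
      then have "exp (B * (\<Sum>k<n. \<alpha> k * trace_drop k)) \<le> exp (B * C1 + ln y)" by simp
      also have "\<dots> = K2 * y" using y by (simp add: K2_def exp_add)
      finally show ?thesis .
    qed
    have E1: "exp (B * (\<Sum>k<n. \<alpha> k * trace_drop k)) \<ge> 1"
      using B(1) by (simp add: sum_nonneg \<alpha>_nonneg trace_drop_nonneg)
    have S2: "1 \<le> S\<^sup>2 * (1 + ln (r n))"
      using mult_mono[of 1 "S\<^sup>2" 1 "1 + ln (r n)"] S L0 by simp
    have "1 + G n \<le> exp (B * (\<Sum>k<n. \<alpha> k * trace_drop k)) * (1 + G 1 + B * (real n)\<^sup>2 * (1 + ln (r n)))"
      using add_mono[OF E1 G_le[OF B n]] by (simp add: algebra_simps)
    also have "\<dots> \<le> (K2 * y) * ((1 + G 1 + B) * (S\<^sup>2 * (1 + ln (r n))))"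
    proof (intro mult_mono E)
      have "(1 + G 1) * 1 \<le> (1 + G 1) * (S\<^sup>2 * (1 + ln (r n)))"
        using S2 G_nonneg[of 1] by (intro mult_left_mono) auto
      moreover have "B * (real n)\<^sup>2 * (1 + ln (r n)) \<le> B * S\<^sup>2 * (1 + ln (r n))"
        using B(1) L0 by (intro mult_right_mono mult_left_mono power_mono) (auto simp: S_def)
      ultimately show "1 + G 1 + B * (real n)\<^sup>2 * (1 + ln (r n)) \<le> (1 + G 1 + B) * (S\<^sup>2 * (1 + ln (r n)))"
        by (simp add: algebra_simps)
    qed (use y G_nonneg[of 1] B(1) L0 in \<open>auto simp: K2_def\<close>)
    also have "\<dots> \<le> (K2 * y) * ((1 + G 1 + B) * (S\<^sup>2 * (4 * y)))"
      using L y G_nonneg[of 1] B(1) by (intro mult_left_mono) (auto simp: K2_def)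
    also have "\<dots> = K2 * (1 + G 1 + B) * 4 * S\<^sup>2 * y\<^sup>2" by (simp add: power2_eq_square)
    finally have G: "1 + G n \<le> K2 * (1 + G 1 + B) * 4 * S\<^sup>2 * y\<^sup>2" .
    have "r (Suc n) \<le> K1 * S * (1 + G n)" using r_Suc[OF n] by (simp add: S_def)
    also have "\<dots> \<le> K1 * S * (K2 * (1 + G 1 + B) * 4 * S\<^sup>2 * y\<^sup>2)"
      using K1 S by (intro mult_left_mono G) auto
    also have "\<dots> = K3 * S ^ 3 * y\<^sup>2" by (simp add: K3_def power2_eq_square power3_eq_cube)
    also have "y\<^sup>2 = sqrt (r n)"
      using r1 by (simp add: y_def powr_power powr_half_sqrt)
    also have "K3 * S ^ 3 * sqrt (r n) \<le> K3 * S ^ 3 * sqrt (r (Suc n))"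
      using K3 S r_mono[of n "Suc n"] by (intro mult_left_mono) auto
    finally have "sqrt (r (Suc n)) * sqrt (r (Suc n)) \<le> K3 * S ^ 3 * sqrt (r (Suc n))"
      using r1 by simp
    then have "sqrt (r (Suc n)) \<le> K3 * S ^ 3"
      using r1 by (subst (asm) mult_le_cancel_right) auto
    then have "ln (sqrt (r (Suc n))) \<le> ln (K3 * S ^ 3)"
      using r1 K3 S by (intro ln_mono) auto
    moreover have "ln (K3 * S ^ 3) = ln K3 + 3 * ln S"
      using K3 S by (simp add: ln_mult ln_realpow)
    moreover have "ln (sqrt (r (Suc n))) = ln (r (Suc n)) / 2" using r1 by (simp add: ln_sqrt)
    ultimately show ?thesis by (simp add: S_def)
  qed
  define C where "C = 7 + 2 * \<bar>ln K3\<bar> + ln (r 1)"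
  show ?thesis
  proof (intro exI[of _ C] conjI allI)
    show "C > 0" using ln_r_nonneg[of 1] by (simp add: C_def)
    fix n
    have l0: "ln (real (Suc n)) \<ge> 0" by simp
    show "1 + ln (r n) \<le> C * (1 + ln (real (Suc n)))"
    proof (cases "n \<ge> 2")
      case True
      then obtain m where m: "n = Suc m" "m \<ge> 1" by (cases n) auto
      have "ln (r n) \<le> 2 * ln K3 + 6 * ln (real n)" using ln_r[OF m(2)] m(1) by simp
      also have "ln (real n) \<le> ln (real (Suc n))" using True by (intro ln_mono) auto
      finally have "1 + ln (r n) \<le> (1 + 2 * \<bar>ln K3\<bar>) * 1 + 6 * ln (real (Suc n))" by simp
      also have "\<dots> \<le> C * 1 + C * ln (real (Suc n))"
        using l0 ln_r_nonneg[of 1] by (intro add_mono mult_right_mono) (auto simp: C_def)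
      finally show ?thesis by (simp add: distrib_left)
    next
      case False
      then have "r n \<le> r 1" by (intro r_mono) simp
      then have "ln (r n) \<le> ln (r 1)" using r_ge_1[of n] by (intro ln_mono) auto
      then have "1 + ln (r n) \<le> C * 1" by (simp add: C_def)
      also have "\<dots> \<le> C * (1 + ln (real (Suc n)))"
        using l0 ln_r_nonneg[of 1] by (intro mult_left_mono) (auto simp: C_def)
      finally show ?thesis .
    qed
  qed
qed

lemma log_bounds:
  "\<exists>C>0. \<forall>n. v n \<le> C * (1 + ln (real (Suc n))) \<and> (\<Sum>k<n. \<alpha> k) \<le> C * (1 + ln (real (Suc n)))
    \<and> (\<Sum>k<n. f k) \<le> C * (1 + ln (real (Suc n)))"
proof -
  obtain C1 where C1: "C1 > 0" "\<And>n. v n \<le> C1 * (1 + ln (r n))" "\<And>n. (\<Sum>k<n. \<alpha> k) \<le> C1 * (1 + ln (r n))"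
    using energy_le by blast
  obtain C2 where C2: "C2 > 0" "\<And>n. (\<Sum>k<n. f k) \<le> C2 * (1 + ln (r n))" using sum_f_le by blast
  obtain C3 where C3: "C3 > 0" "\<And>n. 1 + ln (r n) \<le> C3 * (1 + ln (real (Suc n)))" using ln_r_le by blast
  have le: "y \<le> (C1 + C2) * C3 * (1 + ln (real (Suc n)))" if "y \<le> D * (1 + ln (r n))" "0 \<le> D" "D \<le> C1 + C2" for y D n
  proof -
    note that(1)
    also have "D * (1 + ln (r n)) \<le> (C1 + C2) * (C3 * (1 + ln (real (Suc n))))"
      using that C3(2)[of n] ln_r_nonneg[of n] C1(1) C2(1) by (intro mult_mono) auto
    finally show ?thesis by (simp add: mult.assoc)
  qed
  have "v n \<le> (C1 + C2) * C3 * (1 + ln (real (Suc n))) \<and> (\<Sum>k<n. \<alpha> k) \<le> (C1 + C2) * C3 * (1 + ln (real (Suc n)))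
    \<and> (\<Sum>k<n. f k) \<le> (C1 + C2) * C3 * (1 + ln (real (Suc n)))" for n
    using le[OF C1(2)] le[OF C1(3)] le[OF C2(2)] C1(1) C2(1) by simp
  then show ?thesis using C1(1) C2(1) C3(1) by (intro exI[of _ "(C1 + C2) * C3"]) simp
qed

section \<open>Excitation of the regressors\<close>

text \<open>
  At these times the prediction error is not controlled by \<open>\<alpha>\<close>.
\<close>

definition bad :: "nat \<Rightarrow> bool" where "bad j \<longleftrightarrow> g j > 1"

text \<open>
  Each of these times contributes more than 1/2 to the sum of \<open>f\<close>.
\<close>

lemma sum_bad_le: "\<exists>C>0. \<forall>n. (\<Sum>j<n. of_bool (bad j)) \<le> C * (1 + ln (real (Suc n)))"
proof -
  obtain C where C: "C > 0" "\<And>n. (\<Sum>k<n. f k) \<le> C * (1 + ln (real (Suc n)))" using log_bounds by blast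
  have "(\<Sum>j<n. of_bool (bad j)) \<le> 2 * C * (1 + ln (real (Suc n)))" for n
  proof -
    have "(\<Sum>j<n. of_bool (bad j)) \<le> (\<Sum>j<n. 2 * f j)"
    proof (rule sum_mono)
      fix j
      show "of_bool (bad j) \<le> 2 * f j"
        using g_pos[of j] f_nonneg[of j] by (cases "bad j") (simp_all add: bad_def f_def field_simps)
    qed
    also have "\<dots> \<le> 2 * C * (1 + ln (real (Suc n)))" using C(2)[of n] by (simp add: sum_distrib_left[symmetric])
    finally show ?thesis .
  qed
  then show ?thesis using C(1) by (intro exI[of _ "2 * C"]) simp
qed

lemma \<pi>_le_if_not_bad: "\<not> bad j \<Longrightarrow> (\<pi> j)\<^sup>2 \<le> 2 * \<alpha> j"
proof -
  assume "\<not> bad j"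
  then have "\<alpha> j * (1 + g j) \<le> \<alpha> j * 2" using \<alpha>_nonneg[of j] by (intro mult_left_mono) (auto simp: bad_def)
  moreover have "(\<pi> j)\<^sup>2 = \<alpha> j * (1 + g j)" using g_pos[of j] by (simp add: \<alpha>_def)
  ultimately show ?thesis by linarith
qed

lemma noise_lag_sublinear: "sublinear (\<lambda>n. \<Sum>k<n. (if s < k then V (k - s) else 0) * V (Suc k))"
proof -
  obtain C where C: "\<And>n. (\<Sum>k<n. (V (Suc k))\<^sup>2) \<le> C * real (Suc n)" using sum_noise_le by blast
  have "(\<Sum>k<n. (if s < k then V (k - s) else 0)\<^sup>2) \<le> C * real (Suc n)" for n
  proof -
    have "(\<Sum>k<n. (if s < k then V (k - s) else 0)\<^sup>2) = (\<Sum>k\<in>{Suc s..<n}. (V (k - s))\<^sup>2)"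
      by (rule sum.mono_neutral_cong_right) auto
    also have "\<dots> = (\<Sum>j<n - Suc s. (V (Suc j))\<^sup>2)"
      by (rule sum.reindex_bij_witness[of _ "\<lambda>j. Suc (j + s)" "\<lambda>k. k - Suc s"]) (auto simp: Suc_diff_Suc)
    also have "\<dots> \<le> (\<Sum>j<n. (V (Suc j))\<^sup>2)" by (intro sum_mono2) auto
    finally show ?thesis using C[of n] by linarith
  qed
  then show ?thesis by (rule sublinear_if_weighted_bound[OF noise_lag])
qed

lemma eps_lag_sublinear: "sublinear (\<lambda>n. \<Sum>k<n. (if s \<le> k then \<epsilon> (k - s) else 0) * V (Suc k))"
proof -
  obtain C where C: "\<And>n. (\<Sum>k\<le>n. (\<epsilon> k)\<^sup>2) \<le> C * real (Suc n)" using sum_eps_le by blast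
  have "(\<Sum>k<n. (if s \<le> k then \<epsilon> (k - s) else 0)\<^sup>2) \<le> C * real (Suc n)" for n
  proof -
    have "(\<Sum>k<n. (if s \<le> k then \<epsilon> (k - s) else 0)\<^sup>2) = (\<Sum>k\<in>{s..<n}. (\<epsilon> (k - s))\<^sup>2)"
      by (rule sum.mono_neutral_cong_right) auto
    also have "\<dots> = (\<Sum>j<n - s. (\<epsilon> j)\<^sup>2)"
      by (rule sum.reindex_bij_witness[of _ "\<lambda>j. j + s" "\<lambda>k. k - s"]) auto
    also have "\<dots> \<le> (\<Sum>j\<le>n. (\<epsilon> j)\<^sup>2)" by (intro sum_mono2) auto
    finally show ?thesis using C[of n] by linarith
  qed
  then show ?thesis by (rule sublinear_if_weighted_bound[OF eps_lag])
qed

text \<open>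
  The vector of \<open>V\<close> at the times \<open>m + p + 2, \<dots>, m + 2\<close> and of \<open>\<epsilon>\<close> at time \<open>m + 1\<close>, which drives the
  regressor at time \<open>m + p + 2\<close>. The offset makes the tracking identity available for all lagged states.
\<close>

definition Z :: "nat \<Rightarrow> nat \<Rightarrow> real"
  where "Z m i = (if i \<le> p then V (m + p + 2 - i) else \<epsilon> (m + 1))"

text \<open>
  In a product of two components, the later one is a noise variable and the earlier one is a predictable weight.
\<close>

lemma Z_orthogonal:
  assumes "i < d" "j < d" "i \<noteq> j"
  shows "sublinear (\<lambda>n. \<Sum>m<n. Z m i * Z m j)"
proof -
  have lt: "sublinear (\<lambda>n. \<Sum>m<n. Z m j * Z m i)" if "i < j" "j < d" for i j
  proof (cases "j \<le> p")
    case True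
    have "sublinear (\<lambda>n. \<Sum>m<n. (\<lambda>k. (if j - i - 1 < k then V (k - (j - i - 1)) else 0) * V (Suc k)) (m + (p + 1 - i)))"
      by (rule sublinear_sum_shift[OF noise_lag_sublinear])
    moreover have "(\<lambda>k. (if j - i - 1 < k then V (k - (j - i - 1)) else 0) * V (Suc k)) (m + (p + 1 - i)) = Z m j * Z m i" for m
    proof -
      have "j - i - 1 < m + (p + 1 - i)" "m + (p + 1 - i) - (j - i - 1) = m + p + 2 - j" "Suc (m + (p + 1 - i)) = m + p + 2 - i"
        using that True by auto
      then show ?thesis using that True by (simp add: Z_def)
    qed
    ultimately show ?thesis by simp
  next
    case False
    then have j: "j = p + 1" "i \<le> p" using that d_eq by auto
    have "sublinear (\<lambda>n. \<Sum>m<n. (\<lambda>k. (if p - i \<le> k then \<epsilon> (k - (p - i)) else 0) * V (Suc k)) (m + (p + 1 - i)))"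
      by (rule sublinear_sum_shift[OF eps_lag_sublinear])
    moreover have "(\<lambda>k. (if p - i \<le> k then \<epsilon> (k - (p - i)) else 0) * V (Suc k)) (m + (p + 1 - i)) = Z m j * Z m i" for m
    proof -
      have "p - i \<le> m + (p + 1 - i)" "m + (p + 1 - i) - (p - i) = m + 1" "Suc (m + (p + 1 - i)) = m + p + 2 - i"
        using j by auto
      then show ?thesis using j by (simp add: Z_def)
    qed
    ultimately show ?thesis by simp
  qed
  show ?thesis
  proof (cases "i < j")
    case True
    then show ?thesis using lt[OF True assms(2)] by (simp add: mult.commute)
  next
    case False
    then show ?thesis using lt[of j i] assms by simp
  qed
qed

text \<open>
  The coloured noise has at least the variance of the noise that enters it at the same time.
\<close>

lemma Z_diagonal:
  assumes "i < d"
  shows "eventually (\<lambda>n. (\<Sum>m<n. (Z m i)\<^sup>2) \<ge> sigma_sq / 2 * real n) sequentially"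
proof (cases "i \<le> p")
  case True
  have "sublinear (\<lambda>n. \<Sum>m<n. (\<lambda>k. (V (Suc k))\<^sup>2 - sigma_sq) (m + (p + 1 - i)))"
    by (rule sublinear_sum_shift[OF noise_variance])
  moreover have "(\<lambda>k. (V (Suc k))\<^sup>2 - sigma_sq) (m + (p + 1 - i)) = (Z m i)\<^sup>2 - sigma_sq" for m
  proof -
    have "Suc (m + (p + 1 - i)) = m + p + 2 - i" using True by auto
    then show ?thesis using True by (simp add: Z_def)
  qed
  ultimately have "sublinear (\<lambda>n. \<Sum>m<n. (Z m i)\<^sup>2 - sigma_sq)" by simp
  then have "eventually (\<lambda>n. \<bar>\<Sum>m<n. (Z m i)\<^sup>2 - sigma_sq\<bar> \<le> sigma_sq / 2 * real n) sequentially"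
    by (rule sublinear_eventually) (use sigma_pos in simp)
  then show ?thesis
  proof eventually_elim
    case (elim n)
    from abs_le_D2[OF elim] show ?case by (simp add: sum_subtractf algebra_simps)
  qed
next
  case False
  have "sublinear (\<lambda>n. \<Sum>k<n. \<epsilon> k * V (Suc k))" using eps_lag_sublinear[of 0] by simp
  then have "eventually (\<lambda>n. \<bar>\<Sum>k<n. \<epsilon> k * V (Suc k)\<bar> \<le> sigma_sq / 8 * real n) sequentially"
    by (rule sublinear_eventually) (use sigma_pos in simp)
  moreover have "eventually (\<lambda>n. \<bar>\<Sum>m<n. (V (Suc m))\<^sup>2 - sigma_sq\<bar> \<le> sigma_sq / 4 * real n) sequentially"
    by (rule sublinear_eventually[OF noise_variance]) (use sigma_pos in simp)
  ultimately show ?thesis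
  proof eventually_elim
    case (elim n)
    have "(\<Sum>m<n. (V (Suc m))\<^sup>2 + 2 * \<rho> * (\<epsilon> m * V (Suc m))) \<le> (\<Sum>m<n. (Z m i)\<^sup>2)"
      by (rule sum_mono) (use False in \<open>simp add: Z_def eps_eq power2_sum power_mult_distrib\<close>)
    moreover have "(\<Sum>m<n. (V (Suc m))\<^sup>2 + 2 * \<rho> * (\<epsilon> m * V (Suc m)))
        = (\<Sum>m<n. (V (Suc m))\<^sup>2) + 2 * \<rho> * (\<Sum>m<n. \<epsilon> m * V (Suc m))"
      by (simp add: sum.distrib sum_distrib_left)
    moreover have "\<bar>\<rho> * (\<Sum>m<n. \<epsilon> m * V (Suc m))\<bar> \<le> 1 * (sigma_sq / 8 * real n)"
      unfolding abs_mult using rho elim(1) by (intro mult_mono) auto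
    moreover have "(\<Sum>m<n. (V (Suc m))\<^sup>2) \<ge> sigma_sq * real n - sigma_sq / 4 * real n"
      using abs_le_D2[OF elim(2)] by (simp add: sum_subtractf algebra_simps)
    ultimately show ?case by (simp add: abs_le_iff)
  qed
qed

text \<open>
  The coefficients of the lagged states when \<open>U\<close> is eliminated from the linear form with coefficients \<open>w\<close>,
  and below those of the noise vector \<open>Z\<close> when the states are replaced by noise variables as well.
\<close>

definition state_coeff :: "(nat \<Rightarrow> real) \<Rightarrow> nat \<Rightarrow> real"
  where "state_coeff w i = (if i = 0 then w 0 + w (p + 1) else w i - w (p + 1) * \<theta> $ (i - 1))"

definition noise_coeff :: "(nat \<Rightarrow> real) \<Rightarrow> nat \<Rightarrow> real"
  where "noise_coeff w i = (if i \<le> p then state_coeff w i - w (p + 1) * \<rho> ^ i else - (w (p + 1) * \<rho> ^ (p + 1)))"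

text \<open>
  The difference between a lagged state and the noise variable of the same time.
\<close>

definition discrepancy :: "nat \<Rightarrow> nat \<Rightarrow> real"
  where "discrepancy m i = x (m + p + 2 - i) - \<pi> (m + p + 1 - i)"

lemma eps_expand: "\<epsilon> (n + j) = (\<Sum>i<j. \<rho> ^ i * V (n + j - i)) + \<rho> ^ j * \<epsilon> n"
proof (induction j)
  case (Suc j)
  have "\<epsilon> (n + Suc j) = V (n + Suc j) + \<rho> * \<epsilon> (n + j)" using eps_eq[of "n + j"] by simp
  also have "\<dots> = V (n + Suc j) + (\<Sum>i<j. \<rho> ^ Suc i * V (n + Suc j - Suc i)) + \<rho> ^ Suc j * \<epsilon> n"
    unfolding Suc by (simp add: distrib_left sum_distrib_left mult.assoc)
  also have "V (n + Suc j) + (\<Sum>i<j. \<rho> ^ Suc i * V (n + Suc j - Suc i)) = (\<Sum>i<Suc j. \<rho> ^ i * V (n + Suc j - i))"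
    unfolding sum.lessThan_Suc_shift by simp
  finally show ?case .
qed simp

lemma regressor_decomposition:
  "(\<Sum>i<d. w i * \<Phi> (m + p + 2) $ i)
    = (\<Sum>i<d. noise_coeff w i * Z m i) + (\<Sum>i\<le>p. state_coeff w i * discrepancy m i)"
proof -
  define k where "k = m + p + 2"
  define wd where "wd = w (p + 1)"
  have d: "{..<d} = {..<Suc (Suc p)}" by (simp add: d_eq)
  have Xk: "X (int k - int i) = V (m + p + 2 - i) + discrepancy m i" if "i \<le> p" for i
  proof -
    define j where "j = m + p + 1 - i"
    have j: "int j + 1 = int k - int i" "m + p + 2 - i = Suc j" "j \<ge> 1"
      using that by (auto simp: j_def k_def of_nat_diff)
    show ?thesis
      unfolding discrepancy_def j(1)[symmetric] j(2) j_def[symmetric] tracking[OF j(3)] by simp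
  qed
  have U: "U (int k - 1) = X (int k) - (\<Sum>j<p. \<theta> $ j * X (int k - 1 - int j)) - \<epsilon> k"
    by (rule U_eq) (simp add: k_def)
  have "(\<Sum>i<d. w i * \<Phi> k $ i) = (\<Sum>i\<le>p. w i * X (int k - int i)) + wd * U (int k - 1)"
    unfolding d sum.lessThan_Suc[of _ "Suc p"] lessThan_Suc_atMost
    using \<Phi>_U[of k] by (simp add: \<Phi>_X wd_def)
  also have "\<dots> = (\<Sum>i\<le>p. state_coeff w i * X (int k - int i)) - wd * \<epsilon> k"
  proof -
    have "(\<Sum>i\<le>p. state_coeff w i * X (int k - int i))
        = (w 0 + wd) * X (int k) + (\<Sum>j<p. (w (Suc j) - wd * \<theta> $ j) * X (int k - 1 - int j))"
      unfolding lessThan_Suc_atMost[symmetric] sum.lessThan_Suc_shift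
      by (simp add: state_coeff_def wd_def algebra_simps)
    moreover have "(\<Sum>i\<le>p. w i * X (int k - int i)) = w 0 * X (int k) + (\<Sum>j<p. w (Suc j) * X (int k - 1 - int j))"
      unfolding lessThan_Suc_atMost[symmetric] sum.lessThan_Suc_shift by (simp add: algebra_simps)
    ultimately show ?thesis unfolding U
      by (simp add: left_diff_distrib sum_subtractf right_diff_distrib sum_distrib_left distrib_right mult.assoc)
  qed
  also have "\<epsilon> k = (\<Sum>i\<le>p. \<rho> ^ i * V (m + p + 2 - i)) + \<rho> ^ (p + 1) * \<epsilon> (m + 1)"
    using eps_expand[of "m + 1" "p + 1"] by (simp add: k_def lessThan_Suc_atMost)
  also have "(\<Sum>i\<le>p. state_coeff w i * X (int k - int i))
      = (\<Sum>i\<le>p. state_coeff w i * V (m + p + 2 - i)) + (\<Sum>i\<le>p. state_coeff w i * discrepancy m i)"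
    unfolding sum.distrib[symmetric] by (intro sum.cong refl) (simp add: Xk distrib_left)
  finally have "(\<Sum>i<d. w i * \<Phi> k $ i) = (\<Sum>i\<le>p. state_coeff w i * V (m + p + 2 - i))
      - wd * ((\<Sum>i\<le>p. \<rho> ^ i * V (m + p + 2 - i)) + \<rho> ^ (p + 1) * \<epsilon> (m + 1))
      + (\<Sum>i\<le>p. state_coeff w i * discrepancy m i)" by simp
  moreover have "(\<Sum>i<d. noise_coeff w i * Z m i) = (\<Sum>i\<le>p. (state_coeff w i - wd * \<rho> ^ i) * V (m + p + 2 - i)) - wd * \<rho> ^ (p + 1) * \<epsilon> (m + 1)"
    unfolding d sum.lessThan_Suc[of _ "Suc p"] lessThan_Suc_atMost
    by (simp add: noise_coeff_def Z_def wd_def)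
  ultimately show ?thesis unfolding k_def
    by (simp add: left_diff_distrib sum_subtractf right_diff_distrib sum_distrib_left distrib_left mult.assoc)
qed

lemma theta_le: "i < p \<Longrightarrow> \<bar>\<theta> $ i\<bar> \<le> (\<Sum>k<p. \<bar>\<theta> $ k\<bar>)"
  by (rule member_le_sum) auto

lemma state_coeff_le: "\<exists>c>0. \<forall>w. (\<Sum>i\<le>p. (state_coeff w i)\<^sup>2) \<le> c * (\<Sum>i<d. (w i)\<^sup>2)"
proof -
  define t where "t = 1 + (\<Sum>k<p. \<bar>\<theta> $ k\<bar>)"
  have t: "t \<ge> 1" by (simp add: t_def sum_nonneg)
  define c where "c = 2 + 2 * real (p + 1) * t\<^sup>2"
  have "(\<Sum>i\<le>p. (state_coeff w i)\<^sup>2) \<le> c * (\<Sum>i<d. (w i)\<^sup>2)" for w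
  proof -
    have d: "{..<d} = {..<Suc (Suc p)}" by (simp add: d_eq)
    have le: "(state_coeff w i)\<^sup>2 \<le> 2 * (w i)\<^sup>2 + 2 * (t\<^sup>2 * (w (p + 1))\<^sup>2)" if "i \<le> p" for i
    proof -
      define s where "s = (if i = 0 then 1 else - \<theta> $ (i - 1))"
      have "\<bar>s\<bar> \<le> t"
      proof (cases i)
        case 0
        then show ?thesis using t by (simp add: s_def)
      next
        case (Suc j)
        then show ?thesis using theta_le[of j] that by (simp add: s_def t_def)
      qed
      then have "\<bar>s\<bar>\<^sup>2 \<le> t\<^sup>2" by (intro power_mono) auto
      then have s2: "s\<^sup>2 * (w (p + 1))\<^sup>2 \<le> t\<^sup>2 * (w (p + 1))\<^sup>2" by (intro mult_right_mono) auto
      have "state_coeff w i = w i + s * w (p + 1)" by (simp add: state_coeff_def s_def)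
      then show ?thesis using square_add_le[of "w i" "s * w (p + 1)"] s2 by (simp add: power_mult_distrib)
    qed
    have "(\<Sum>i\<le>p. (state_coeff w i)\<^sup>2) \<le> (\<Sum>i\<le>p. 2 * (w i)\<^sup>2 + 2 * (t\<^sup>2 * (w (p + 1))\<^sup>2))"
      by (intro sum_mono le) simp
    also have "\<dots> = 2 * (\<Sum>i\<le>p. (w i)\<^sup>2) + 2 * real (p + 1) * t\<^sup>2 * (w (p + 1))\<^sup>2"
      by (simp add: sum.distrib sum_distrib_left)
    also have "\<dots> \<le> 2 * (\<Sum>i<d. (w i)\<^sup>2) + 2 * real (p + 1) * t\<^sup>2 * (\<Sum>i<d. (w i)\<^sup>2)"
      unfolding d by (intro add_mono mult_left_mono) (auto simp: lessThan_Suc_atMost sum_nonneg)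
    finally show ?thesis by (simp add: c_def distrib_right)
  qed
  moreover have "c > 0" by (simp add: c_def add_pos_nonneg)
  ultimately show ?thesis by blast
qed

text \<open>
  The coefficients \<open>w\<close> can be recovered from those of the noise vector: first \<open>w (p + 1)\<close>, dividing by a
  power of \<open>\<rho>\<close>, and then the others.
\<close>

lemma noise_coeff_ge: "\<exists>c>0. \<forall>w. (\<Sum>i<d. (w i)\<^sup>2) \<le> c * (\<Sum>i<d. (noise_coeff w i)\<^sup>2)"
proof -
  define t where "t = 1 + (\<Sum>k<p. \<bar>\<theta> $ k\<bar>)"
  have t: "t \<ge> 1" by (simp add: t_def sum_nonneg)
  \<comment> \<open>The noise coefficient of index \<open>p + 1\<close> is \<open>- w (p + 1) * \<rho> ^ (p + 1)\<close>.\<close>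
  define T where "T = (1 + t) / \<bar>\<rho>\<bar> ^ (p + 1)"
  define c where "c = 2 + 2 * real d * T\<^sup>2"
  have "(\<Sum>i<d. (w i)\<^sup>2) \<le> c * (\<Sum>i<d. (noise_coeff w i)\<^sup>2)" for w
  proof -
    define b where "b = noise_coeff w"
    have w_last: "\<bar>w (p + 1)\<bar> * (1 + t) = T * \<bar>b (p + 1)\<bar>"
      using rho_nz by (simp add: b_def noise_coeff_def T_def abs_mult power_abs)
    have le: "(w i)\<^sup>2 \<le> 2 * (b i)\<^sup>2 + 2 * (T\<^sup>2 * (b (p + 1))\<^sup>2)" if "i < d" for i
    proof -
      obtain s where s: "w i = (if i \<le> p then b i else 0) + s * w (p + 1)" "\<bar>s\<bar> \<le> 1 + t"
      proof (cases "i \<le> p")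
        case True
        have pow: "\<bar>\<rho> ^ i\<bar> \<le> 1" using rho by (simp add: power_abs power_le_one)
        have "\<bar>\<rho> ^ i + (if i = 0 then -1 else \<theta> $ (i - 1))\<bar> \<le> 1 + t"
        proof (cases i)
          case 0
          then show ?thesis using t by simp
        next
          case (Suc j)
          then have "\<bar>\<theta> $ j\<bar> \<le> t" using theta_le[of j] True by (simp add: t_def)
          then show ?thesis using pow Suc abs_triangle_ineq[of "\<rho> ^ i" "\<theta> $ j"] by simp
        qed
        then show ?thesis
          using that[of "\<rho> ^ i + (if i = 0 then -1 else \<theta> $ (i - 1))"] True
          by (simp add: b_def noise_coeff_def state_coeff_def algebra_simps)
      next
        case False
        then have "i = p + 1" using \<open>i < d\<close> d_eq by simp
        then show ?thesis using that[of 1] t by simp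
      qed
      have "\<bar>s * w (p + 1)\<bar> \<le> T * \<bar>b (p + 1)\<bar>"
        using mult_right_mono[OF s(2), of "\<bar>w (p + 1)\<bar>"] w_last by (simp add: abs_mult mult.commute)
      then have "\<bar>s * w (p + 1)\<bar>\<^sup>2 \<le> (T * \<bar>b (p + 1)\<bar>)\<^sup>2" by (intro power_mono) auto
      then have s2: "(s * w (p + 1))\<^sup>2 \<le> T\<^sup>2 * (b (p + 1))\<^sup>2" by (simp add: power_mult_distrib)
      have "(if i \<le> p then b i else 0)\<^sup>2 \<le> (b i)\<^sup>2" by simp
      then show ?thesis
        using square_add_le[of "if i \<le> p then b i else 0" "s * w (p + 1)"] s2 unfolding s(1)[symmetric] by linarith
    qed
    have "(\<Sum>i<d. (w i)\<^sup>2) \<le> (\<Sum>i<d. 2 * (b i)\<^sup>2 + 2 * (T\<^sup>2 * (b (p + 1))\<^sup>2))"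
      by (intro sum_mono le) simp
    also have "\<dots> = 2 * (\<Sum>i<d. (b i)\<^sup>2) + 2 * real d * T\<^sup>2 * (b (p + 1))\<^sup>2"
      by (simp add: sum.distrib sum_distrib_left)
    also have "(b (p + 1))\<^sup>2 \<le> (\<Sum>i<d. (b i)\<^sup>2)"
      by (rule member_le_sum) (auto simp: d_eq)
    finally show ?thesis by (simp add: c_def b_def distrib_right mult_left_mono)
  qed
  moreover have "c > 0" by (simp add: c_def add_pos_nonneg)
  ultimately show ?thesis by blast
qed

text \<open>
  Some prediction error that enters the regressor at time \<open>m + p + 2\<close> may be large.
\<close>

definition disturbed :: "nat \<Rightarrow> bool"
  where "disturbed m \<longleftrightarrow> (\<exists>i\<le>p. bad (m + p + 1 - i))"

lemma undisturbed_discrepancy_sublinear: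
  "sublinear (\<lambda>n. \<Sum>m<n. if disturbed m then 0 else (\<Sum>i\<le>p. (discrepancy m i)\<^sup>2))"
proof -
  obtain C where C: "C > 0" "\<And>n. (\<Sum>k<n. \<alpha> k) \<le> C * (1 + ln (real (Suc n)))" using log_bounds by blast
  define a where "a = p + 2"
  define S where "S n = (\<Sum>k=1..n + a. (x k)\<^sup>2) + C * (1 + ln (real (Suc (n + a))))" for n
  have "sublinear (\<lambda>n. (\<Sum>k=1..n + a. (x k)\<^sup>2) - 0)"
    by (rule sublinear_shift[OF reference])
  moreover have "sublinear (\<lambda>n. C * (1 + ln (real (Suc (n + a)))))"
    by (rule sublinear_le[OF sublinear_log[of a], of _ C]) (simp add: C(1) abs_mult less_imp_le)
  ultimately have "sublinear S" unfolding S_def using sublinear_add by simp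
  moreover have "\<bar>\<Sum>m<n. if disturbed m then 0 else (\<Sum>i\<le>p. (discrepancy m i)\<^sup>2)\<bar> \<le> (4 * real (p + 1)) * S n" for n
  proof -
    have nn: "0 \<le> (\<Sum>m<n. if disturbed m then 0 else (\<Sum>i\<le>p. (discrepancy m i)\<^sup>2))"
      by (intro sum_nonneg) (simp add: sum_nonneg)
    have "(\<Sum>m<n. if disturbed m then 0 else (\<Sum>i\<le>p. (discrepancy m i)\<^sup>2))
        \<le> (\<Sum>m<n. \<Sum>i\<le>p. 2 * (x (Suc (m + (p + 1 - i))))\<^sup>2 + 4 * \<alpha> (m + (p + 1 - i)))"
    proof (rule sum_mono)
      fix m
      have le: "(discrepancy m i)\<^sup>2 \<le> 2 * (x (Suc (m + (p + 1 - i))))\<^sup>2 + 4 * \<alpha> (m + (p + 1 - i))"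
        if "\<not> disturbed m" "i \<le> p" for i
      proof -
        have eq: "m + p + 2 - i = Suc (m + (p + 1 - i))" "m + p + 1 - i = m + (p + 1 - i)" using that(2) by auto
        have "\<not> bad (m + (p + 1 - i))" using that by (auto simp: disturbed_def eq(2)[symmetric])
        from \<pi>_le_if_not_bad[OF this] show ?thesis
          using square_add_le[of "x (Suc (m + (p + 1 - i)))" "- \<pi> (m + (p + 1 - i))"]
          unfolding discrepancy_def eq by simp
      qed
      have "0 \<le> (\<Sum>i\<le>p. 2 * (x (Suc (m + (p + 1 - i))))\<^sup>2 + 4 * \<alpha> (m + (p + 1 - i)))"
        by (intro sum_nonneg add_nonneg_nonneg) (simp_all add: \<alpha>_nonneg)
      moreover have "\<not> disturbed m \<Longrightarrow> (\<Sum>i\<le>p. (discrepancy m i)\<^sup>2) \<le> (\<Sum>i\<le>p. 2 * (x (Suc (m + (p + 1 - i))))\<^sup>2 + 4 * \<alpha> (m + (p + 1 - i)))"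
        by (intro sum_mono le) auto
      ultimately show "(if disturbed m then 0 else (\<Sum>i\<le>p. (discrepancy m i)\<^sup>2))
        \<le> (\<Sum>i\<le>p. 2 * (x (Suc (m + (p + 1 - i))))\<^sup>2 + 4 * \<alpha> (m + (p + 1 - i)))" by simp
    qed
    also have "\<dots> = (\<Sum>i\<le>p. \<Sum>m<n. 2 * (x (Suc (m + (p + 1 - i))))\<^sup>2 + 4 * \<alpha> (m + (p + 1 - i)))"
      by (rule sum.swap)
    also have "\<dots> \<le> (\<Sum>i\<le>p. 4 * S n)"
    proof (rule sum_mono)
      fix i
      have ai: "p + 1 - i \<le> a" by (simp add: a_def)
      have x: "(\<Sum>m<n. (x (Suc (m + (p + 1 - i))))\<^sup>2) \<le> (\<Sum>k=1..n + a. (x k)\<^sup>2)"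
        using sum_shift_le[of "\<lambda>k. (x (Suc k))\<^sup>2", OF _ ai, of n] by (simp add: sum.atLeast1_atMost_eq)
      have al: "(\<Sum>m<n. \<alpha> (m + (p + 1 - i))) \<le> C * (1 + ln (real (Suc (n + a))))"
        by (rule order_trans[OF sum_shift_le[OF \<alpha>_nonneg ai] C(2)])
      have "0 \<le> (\<Sum>k=1..n + a. (x k)\<^sup>2)" by (simp add: sum_nonneg)
      then show "(\<Sum>m<n. 2 * (x (Suc (m + (p + 1 - i))))\<^sup>2 + 4 * \<alpha> (m + (p + 1 - i))) \<le> 4 * S n"
        using x al unfolding S_def sum.distrib sum_distrib_left[symmetric] distrib_left by linarith
    qed
    also have "\<dots> = (4 * real (p + 1)) * S n" by simp
    finally show ?thesis using nn by simp
  qed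
  ultimately show ?thesis by (rule sublinear_le)
qed

text \<open>
  There are \<open>O(ln n)\<close> disturbed times up to \<open>n\<close>, each contributing \<open>O(n powr \<delta>)\<close>.
\<close>

lemma disturbed_noise_sublinear:
  "sublinear (\<lambda>n. \<Sum>m<n. if disturbed m then (\<Sum>i<d. (Z m i)\<^sup>2) else 0)"
proof -
  obtain C where C: "C > 0" "\<And>n. (\<Sum>j<n. of_bool (bad j)) \<le> C * (1 + ln (real (Suc n)))" using sum_bad_le by blast
  obtain D1 where D1: "\<And>k. (V (Suc k))\<^sup>2 \<le> D1 * real (Suc k) powr \<delta>" using noise_growth by blast
  obtain D2 where D2: "\<And>n. (\<epsilon> n)\<^sup>2 \<le> D2 * real (Suc n) powr \<delta>" using eps_growth by blast
  define D where "D = \<bar>D1\<bar> + \<bar>D2\<bar>"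
  define a where "a = p + 2"
  define y where "y n = (real (n + a) + 1) powr \<delta>" for n
  have Z_le: "(Z m i)\<^sup>2 \<le> D * y n" if "m < n" for m n i
  proof -
    have mono: "K * real (Suc k) powr \<delta> \<le> D * y n" if "k \<le> n + a" "\<bar>K\<bar> \<le> D" for k K
    proof -
      have "K * real (Suc k) powr \<delta> \<le> D * real (Suc k) powr \<delta>" using that(2) by (intro mult_right_mono) auto
      also have "\<dots> \<le> D * y n"
        using that \<delta>_pos unfolding y_def by (intro mult_left_mono powr_mono2) auto
      finally show ?thesis .
    qed
    show ?thesis
    proof (cases "i \<le> p")
      case True
      have eq: "m + p + 2 - i = Suc (m + p + 1 - i)" using True by simp
      have "(V (Suc (m + p + 1 - i)))\<^sup>2 \<le> D * y n"
        by (rule order_trans[OF D1 mono]) (use that in \<open>auto simp: a_def D_def\<close>)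
      then show ?thesis using True unfolding Z_def eq by simp
    next
      case False
      have "(\<epsilon> (m + 1))\<^sup>2 \<le> D * y n"
        by (rule order_trans[OF D2 mono]) (use that in \<open>auto simp: a_def D_def\<close>)
      then show ?thesis using False unfolding Z_def by simp
    qed
  qed
  have D0: "D \<ge> 0" "y n \<ge> 0" for n by (simp_all add: D_def y_def)
  have count: "(\<Sum>m<n. of_bool (disturbed m)) \<le> real (p + 1) * (C * (1 + ln (real (Suc (n + a)))))" for n
  proof -
    have "(\<Sum>m<n. of_bool (disturbed m)) \<le> (\<Sum>m<n. \<Sum>i\<le>p. of_bool (bad (m + (p + 1 - i))) :: real)"
    proof (rule sum_mono)
      fix m
      show "of_bool (disturbed m) \<le> (\<Sum>i\<le>p. of_bool (bad (m + (p + 1 - i))) :: real)"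
      proof (cases "disturbed m")
        case True
        then obtain i where i: "i \<le> p" "bad (m + p + 1 - i)" by (auto simp: disturbed_def)
        then have "bad (m + (p + 1 - i))" by (simp add: Nat.diff_add_assoc)
        then have "1 = (of_bool (bad (m + (p + 1 - i))) :: real)" by simp
        also have "\<dots> \<le> (\<Sum>i\<le>p. of_bool (bad (m + (p + 1 - i))))"
          using i(1) by (intro member_le_sum[of i "{..p}" "\<lambda>i. of_bool (bad (m + (p + 1 - i)))"]) auto
        finally show ?thesis using True by simp
      qed (simp add: sum_nonneg)
    qed
    also have "\<dots> = (\<Sum>i\<le>p. \<Sum>m<n. of_bool (bad (m + (p + 1 - i))))" by (rule sum.swap)
    also have "\<dots> \<le> (\<Sum>i\<le>p. C * (1 + ln (real (Suc (n + a)))))"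
    proof (rule sum_mono)
      fix i
      show "(\<Sum>m<n. of_bool (bad (m + (p + 1 - i)))) \<le> C * (1 + ln (real (Suc (n + a))))"
      proof (rule order_trans[OF sum_shift_le C(2)])
        show "p + 1 - i \<le> a" by (simp add: a_def)
      qed simp
    qed
    finally show ?thesis by simp
  qed
  have "\<bar>\<Sum>m<n. if disturbed m then (\<Sum>i<d. (Z m i)\<^sup>2) else 0\<bar>
      \<le> (real d * D * real (p + 1) * C) * ((1 + ln (real (n + a) + 1)) * (real (n + a) + 1) powr \<delta>)" for n
  proof -
    have nn: "0 \<le> (\<Sum>m<n. if disturbed m then (\<Sum>i<d. (Z m i)\<^sup>2) else 0)"
      by (intro sum_nonneg) (simp add: sum_nonneg)
    have "(\<Sum>m<n. if disturbed m then (\<Sum>i<d. (Z m i)\<^sup>2) else 0) \<le> (\<Sum>m<n. of_bool (disturbed m) * (real d * (D * y n)))"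
    proof (rule sum_mono)
      fix m assume "m \<in> {..<n}"
      then have "(\<Sum>i<d. (Z m i)\<^sup>2) \<le> (\<Sum>i<d. D * y n)" by (intro sum_mono Z_le) simp
      then show "(if disturbed m then (\<Sum>i<d. (Z m i)\<^sup>2) else 0) \<le> of_bool (disturbed m) * (real d * (D * y n))" by simp
    qed
    also have "\<dots> = (\<Sum>m<n. of_bool (disturbed m)) * (real d * (D * y n))" by (rule sum_distrib_right[symmetric])
    also have "\<dots> \<le> (real (p + 1) * (C * (1 + ln (real (Suc (n + a)))))) * (real d * (D * y n))"
      using D0 by (intro mult_right_mono count) auto
    finally show ?thesis using nn by (simp add: y_def algebra_simps)
  qed
  then show ?thesis by (rule sublinear_le[OF sublinear_ln_powr[OF \<delta>_lt]])
qed

text \<open>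
  At undisturbed times the linear form \<open>u + h\<close>, with noise part \<open>u\<close> and discrepancy \<open>h\<close>, satisfies
  \<open>(u + h)\<^sup>2 \<ge> u\<^sup>2 / 2 - h\<^sup>2\<close>; at disturbed times its square is only known to be nonnegative. The losses
  are sublinear in \<open>n\<close>, uniformly in \<open>w\<close>.
\<close>

lemma excitation:
  "\<exists>c>0. eventually (\<lambda>n. \<forall>w. (\<Sum>k<n. (\<Sum>i<d. w i * \<Phi> k $ i)\<^sup>2) \<ge> c * real n * (\<Sum>i<d. (w i)\<^sup>2)) sequentially"
proof -
  obtain c1 where c1: "c1 > 0" "\<And>w. (\<Sum>i<d. (w i)\<^sup>2) \<le> c1 * (\<Sum>i<d. (noise_coeff w i)\<^sup>2)" using noise_coeff_ge by blast
  obtain c2 where c2: "c2 > 0" "\<And>w. (\<Sum>i\<le>p. (state_coeff w i)\<^sup>2) \<le> c2 * (\<Sum>i<d. (w i)\<^sup>2)" using state_coeff_le by blast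
  define K where "K n = (\<Sum>m<n. if disturbed m then 0 else (\<Sum>i\<le>p. (discrepancy m i)\<^sup>2))" for n
  define E where "E n = (\<Sum>m<n. if disturbed m then (\<Sum>i<d. (Z m i)\<^sup>2) else 0)" for n
  \<comment> \<open>The sum of squares of the noise part has the constant \<open>sigma_sq / 4 = 8 * \<tau>\<close>, of which half is used and the errors cost a part.\<close>
  define \<tau> where "\<tau> = sigma_sq / 32"
  have \<tau>: "\<tau> > 0" using sigma_pos by (simp add: \<tau>_def)
  have "eventually (\<lambda>n. \<forall>b. (\<Sum>m<n. (\<Sum>i<d. b i * Z m i)\<^sup>2) \<ge> (sigma_sq / 2) / 2 * real n * (\<Sum>i<d. (b i)\<^sup>2)) sequentially"
    using sigma_pos by (intro square_sum_lower_bound Z_orthogonal Z_diagonal) auto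
  moreover have "eventually (\<lambda>n. \<bar>E n\<bar> \<le> 4 * \<tau> * real n) sequentially"
    unfolding E_def by (rule sublinear_eventually[OF disturbed_noise_sublinear]) (use \<tau> in simp)
  moreover have "eventually (\<lambda>n. \<bar>K n\<bar> \<le> \<tau> / (c1 * c2) * real n) sequentially"
    unfolding K_def by (rule sublinear_eventually[OF undisturbed_discrepancy_sublinear]) (use \<tau> c1(1) c2(1) in simp)
  moreover have "eventually (\<lambda>n. n \<ge> p + 2) sequentially" by (rule eventually_ge_at_top)
  ultimately have "eventually (\<lambda>n. \<forall>w. (\<Sum>k<n + (p + 2). (\<Sum>i<d. w i * \<Phi> k $ i)\<^sup>2)
      \<ge> \<tau> / (2 * c1) * real (n + (p + 2)) * (\<Sum>i<d. (w i)\<^sup>2)) sequentially"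
  proof eventually_elim
    case (elim n)
    show ?case
    proof
      fix w
      define b where "b = noise_coeff w"
      define a where "a = state_coeff w"
      define W where "W = (\<Sum>i<d. (w i)\<^sup>2)"
      define BB where "BB = (\<Sum>i<d. (b i)\<^sup>2)"
      define AA where "AA = (\<Sum>i\<le>p. (a i)\<^sup>2)"
      have nonneg: "W \<ge> 0" "BB \<ge> 0" "AA \<ge> 0" by (simp_all add: W_def BB_def AA_def sum_nonneg)
      have W_BB: "W \<le> c1 * BB" unfolding W_def BB_def b_def by (rule c1(2))
      have AA_W: "AA \<le> c2 * W" unfolding W_def AA_def a_def by (rule c2(2))
      have step: "(\<Sum>i<d. w i * \<Phi> (m + (p + 2)) $ i)\<^sup>2 \<ge> 1/2 * (\<Sum>i<d. b i * Z m i)\<^sup>2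
          - 1/2 * BB * (if disturbed m then (\<Sum>i<d. (Z m i)\<^sup>2) else 0)
          - AA * (if disturbed m then 0 else (\<Sum>i\<le>p. (discrepancy m i)\<^sup>2))" for m
      proof (cases "disturbed m")
        case True
        have "(\<Sum>i<d. b i * Z m i)\<^sup>2 \<le> BB * (\<Sum>i<d. (Z m i)\<^sup>2)"
          unfolding BB_def by (rule Cauchy_Schwarz_ineq_sum)
        then have "1/2 * (\<Sum>i<d. b i * Z m i)\<^sup>2 - 1/2 * BB * (\<Sum>i<d. (Z m i)\<^sup>2) \<le> 0" by simp
        also have "0 \<le> (\<Sum>i<d. w i * \<Phi> (m + (p + 2)) $ i)\<^sup>2" by simp
        finally show ?thesis using True by simp
      next
        case False
        define u where "u = (\<Sum>i<d. b i * Z m i)"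
        define h where "h = (\<Sum>i\<le>p. a i * discrepancy m i)"
        have h: "h\<^sup>2 \<le> AA * (\<Sum>i\<le>p. (discrepancy m i)\<^sup>2)"
          unfolding AA_def h_def by (rule Cauchy_Schwarz_ineq_sum)
        have "u\<^sup>2 \<le> 2 * (u + h)\<^sup>2 + 2 * h\<^sup>2" using square_add_le[of "u + h" "- h"] by simp
        moreover have "(\<Sum>i<d. w i * \<Phi> (m + (p + 2)) $ i) = u + h"
          using regressor_decomposition[of w m] by (simp only: u_def h_def a_def b_def add.assoc)
        ultimately show ?thesis using h False unfolding u_def[symmetric] by simp
      qed
      have "\<tau> / c1 * real n * W \<le> 1/2 * (8 * \<tau> * real n * BB) - 1/2 * BB * (4 * \<tau> * real n) - AA * (\<tau> / (c1 * c2) * real n)"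
      proof -
        have "AA * (\<tau> / (c1 * c2) * real n) \<le> (c2 * W) * (\<tau> / (c1 * c2) * real n)"
          using \<tau> c1(1) c2(1) by (intro mult_right_mono AA_W) auto
        also have "\<dots> = \<tau> / c1 * real n * W" using c2(1) by simp
        finally have "AA * (\<tau> / (c1 * c2) * real n) \<le> \<tau> / c1 * real n * W" .
        moreover have "\<tau> / c1 * real n * W \<le> \<tau> / c1 * real n * (c1 * BB)"
          using \<tau> c1(1) by (intro mult_left_mono W_BB) auto
        moreover have "\<tau> / c1 * real n * (c1 * BB) = \<tau> * real n * BB" using c1(1) by simp
        ultimately show ?thesis by (simp add: algebra_simps)
      qed
      also have "\<dots> \<le> 1/2 * (\<Sum>m<n. (\<Sum>i<d. b i * Z m i)\<^sup>2) - 1/2 * BB * E n - AA * K n"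
      proof -
        have "8 * \<tau> * real n * BB \<le> (\<Sum>m<n. (\<Sum>i<d. b i * Z m i)\<^sup>2)"
          using elim(1)[rule_format, of b] by (simp add: \<tau>_def BB_def)
        moreover have "1/2 * BB * E n \<le> 1/2 * BB * (4 * \<tau> * real n)"
          using elim(2) nonneg(2) by (intro mult_left_mono) auto
        moreover have "AA * K n \<le> AA * (\<tau> / (c1 * c2) * real n)"
          using elim(3) nonneg(3) by (intro mult_left_mono) auto
        ultimately show ?thesis by linarith
      qed
      also have "\<dots> \<le> (\<Sum>m<n. (\<Sum>i<d. w i * \<Phi> (m + (p + 2)) $ i)\<^sup>2)"
        using sum_mono[of "{..<n}", OF step]
        unfolding E_def K_def sum_subtractf sum_distrib_left[symmetric] .
      also have "\<dots> \<le> (\<Sum>k<n + (p + 2). (\<Sum>i<d. w i * \<Phi> k $ i)\<^sup>2)"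
        by (rule sum_shift_le) simp_all
      finally have "\<tau> / c1 * real n * W \<le> (\<Sum>k<n + (p + 2). (\<Sum>i<d. w i * \<Phi> k $ i)\<^sup>2)" .
      moreover have "\<tau> / (2 * c1) * real (n + (p + 2)) * W \<le> \<tau> / c1 * real n * W"
      proof (rule mult_right_mono[OF _ nonneg(1)])
        have "\<tau> / (2 * c1) * real (n + (p + 2)) \<le> \<tau> / (2 * c1) * (2 * real n)"
          using elim(4) \<tau> c1(1) by (intro mult_left_mono) auto
        then show "\<tau> / (2 * c1) * real (n + (p + 2)) \<le> \<tau> / c1 * real n" by simp
      qed
      ultimately show "\<tau> / (2 * c1) * real (n + (p + 2)) * (\<Sum>i<d. (w i)\<^sup>2) \<le> (\<Sum>k<n + (p + 2). (\<Sum>i<d. w i * \<Phi> k $ i)\<^sup>2)"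
        unfolding W_def by linarith
    qed
  qed
  then have "eventually (\<lambda>n. \<forall>w. (\<Sum>k<n. (\<Sum>i<d. w i * \<Phi> k $ i)\<^sup>2)
      \<ge> \<tau> / (2 * c1) * real n * (\<Sum>i<d. (w i)\<^sup>2)) sequentially"
    by (rule eventually_sequentially_seg[THEN iffD1])
  then show ?thesis using \<tau> c1(1) by (intro exI[of _ "\<tau> / (2 * c1)"]) simp
qed

text \<open>
  The excitation bounds the energy from below by a multiple of \<open>n\<close> times the squared error.
\<close>

theorem estimation_error_rate:
  "(\<lambda>n. e n \<bullet> e n) \<in> O(\<lambda>n. ln (real n) / real n)"
proof -
  obtain c where c: "c > 0" and exc: "eventually (\<lambda>n. \<forall>w. (\<Sum>k<n. (\<Sum>i<d. w i * \<Phi> k $ i)\<^sup>2) \<ge> c * real n * (\<Sum>i<d. (w i)\<^sup>2)) sequentially"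
    using excitation by blast
  obtain C where C: "C > 0" "\<And>n. v n \<le> C * (1 + ln (real (Suc n)))" using log_bounds by blast
  have "eventually (\<lambda>n. 1 + ln (real (Suc n)) \<le> 3 * ln (real n)) sequentially" by real_asymp
  with exc have "eventually (\<lambda>n. norm (e n \<bullet> e n) \<le> 3 * C / c * norm (ln (real n) / real n)) sequentially"
    using eventually_gt_at_top[of 0]
  proof eventually_elim
    case (elim n)
    have ee: "e n \<bullet> e n = (\<Sum>i<d. (e n $ i)\<^sup>2)"
      unfolding scalar_prod_def carrier_vecD[OF e_carrier[of n]] by (simp add: lessThan_atLeast0 power2_eq_square)
    have pe: "(\<Sum>i<d. e n $ i * \<Phi> k $ i) = \<Phi> k \<bullet> e n" for k
      unfolding scalar_prod_def carrier_vecD[OF e_carrier[of n]] by (simp add: lessThan_atLeast0 mult.commute)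
    have "c * real n * (e n \<bullet> e n) \<le> (\<Sum>k<n. (\<Phi> k \<bullet> e n)\<^sup>2)"
      using elim(1)[rule_format, of "\<lambda>i. e n $ i"] by (simp add: ee pe)
    also have "\<dots> \<le> v n"
      unfolding v_def gram_form[OF e_carrier e_carrier] by (simp add: power2_eq_square scalar_prod_self_nonneg)
    also have "\<dots> \<le> C * (3 * ln (real n))"
      using C(2)[of n] mult_left_mono[OF elim(2), of C] C(1) by linarith
    finally have "e n \<bullet> e n \<le> 3 * C / c * (ln (real n) / real n)"
      using c elim(3) by (simp add: field_simps)
    also have "\<dots> \<le> 3 * C / c * norm (ln (real n) / real n)"
      using c C(1) by (intro mult_left_mono) (simp_all only: real_norm_def abs_ge_self, simp)
    finally show ?case by (simp add: scalar_prod_self_nonneg)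
  qed
  then show ?thesis by (rule bigoI)
qed

end

section \<open>Measurability of the closed loop\<close>

lemma regression_vector_carrier: "regression_vector p X U n \<omega> \<in> carrier_vec (p + 2)"
proof -
  have "vec_of_list [U (int n - 1) \<omega>] \<in> carrier_vec 1" by (rule carrier_vecI) simp
  then have "regression_vector p X U n \<omega> \<in> carrier_vec ((p + 1) + 1)"
    unfolding regression_vector_def by (rule append_carrier_vec[OF vec_carrier])
  then show ?thesis by simp
qed

lemma regression_vector_index:
  "i \<le> p \<Longrightarrow> regression_vector p X U n \<omega> $ i = X (int n - int i) \<omega>"
  "regression_vector p X U n \<omega> $ (p + 1) = U (int n - 1) \<omega>"
  by (simp_all add: regression_vector_def append_vec_def Let_def)

lemma extended_parameter_carrier:
  assumes "\<theta> \<in> carrier_vec p"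
  shows "extended_parameter \<theta> \<rho> \<in> carrier_vec (p + 2)"
  using assms by (intro carrier_vecI) (simp add: extended_parameter_def)

lemma extended_parameter_index:
  assumes "\<theta> \<in> carrier_vec p" "i < p + 2"
  shows "extended_parameter \<theta> \<rho> $ i = (if i < p then \<theta> $ i else 0)
      - \<rho> * (if i = 0 then -1 else if i \<le> p then \<theta> $ (i - 1) else 1)"
  using assms by (auto simp: extended_parameter_def append_vec_def Let_def)

context filtered_prob_space
begin

lemma borel_measurable_F_cong:
  "(\<And>\<omega>. \<omega> \<in> space M \<Longrightarrow> f \<omega> = f' \<omega>) \<Longrightarrow> f \<in> borel_measurable (F n) \<longleftrightarrow> f' \<in> borel_measurable (F n)"
  by (rule measurable_cong) simp

lemma borel_measurable_scalar_prod:
  assumes "\<And>\<omega>. \<omega> \<in> space M \<Longrightarrow> dim_vec (b \<omega>) = d"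
    and "\<And>i. i < d \<Longrightarrow> (\<lambda>\<omega>. a \<omega> $ i) \<in> borel_measurable (F n)"
    and "\<And>i. i < d \<Longrightarrow> (\<lambda>\<omega>. b \<omega> $ i) \<in> borel_measurable (F n)"
  shows "(\<lambda>\<omega>. a \<omega> \<bullet> b \<omega> :: real) \<in> borel_measurable (F n)"
proof -
  have "(\<lambda>\<omega>. \<Sum>i<d. a \<omega> $ i * b \<omega> $ i) \<in> borel_measurable (F n)"
    using assms(2,3) by (intro borel_measurable_sum borel_measurable_times) auto
  also have "?this \<longleftrightarrow> ?thesis"
    using assms(1) by (intro borel_measurable_F_cong) (simp add: scalar_prod_def lessThan_atLeast0)
  finally show ?thesis .
qed

lemma borel_measurable_mult_mat_vec:
  fixes A :: "'a \<Rightarrow> real mat"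
  assumes "\<And>\<omega>. A \<omega> \<in> carrier_mat d d" "\<And>\<omega>. b \<omega> \<in> carrier_vec d"
    and "\<And>i j. i < d \<Longrightarrow> j < d \<Longrightarrow> (\<lambda>\<omega>. A \<omega> $$ (i, j)) \<in> borel_measurable (F n)"
    and "\<And>i. i < d \<Longrightarrow> (\<lambda>\<omega>. b \<omega> $ i) \<in> borel_measurable (F n)"
    and "i < d"
  shows "(\<lambda>\<omega>. (A \<omega> *\<^sub>v b \<omega>) $ i) \<in> borel_measurable (F n)"
proof -
  have "(A \<omega> *\<^sub>v b \<omega>) $ i = (\<Sum>j<d. A \<omega> $$ (i, j) * b \<omega> $ j)" for \<omega>
    using assms(5) carrier_matD[OF assms(1)[of \<omega>]] carrier_vecD[OF assms(2)[of \<omega>]]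
    by (simp add: scalar_prod_def lessThan_atLeast0)
  then show ?thesis
    using assms(3,4,5) by (simp only:) (intro borel_measurable_sum borel_measurable_times, auto)
qed

lemma borel_measurable_gram_inv:
  fixes \<Phi> :: "nat \<Rightarrow> 'a \<Rightarrow> real vec"
  assumes car: "\<And>k \<omega>. \<Phi> k \<omega> \<in> carrier_vec d"
    and meas: "\<And>k i. k < n \<Longrightarrow> i < d \<Longrightarrow> (\<lambda>\<omega>. \<Phi> k \<omega> $ i) \<in> borel_measurable (F m)"
  shows "i < d \<Longrightarrow> j < d \<Longrightarrow> (\<lambda>\<omega>. gram_inv d (\<lambda>k. \<Phi> k \<omega>) n $$ (i, j)) \<in> borel_measurable (F m)"
  using meas
proof (induction n arbitrary: i j)
  case 0
  then show ?case by simp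
next
  case (Suc n)
  interpret RG: regressors d "\<lambda>k. \<Phi> k \<omega>" for \<omega> by unfold_locales (rule car)
  let ?Q = "\<lambda>\<omega>. gram_inv d (\<lambda>k. \<Phi> k \<omega>) n"
  have Q: "(\<lambda>\<omega>. ?Q \<omega> $$ (i, j)) \<in> borel_measurable (F m)" if "i < d" "j < d" for i j
    using Suc.IH[OF that] Suc.prems by auto
  have phi: "(\<lambda>\<omega>. \<Phi> n \<omega> $ i) \<in> borel_measurable (F m)" if "i < d" for i
    using Suc.prems that by auto
  have Qphi: "(\<lambda>\<omega>. (?Q \<omega> *\<^sub>v \<Phi> n \<omega>) $ i) \<in> borel_measurable (F m)" if "i < d" for i
    by (rule borel_measurable_mult_mat_vec[OF RG.gram_inv_carrier car Q phi that])
  have g: "(\<lambda>\<omega>. \<Phi> n \<omega> \<bullet> (?Q \<omega> *\<^sub>v \<Phi> n \<omega>)) \<in> borel_measurable (F m)"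
    by (rule borel_measurable_scalar_prod[where d = d]) (simp_all add: phi Qphi del: index_mult_mat_vec)
  have "(\<lambda>\<omega>. ?Q \<omega> $$ (i, j) - 1 / (1 + \<Phi> n \<omega> \<bullet> (?Q \<omega> *\<^sub>v \<Phi> n \<omega>)) *
      ((?Q \<omega> *\<^sub>v \<Phi> n \<omega>) $ i * (?Q \<omega> *\<^sub>v \<Phi> n \<omega>) $ j)) \<in> borel_measurable (F m)"
    using Q[OF Suc.prems(1,2)] Qphi[OF Suc.prems(1)] Qphi[OF Suc.prems(2)] g
    by (intro borel_measurable_diff borel_measurable_times borel_measurable_divide borel_measurable_add borel_measurable_const)
  moreover have "gram_inv d (\<lambda>k. \<Phi> k \<omega>) (Suc n) $$ (i, j) = ?Q \<omega> $$ (i, j) - 1 / (1 + \<Phi> n \<omega> \<bullet> (?Q \<omega> *\<^sub>v \<Phi> n \<omega>)) *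
      ((?Q \<omega> *\<^sub>v \<Phi> n \<omega>) $ i * (?Q \<omega> *\<^sub>v \<Phi> n \<omega>) $ j)" for \<omega>
    using Suc.prems(1,2) by (simp add: rank_one_def)
  ultimately show ?case by simp
qed

lemma borel_measurable_leverage:
  fixes \<Phi> :: "nat \<Rightarrow> 'a \<Rightarrow> real vec"
  assumes car: "\<And>k \<omega>. \<Phi> k \<omega> \<in> carrier_vec d"
    and meas: "\<And>k i. k \<le> n \<Longrightarrow> i < d \<Longrightarrow> (\<lambda>\<omega>. \<Phi> k \<omega> $ i) \<in> borel_measurable (F m)"
  shows "(\<lambda>\<omega>. leverage d (\<lambda>k. \<Phi> k \<omega>) n) \<in> borel_measurable (F m)"
proof -
  interpret RG: regressors d "\<lambda>k. \<Phi> k \<omega>" for \<omega> by unfold_locales (rule car)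
  let ?Q = "\<lambda>\<omega>. gram_inv d (\<lambda>k. \<Phi> k \<omega>) n"
  have Q: "(\<lambda>\<omega>. ?Q \<omega> $$ (i, j)) \<in> borel_measurable (F m)" if "i < d" "j < d" for i j
    using borel_measurable_gram_inv[OF car _ that] meas by auto
  have Qphi: "(\<lambda>\<omega>. (?Q \<omega> *\<^sub>v \<Phi> n \<omega>) $ i) \<in> borel_measurable (F m)" if "i < d" for i
    by (rule borel_measurable_mult_mat_vec[OF RG.gram_inv_carrier car Q meas[OF order_refl] that])
  show ?thesis unfolding leverage_def
    by (rule borel_measurable_scalar_prod[where d = d]) (simp_all add: meas Qphi del: index_mult_mat_vec)
qed

end

section \<open>Almost sure rate of the least squares estimator\<close>

theorem theorem3p1:
  fixes M :: "'a measure"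
    and F :: "nat \<Rightarrow> 'a measure"
    and p :: nat
    and \<theta> :: "real vec"
    and \<rho> sigma_sq :: real
    and X U :: "int \<Rightarrow> 'a \<Rightarrow> real"
    and \<epsilon> V x :: "nat \<Rightarrow> 'a \<Rightarrow> real"
    and \<theta>h :: "nat \<Rightarrow> 'a \<Rightarrow> real vec"
  defines "\<Phi> \<equiv> \<lambda>n \<omega>. regression_vector p X U n \<omega>"
    and "\<Theta> \<equiv> extended_parameter \<theta> \<rho>"
  assumes prob: "prob_space M"
    and filt: "filtration (space M) F"
    and subalg: "\<And>n. subalgebra M (F n)"
    and p_pos: "p \<ge> 1"
    and theta_dim: "\<theta> \<in> carrier_vec p"
    and rho: "\<bar>\<rho>\<bar> < 1"
    and rho_nz: "\<rho> \<noteq> 0"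
    and sigma_pos: "sigma_sq > 0"
    \<comment> \<open>driving noise\<close>
    and mds: "martingale_difference M F V"
    and var: "constant_conditional_variance M F V sigma_sq"
    and moment: "finite_conditional_moment_gt2 M F V"
    \<comment> \<open>initial values\<close>
    and X_init: "\<And>k. k \<le> 0 \<Longrightarrow> X k \<in> borel_measurable (F 0)"
    and eps_init: "\<epsilon> 0 \<in> borel_measurable (F 0)"
    and U_init: "U 0 \<in> borel_measurable (F 0)" "U (-1) \<in> borel_measurable (F 0)"
    and est_init: "\<And>i. i < p + 2 \<Longrightarrow> (\<lambda>\<omega>. \<theta>h 0 \<omega> $ i) \<in> borel_measurable (F 0)"
    \<comment> \<open>model\<close>
    and X_eq: "\<And>n \<omega>. \<omega> \<in> space M \<Longrightarrow>
      X (int n + 1) \<omega> =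
        (\<Sum>k=1..p. \<theta> $ (k - 1) * X (int n - int k + 1) \<omega>) + U (int n) \<omega> + \<epsilon> (Suc n) \<omega>"
    and eps_eq: "\<And>n \<omega>. \<omega> \<in> space M \<Longrightarrow> \<epsilon> (Suc n) \<omega> = \<rho> * \<epsilon> n \<omega> + V (Suc n) \<omega>"
    \<comment> \<open>estimator and adaptive tracking control\<close>
    and estimator: "\<And>\<omega>. \<omega> \<in> space M \<Longrightarrow>
      least_squares_estimator (p + 2) (\<lambda>n. \<Phi> n \<omega>) (\<lambda>k. X k \<omega>) (\<lambda>k. U k \<omega>) (\<lambda>n. \<theta>h n \<omega>)"
    and control: "\<And>n \<omega>. n \<ge> 1 \<Longrightarrow> \<omega> \<in> space M \<Longrightarrow>
      U (int n) \<omega> = x (n + 1) \<omega> - \<theta>h n \<omega> \<bullet> \<Phi> n \<omega>"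
    and x_predictable: "\<And>n. x (Suc n) \<in> borel_measurable (F n)"
    and x_small: "AE \<omega> in M. (\<lambda>n. \<Sum>k=1..n. (x k \<omega>)\<^sup>2) \<in> o(\<lambda>n. real n)"
  shows "AE \<omega> in M.
    (\<lambda>n. vec_norm2 (\<theta>h n \<omega> - \<Theta>)) \<longlonglongrightarrow> 0 \<and>
    (\<lambda>n. (vec_norm2 (\<theta>h n \<omega> - \<Theta>))\<^sup>2) \<in> O(\<lambda>n. ln (real n) / real n)"
proof -
  obtain q \<kappa> where noise: "driving_noise M F V sigma_sq q \<kappa>"
    using driving_noise_of_moment[OF prob filt subalg sigma_pos mds var moment] .
  interpret driving_noise M F V sigma_sq q \<kappa> by (rule noise)
  define d where "d = p + 2"
  have \<Phi>_carrier: "\<Phi> n \<omega> \<in> carrier_vec d" for n \<omega>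
    unfolding \<Phi>_def d_def by (rule regression_vector_carrier)
  have \<Phi>_X: "\<Phi> n \<omega> $ i = X (int n - int i) \<omega>" if "i \<le> p" for n i \<omega>
    unfolding \<Phi>_def using that by (rule regression_vector_index)
  have \<Phi>_U: "\<Phi> n \<omega> $ (p + 1) = U (int n - 1) \<omega>" for n \<omega>
    unfolding \<Phi>_def by (rule regression_vector_index)
  have \<Theta>_carrier: "\<Theta> \<in> carrier_vec d"
    unfolding \<Theta>_def d_def by (rule extended_parameter_carrier[OF theta_dim])
  have loop: "closed_loop p d \<theta> \<rho> (\<lambda>k. X k \<omega>) (\<lambda>k. U k \<omega>) (\<lambda>n. \<epsilon> n \<omega>) (\<lambda>n. V n \<omega>) (\<lambda>n. x n \<omega>)
      (\<lambda>n. \<Phi> n \<omega>) (\<lambda>n. \<theta>h n \<omega>) \<Theta>" if \<omega>: "\<omega> \<in> space M" for \<omega>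
  proof unfold_locales
    show "X (int n + 1) \<omega> = (\<Sum>k<p. \<theta> $ k * X (int n - int k) \<omega>) + U (int n) \<omega> + \<epsilon> (Suc n) \<omega>" for n
      using X_eq[OF \<omega>, of n] by (simp add: sum.atLeast1_atMost_eq)
    show "\<Theta> $ i = (if i < p then \<theta> $ i else 0) - \<rho> * (if i = 0 then - 1 else if i \<le> p then \<theta> $ (i - 1) else 1)"
      if "i < p + 2" for i
      unfolding \<Theta>_def by (rule extended_parameter_index[OF theta_dim that])
    show "least_squares_estimator d (\<lambda>n. \<Phi> n \<omega>) (\<lambda>k. X k \<omega>) (\<lambda>k. U k \<omega>) (\<lambda>n. \<theta>h n \<omega>)"
      unfolding d_def by (rule estimator[OF \<omega>])
  qed (use d_def rho rho_nz eps_eq \<omega> \<Phi>_carrier \<Phi>_X \<Phi>_U \<Theta>_carrier control in auto)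
  interpret RG: regressors d "\<lambda>k. \<Phi> k \<omega>" for \<omega> by unfold_locales (rule \<Phi>_carrier)
  have \<theta>h_carrier: "\<theta>h n \<omega> \<in> carrier_vec d" if "\<omega> \<in> space M" for n \<omega>
  proof -
    interpret closed_loop p d \<theta> \<rho> "\<lambda>k. X k \<omega>" "\<lambda>k. U k \<omega>" "\<lambda>n. \<epsilon> n \<omega>" "\<lambda>n. V n \<omega>" "\<lambda>n. x n \<omega>"
      "\<lambda>n. \<Phi> n \<omega>" "\<lambda>n. \<theta>h n \<omega>" \<Theta> by (rule loop[OF that])
    show ?thesis by (rule estimator_carrier)
  qed
  have \<theta>h_Suc: "\<theta>h (Suc n) \<omega> $ i = \<theta>h n \<omega> $ i + (X (int n + 1) \<omega> - U (int n) \<omega> - \<theta>h n \<omega> \<bullet> \<Phi> n \<omega>) *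
      (\<Sum>j<d. gram_inv d (\<lambda>k. \<Phi> k \<omega>) (Suc n) $$ (i, j) * \<Phi> n \<omega> $ j)"
    if "\<omega> \<in> space M" "i < d" for n i \<omega>
  proof -
    have "\<theta>h (Suc n) \<omega> = \<theta>h n \<omega> + (X (int n + 1) \<omega> - U (int n) \<omega> - \<theta>h n \<omega> \<bullet> \<Phi> n \<omega>) \<cdot>\<^sub>v
         (the (mat_inverse (design_matrix d (\<lambda>k. \<Phi> k \<omega>) n)) *\<^sub>v \<Phi> n \<omega>)"
      using estimator[OF that(1)] unfolding least_squares_estimator_def d_def by blast
    also have "the (mat_inverse (design_matrix d (\<lambda>k. \<Phi> k \<omega>) n)) = gram_inv d (\<lambda>k. \<Phi> k \<omega>) (Suc n)"
      unfolding design_matrix_eq_gram[of "\<lambda>k. \<Phi> k \<omega>", OF \<Phi>_carrier] RG.mat_inverse_gram by simp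
    finally show ?thesis
      using that(2) RG.dim_gram(3)[of \<omega> "Suc n"] RG.dim_gram(4)[of \<omega> "Suc n"]
      by (simp add: scalar_prod_def lessThan_atLeast0 del: gram_inv.simps)
  qed
  \<comment> \<open>The control, the estimator and the state are adapted by simultaneous induction.\<close>
  have adapted: "(\<forall>k\<le>int n. X k \<in> borel_measurable (F n)) \<and> \<epsilon> n \<in> borel_measurable (F n)
      \<and> U (int n - 1) \<in> borel_measurable (F n) \<and> (\<forall>i<d. (\<lambda>\<omega>. \<theta>h n \<omega> $ i) \<in> borel_measurable (F n))
      \<and> (\<forall>m\<le>n. \<forall>i<d. (\<lambda>\<omega>. \<Phi> m \<omega> $ i) \<in> borel_measurable (F n))
      \<and> U (int n) \<in> borel_measurable (F n)" for n
  proof -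
    have \<Phi>_meas: "(\<lambda>\<omega>. \<Phi> n \<omega> $ i) \<in> borel_measurable (F n)"
      if "\<forall>k\<le>int n. X k \<in> borel_measurable (F n)" "U (int n - 1) \<in> borel_measurable (F n)" "i < d" for n i
    proof (cases "i \<le> p")
      case True
      then have "(\<lambda>\<omega>. \<Phi> n \<omega> $ i) = X (int n - int i)" by (simp add: fun_eq_iff \<Phi>_X)
      then show ?thesis using that(1) by simp
    next
      case False
      then have "i = p + 1" using that(3) by (simp add: d_def)
      then have "(\<lambda>\<omega>. \<Phi> n \<omega> $ i) = U (int n - 1)" using \<Phi>_U by (simp add: fun_eq_iff)
      then show ?thesis using that(2) by simp
    qed
    have dim: "dim_vec (\<Phi> n \<omega>) = d" for n \<omega> using \<Phi>_carrier by simp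
    show ?thesis
    proof (induction n)
      case 0
      show ?case using X_init eps_init U_init est_init \<Phi>_meas[of 0] by (auto simp: d_def)
    next
      case (Suc n)
      have \<theta>h0: "i < d \<Longrightarrow> (\<lambda>\<omega>. \<theta>h n \<omega> $ i) \<in> borel_measurable (F n)"
        and \<Phi>0: "m \<le> n \<Longrightarrow> i < d \<Longrightarrow> (\<lambda>\<omega>. \<Phi> m \<omega> $ i) \<in> borel_measurable (F n)"
        and X0: "k \<le> int n \<Longrightarrow> X k \<in> borel_measurable (F n)" for i m k
        using Suc by blast+
      note mono = borel_measurable_F_mono[of _ n "Suc n", OF _ le_SucI[OF order_refl]]
      have eps0: "\<epsilon> n \<in> borel_measurable (F (Suc n))" and Un: "U (int n) \<in> borel_measurable (F (Suc n))"
        by (rule mono, use Suc in blast)+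
      have eps: "\<epsilon> (Suc n) \<in> borel_measurable (F (Suc n))"
      proof -
        have "(\<lambda>\<omega>. \<rho> * \<epsilon> n \<omega> + V (Suc n) \<omega>) \<in> borel_measurable (F (Suc n))"
          using eps0 V_measurable[of n] by (intro borel_measurable_add borel_measurable_times borel_measurable_const)
        then show ?thesis using eps_eq by (subst borel_measurable_F_cong)
      qed
      have X1: "X (int n + 1) \<in> borel_measurable (F (Suc n))"
      proof -
        have "(\<lambda>\<omega>. (\<Sum>k=1..p. \<theta> $ (k - 1) * X (int n - int k + 1) \<omega>) + U (int n) \<omega> + \<epsilon> (Suc n) \<omega>) \<in> borel_measurable (F (Suc n))"
          using Un eps
          by (intro borel_measurable_add borel_measurable_sum borel_measurable_times borel_measurable_const mono[OF X0]) auto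
        then show ?thesis using X_eq by (subst borel_measurable_F_cong)
      qed
      have X: "\<forall>k\<le>int (Suc n). X k \<in> borel_measurable (F (Suc n))"
      proof (intro allI impI)
        fix k assume "k \<le> int (Suc n)"
        then consider "k = int n + 1" | "k \<le> int n" by linarith
        then show "X k \<in> borel_measurable (F (Suc n))" by cases (use X1 mono[OF X0] in auto)
      qed
      have U0: "U (int (Suc n) - 1) \<in> borel_measurable (F (Suc n))" using Un by simp
      have \<Phi>: "\<forall>m\<le>Suc n. \<forall>i<d. (\<lambda>\<omega>. \<Phi> m \<omega> $ i) \<in> borel_measurable (F (Suc n))"
      proof (intro allI impI)
        fix m i assume "m \<le> Suc n" "i < d"
        then consider "m = Suc n" | "m \<le> n" by linarith
        then show "(\<lambda>\<omega>. \<Phi> m \<omega> $ i) \<in> borel_measurable (F (Suc n))"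
          by cases (use \<Phi>_meas[OF X U0 \<open>i < d\<close>] mono[OF \<Phi>0[OF _ \<open>i < d\<close>]] in auto)
      qed
      have \<theta>h: "(\<lambda>\<omega>. \<theta>h (Suc n) \<omega> $ i) \<in> borel_measurable (F (Suc n))" if i: "i < d" for i
      proof -
        have Q: "(\<lambda>\<omega>. gram_inv d (\<lambda>k. \<Phi> k \<omega>) (Suc n) $$ (i, j)) \<in> borel_measurable (F (Suc n))" if "j < d" for j
          using \<Phi> by (intro borel_measurable_gram_inv[OF \<Phi>_carrier _ i that]) auto
        have sp: "(\<lambda>\<omega>. \<theta>h n \<omega> \<bullet> \<Phi> n \<omega>) \<in> borel_measurable (F (Suc n))"
          using \<Phi> by (intro borel_measurable_scalar_prod[OF dim] mono[OF \<theta>h0]) auto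
        have "(\<lambda>\<omega>. \<theta>h n \<omega> $ i + (X (int n + 1) \<omega> - U (int n) \<omega> - \<theta>h n \<omega> \<bullet> \<Phi> n \<omega>) *
            (\<Sum>j<d. gram_inv d (\<lambda>k. \<Phi> k \<omega>) (Suc n) $$ (i, j) * \<Phi> n \<omega> $ j)) \<in> borel_measurable (F (Suc n))"
          using \<Phi> Q
          by (intro borel_measurable_add borel_measurable_times borel_measurable_diff borel_measurable_sum
              mono[OF \<theta>h0[OF i]] X1 Un sp) auto
        then show ?thesis using \<theta>h_Suc[OF _ i] by (subst borel_measurable_F_cong)
      qed
      have U1: "U (int (Suc n)) \<in> borel_measurable (F (Suc n))"
      proof -
        have "(\<lambda>\<omega>. \<theta>h (Suc n) \<omega> \<bullet> \<Phi> (Suc n) \<omega>) \<in> borel_measurable (F (Suc n))"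
          using \<theta>h \<Phi> by (intro borel_measurable_scalar_prod[OF dim]) auto
        then have "(\<lambda>\<omega>. x (Suc n + 1) \<omega> - \<theta>h (Suc n) \<omega> \<bullet> \<Phi> (Suc n) \<omega>) \<in> borel_measurable (F (Suc n))"
          using x_predictable[of "Suc n"] by (intro borel_measurable_diff) simp_all
        then show ?thesis using control[of "Suc n"] by (subst borel_measurable_F_cong) auto
      qed
      show ?case using X eps U0 \<Phi> \<theta>h U1 by blast
    qed
  qed
  have \<theta>h_F: "i < d \<Longrightarrow> (\<lambda>\<omega>. \<theta>h n \<omega> $ i) \<in> borel_measurable (F n)"
    and \<Phi>_F: "m \<le> n \<Longrightarrow> i < d \<Longrightarrow> (\<lambda>\<omega>. \<Phi> m \<omega> $ i) \<in> borel_measurable (F n)"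
    and \<epsilon>_F: "\<epsilon> n \<in> borel_measurable (F n)" for i m n
    using adapted[of n] by blast+
  define lev where "lev n \<omega> = leverage d (\<lambda>k. \<Phi> k \<omega>) n" for n \<omega>
  define pr where "pr n \<omega> = (\<theta>h n \<omega> - \<Theta>) \<bullet> \<Phi> n \<omega>" for n \<omega>
  have lev_F: "lev n \<in> borel_measurable (F n)" for n
    unfolding lev_def by (rule borel_measurable_leverage[OF \<Phi>_carrier \<Phi>_F])
  have lev_nonneg: "lev n \<omega> \<ge> 0" for n \<omega> unfolding lev_def by (rule RG.leverage_nonneg)
  have pr_F: "pr n \<in> borel_measurable (F n)" for n
    unfolding pr_def
  proof (rule borel_measurable_scalar_prod)
    show "dim_vec (\<Phi> n \<omega>) = d" for \<omega> using \<Phi>_carrier by simp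
    show "(\<lambda>\<omega>. (\<theta>h n \<omega> - \<Theta>) $ i) \<in> borel_measurable (F n)" if "i < d" for i
    proof -
      have "(\<lambda>\<omega>. \<theta>h n \<omega> $ i - \<Theta> $ i) \<in> borel_measurable (F n)"
        using \<theta>h_F[OF that] by (intro borel_measurable_diff borel_measurable_const)
      moreover have "(\<lambda>\<omega>. (\<theta>h n \<omega> - \<Theta>) $ i) = (\<lambda>\<omega>. \<theta>h n \<omega> $ i - \<Theta> $ i)"
        using that \<Theta>_carrier by (simp add: fun_eq_iff)
      ultimately show ?thesis by simp
    qed
    show "(\<lambda>\<omega>. \<Phi> n \<omega> $ i) \<in> borel_measurable (F n)" if "i < d" for i
      by (rule \<Phi>_F[OF order_refl that])
  qed
  have ratio_F: "(\<lambda>\<omega>. pr n \<omega> / (1 + lev n \<omega>)) \<in> borel_measurable (F n)"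
    "(\<lambda>\<omega>. lev n \<omega> / (1 + lev n \<omega>)) \<in> borel_measurable (F n)" for n
    using pr_F[of n] lev_F[of n] by measurable
  have V_lag: "(\<lambda>\<omega>. if s < k then V (k - s) \<omega> else 0) \<in> borel_measurable (F k)" for s k
  proof (cases "s < k")
    case True
    then obtain j where "k - s = Suc j" by (cases "k - s") auto
    then show ?thesis using True borel_measurable_F_mono[OF V_measurable[of j], of k] by simp
  qed simp
  have eps_lag: "(\<lambda>\<omega>. if s \<le> k then \<epsilon> (k - s) \<omega> else 0) \<in> borel_measurable (F k)" for s k
    using borel_measurable_F_mono[OF \<epsilon>_F[of "k - s"], of k] by (cases "s \<le> k") simp_all
  define \<delta> where "\<delta> = (1 + q) / (2 * q)"
  have \<delta>: "\<delta> > 0" "\<delta> < 1" using q_gt by (simp_all add: \<delta>_def)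
  \<comment> \<open>The weighted noise sums that make almost every trajectory regular.\<close>
  have noise1: "AE \<omega> in M. \<forall>\<eta>>0. \<exists>C. \<forall>n. \<bar>\<Sum>k<n. pr k \<omega> / (1 + lev k \<omega>) * V (Suc k) \<omega>\<bar>
      \<le> C + \<eta> * (\<Sum>k<n. (pr k \<omega> / (1 + lev k \<omega>))\<^sup>2)"
    by (rule AE_weighted_noise_sum[OF ratio_F(1)])
  have noise2: "AE \<omega> in M. \<forall>\<eta>>0. \<exists>C. \<forall>n. \<bar>\<Sum>k<n. lev k \<omega> / (1 + lev k \<omega>) * ((V (Suc k) \<omega>)\<^sup>2 - sigma_sq)\<bar>
      \<le> C + \<eta> * (\<Sum>k<n. lev k \<omega> / (1 + lev k \<omega>))"
    by (rule AE_weighted_square_sum[OF ratio_F(2)]) (use lev_nonneg in \<open>simp_all add: divide_le_eq_1 add_pos_nonneg\<close>)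
  have noise3: "AE \<omega> in M. \<forall>\<eta>>0. \<exists>C. \<forall>n. \<bar>\<Sum>k<n. 1 * ((V (Suc k) \<omega>)\<^sup>2 - sigma_sq)\<bar> \<le> C + \<eta> * (\<Sum>k<n. 1)"
    by (rule AE_weighted_square_sum[of "\<lambda>_ _. 1"]) simp_all
  have noise4: "AE \<omega> in M. \<forall>s. \<forall>\<eta>>0. \<exists>C. \<forall>n. \<bar>\<Sum>k<n. (if s < k then V (k - s) \<omega> else 0) * V (Suc k) \<omega>\<bar>
      \<le> C + \<eta> * (\<Sum>k<n. (if s < k then V (k - s) \<omega> else 0)\<^sup>2)"
    by (intro AE_all_countable[THEN iffD2] allI AE_weighted_noise_sum V_lag)
  have noise5: "AE \<omega> in M. \<forall>s. \<forall>\<eta>>0. \<exists>C. \<forall>n. \<bar>\<Sum>k<n. (if s \<le> k then \<epsilon> (k - s) \<omega> else 0) * V (Suc k) \<omega>\<bar>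
      \<le> C + \<eta> * (\<Sum>k<n. (if s \<le> k then \<epsilon> (k - s) \<omega> else 0)\<^sup>2)"
    by (intro AE_all_countable[THEN iffD2] allI AE_weighted_noise_sum eps_lag)
  show ?thesis
    using noise1 noise2 noise3 noise4 noise5 AE_noise_growth x_small AE_space
  proof eventually_elim
    case (elim \<omega>)
    interpret CL: closed_loop p d \<theta> \<rho> "\<lambda>k. X k \<omega>" "\<lambda>k. U k \<omega>" "\<lambda>n. \<epsilon> n \<omega>" "\<lambda>n. V n \<omega>" "\<lambda>n. x n \<omega>"
      "\<lambda>n. \<Phi> n \<omega>" "\<lambda>n. \<theta>h n \<omega>" \<Theta> by (rule loop[OF elim(8)])
    have pr: "CL.\<pi> n = pr n \<omega>" and lev: "leverage d (\<lambda>n. \<Phi> n \<omega>) n = lev n \<omega>" and f: "CL.f n = lev n \<omega> / (1 + lev n \<omega>)" for n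
      by (simp_all add: CL.\<pi>_def CL.e_def CL.f_def pr_def lev_def)
    interpret RP: regular_path p d \<theta> \<rho> "\<lambda>k. X k \<omega>" "\<lambda>k. U k \<omega>" "\<lambda>n. \<epsilon> n \<omega>" "\<lambda>n. V n \<omega>" "\<lambda>n. x n \<omega>"
      "\<lambda>n. \<Phi> n \<omega>" "\<lambda>n. \<theta>h n \<omega>" \<Theta> sigma_sq \<delta>
    proof unfold_locales
      show "\<forall>\<eta>>0. \<exists>C. \<forall>n. \<bar>\<Sum>k<n. CL.\<pi> k / (1 + leverage d (\<lambda>n. \<Phi> n \<omega>) k) * V (Suc k) \<omega>\<bar>
          \<le> C + \<eta> * (\<Sum>k<n. (CL.\<pi> k / (1 + leverage d (\<lambda>n. \<Phi> n \<omega>) k))\<^sup>2)"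
        unfolding pr lev by (rule elim(1))
      show "\<forall>\<eta>>0. \<exists>C. \<forall>n. \<bar>\<Sum>k<n. CL.f k * ((V (Suc k) \<omega>)\<^sup>2 - sigma_sq)\<bar> \<le> C + \<eta> * (\<Sum>k<n. CL.f k)"
        unfolding f by (rule elim(2))
      show "sublinear (\<lambda>n. \<Sum>k<n. (V (Suc k) \<omega>)\<^sup>2 - sigma_sq)"
        using elim(3) by (simp add: sublinear_def)
      show "sublinear (\<lambda>n. \<Sum>k = 1..n. (x k \<omega>)\<^sup>2)"
        using elim(7) by (simp add: sublinear_iff_smallo)
      show "\<exists>C. \<forall>k. (V (Suc k) \<omega>)\<^sup>2 \<le> C * real (Suc k) powr \<delta>"
        unfolding \<delta>_def by (rule elim(6))
    qed (use sigma_pos \<delta> elim(4,5) in blast)+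
    have norm: "vec_norm2 (\<theta>h n \<omega> - \<Theta>) = sqrt (CL.e n \<bullet> CL.e n)" for n
      by (simp add: vec_norm2_def CL.e_def)
    have sq: "(vec_norm2 (\<theta>h n \<omega> - \<Theta>))\<^sup>2 = CL.e n \<bullet> CL.e n" for n
      by (simp add: norm scalar_prod_self_nonneg)
    have rate: "(\<lambda>n. CL.e n \<bullet> CL.e n) \<in> O(\<lambda>n. ln (real n) / real n)"
      by (rule RP.estimation_error_rate)
    have "(\<lambda>n. ln (real n) / real n) \<in> o(\<lambda>_. 1)" by real_asymp
    with rate have "(\<lambda>n. CL.e n \<bullet> CL.e n) \<in> o(\<lambda>_. 1)" by (rule landau_o.big_small_trans)
    then have "(\<lambda>n. CL.e n \<bullet> CL.e n) \<longlonglongrightarrow> 0" using smalloD_tendsto[of "\<lambda>n. CL.e n \<bullet> CL.e n" sequentially "\<lambda>_. 1"] by simp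
    then have "(\<lambda>n. sqrt (CL.e n \<bullet> CL.e n)) \<longlonglongrightarrow> sqrt 0" by (rule tendsto_real_sqrt)
    then show ?case using rate unfolding sq unfolding norm by simp
  qed
qed

end
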